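(* Let $(M,F,\mathfrak m)$ be an $n$-dimensional forward complete Finsler measure space and let $r:=r_o=d_F(o,\cdot)$ be the distance function on $(M,F)$ from some $o\in M$. Put $\Omega:=M\setminus\{o\}$. Let $1<p<n$, $p'=\frac p{p-1}$, and let $G:(0,\sup_\Omega r)\to\mathbb R$ and $H:\mathbb R\to\mathbb R$ be $C^1$ functions such that $G(r)\in L^{p'}_{loc}(\Omega)$, $G'(r)\in L^1_{loc}(\Omega)$ and $H(0)=H'(0)=0$. Then the following inequalities hold. (1) For any $u\in C_0^\infty(M)$, $$\int_M\max\{F^{*p}(\pm du)\}\,d\mathfrak m\ \ge\ p\int_M[G'(r)+G(r)\Delta r]H(u)\,d\mathfrak m-(p-1)\int_M|G(r)H'(u)|^{p'}d\mathfrak m.\qquad(a)$$ (2) For any $u\in C_0^\infty(M)$, $$\int_M\max\{F^{*p}(\pm du)\}\,d\mathfrak m\ \ge\ \frac{\left|\int_M[G'(r)+G(r)\Delta r]H(u)\,d\mathfrak m\right|^p}{\left(\int_M|G(r)H'(u)|^{p'}d\mathfrak m\right)^{p-1}},\qquad(b)$$ provided that there exists a neighborhood $I\subset\mathbb R$ of zero such that $H'(s)\ne0$ for any $s\in I\setminus\{0\}$ and $G(t)\neq0$ for $t>0$. Further, the equality in (a) or (b) holds if and only if $$du=-\mathrm{sgn}(G(r)H'(u))\,|G(r)H'(u)|^{\frac1{p-1}}dr,\qquad \max\{F^*(\pm dr)\}=F^*(dr)\quad\text{on } M.$$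
   Context: A Finsler metric on an $n$-dimensional smooth manifold $M$ is a continuous $F:TM\to[0,\infty)$, smooth on $TM\setminus\{0\}$, with $F(x,\lambda y)=\lambda F(x,y)$ for $\lambda>0$ and $g_{ij}(x,y)=\frac12[F^2]_{y^iy^j}$ positive definite for $y\ne0$. A Finsler measure space $(M,F,\mathfrak m)$ is such a manifold with a smooth measure $\mathfrak m$. The dual metric is $F^*(x,\xi)=\sup_{y\ne0}\xi(y)/F(x,y)$; $\max\{F^{*p}(\pm du)\}=\max\{F^*(du)^p,F^*(-du)^p\}$. $d_F(x_1,x_2)$ is the infimum of $\int_0^1F(\dot c)dt$ over $C^1$ curves from $x_1$ to $x_2$. $(M,F)$ is forward complete if every geodesic (constant speed, locally minimizing curve) on $[0,l)$ extends to $[0,\infty)$. The gradient is $\nabla u=\mathcal L^*(du)$, where $\mathcal L^*:T_x^*M\to T_xM$ is the Legendre transformation: $\mathcal L^*(\xi)$ is the unique vector with $F(\mathcal L^*(\xi))=F^*(\xi)$ and $\xi(\mathcal L^*(\xi))=F^*(\xi)^2$. The Finsler Laplacian $\Delta u=\mathrm{div}(\nabla u)$ is understood in the weak sense: $\int_M\varphi\Delta u\,d\mathfrak m=-\int_Md\varphi(\nabla u)\,d\mathfrak m$ for test functions $\varphi\in C_0^\infty(M)$; integrals containing $\Delta r$ are understood accordingly. Results are stated for $u\in C_0^\infty(M)$; their extension to a more general class of functions (e.g. the closure of $C_0^\infty(M)$ for $\|u\|_{L^p}+\|F^*(du)\|_{L^p}$) is standard.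
   Formalization: In the equality case, relations hold almost everywhere; max{F*(±dr)}=F*(dr) is required only where du≠0 (it can fail when u=0), and equality in (b) is characterized with some real multiple μH in place of H, as (b) is unchanged when H is rescaled. *)

theory Defs
  imports "HOL-Analysis.Analysis"
begin

section \<open>Smooth manifolds and tangent vectors\<close>

text \<open>On an open set \<open>S\<close>: all iterated partial derivatives up to order \<open>k\<close> exist and are
  continuous.\<close>

primrec Ck_on ::
  "nat \<Rightarrow> ('a::euclidean_space \<Rightarrow> 'b::real_normed_vector) \<Rightarrow> 'a set \<Rightarrow> bool" where
  "Ck_on 0 = (\<lambda>f S. continuous_on S f)"
| "Ck_on (Suc k) = (\<lambda>f S. (\<forall>x\<in>S. f differentiable (at x)) \<and>
     (\<forall>b\<in>Basis. Ck_on k (\<lambda>x. frechet_derivative f (at x) b) S))"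

definition smooth_on ::
  "'a set \<Rightarrow> ('a::euclidean_space \<Rightarrow> 'b::real_normed_vector) \<Rightarrow> bool" where
  "smooth_on S f \<longleftrightarrow> (\<forall>k. Ck_on k f S)"

definition C1_fun_on :: "real set \<Rightarrow> (real \<Rightarrow> real) \<Rightarrow> bool" where
  "C1_fun_on S f \<longleftrightarrow> (\<forall>t\<in>S. f differentiable (at t)) \<and> continuous_on S (deriv f)"

text \<open>The manifold is the type \<open>'a\<close>. A chart is a pair of its domain and its coordinate map; the
  values of the coordinate map outside the domain are irrelevant.\<close>

type_synonym ('a, 'n) chart = "'a set \<times> ('a \<Rightarrow> real ^ 'n)"

definition chart_inv :: "('a, 'n) chart \<Rightarrow> real ^ 'n \<Rightarrow> 'a" where
  "chart_inv c = inv_into (fst c) (snd c)"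

definition smooth_atlas ::
  "('a::{second_countable_topology,t2_space}, 'n::finite) chart set \<Rightarrow> bool" where
  "smooth_atlas A \<longleftrightarrow>
     (\<Union>c\<in>A. fst c) = UNIV \<and>
     (\<forall>c\<in>A. open (fst c) \<and> open (snd c ` fst c) \<and>
        homeomorphism (fst c) (snd c ` fst c) (snd c) (chart_inv c)) \<and>
     (\<forall>c\<in>A. \<forall>c'\<in>A. smooth_on (snd c ` (fst c \<inter> fst c')) (snd c' \<circ> chart_inv c))"

text \<open>A tangent vector at \<open>x\<close> is the family of its coordinate vectors in all charts around \<open>x\<close>,
  which are related by the derivatives of the coordinate changes (and, to make the representation
  unique, the family vanishes on everything that is not a chart around \<open>x\<close>). Vector operations
  are componentwise; the zero vector is \<open>\<lambda>_. 0\<close>.\<close>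

type_synonym ('a, 'n) tvec = "('a, 'n) chart \<Rightarrow> real ^ 'n"

definition tangent_space :: "('a, 'n::finite) chart set \<Rightarrow> 'a \<Rightarrow> ('a, 'n) tvec set" where
  "tangent_space A x = {v.
     (\<forall>c. \<not> (c \<in> A \<and> x \<in> fst c) \<longrightarrow> v c = 0) \<and>
     (\<forall>c\<in>A. \<forall>c'\<in>A. x \<in> fst c \<and> x \<in> fst c' \<longrightarrow>
        v c' = frechet_derivative (snd c' \<circ> chart_inv c) (at (snd c x)) (v c))}"

text \<open>The tangent vector at \<open>x\<close> whose coordinate vector in the chart \<open>c\<close> is \<open>w\<close>.\<close>

definition coord_tvec ::
  "('a, 'n::finite) chart set \<Rightarrow> ('a, 'n) chart \<Rightarrow> 'a \<Rightarrow> real ^ 'n \<Rightarrow> ('a, 'n) tvec" where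
  "coord_tvec A c x w = (\<lambda>c'. if c' \<in> A \<and> x \<in> fst c'
     then frechet_derivative (snd c' \<circ> chart_inv c) (at (snd c x)) w else 0)"

definition compactly_supported_smooth ::
  "('a::topological_space, 'n::finite) chart set \<Rightarrow> ('a \<Rightarrow> real) \<Rightarrow> bool" where
  "compactly_supported_smooth A u \<longleftrightarrow>
     (\<forall>c\<in>A. smooth_on (snd c ` fst c) (u \<circ> chart_inv c)) \<and> compact (closure {x. u x \<noteq> 0})"

text \<open>A covector at \<open>x\<close> is given by its values on \<open>tangent_space A x\<close>. The differential of a
  function is set to \<open>0\<close> at points where the function is not differentiable. The choice of the
  chart around \<open>x\<close> is immaterial.\<close>

definition differential ::
  "('a, 'n::finite) chart set \<Rightarrow> ('a \<Rightarrow> real) \<Rightarrow> 'a \<Rightarrow> ('a, 'n) tvec \<Rightarrow> real" where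
  "differential A f x v = (let c = (SOME c. c \<in> A \<and> x \<in> fst c) in
     if (f \<circ> chart_inv c) differentiable (at (snd c x))
     then frechet_derivative (f \<circ> chart_inv c) (at (snd c x)) (v c) else 0)"


section \<open>Finsler measure spaces\<close>

text \<open>A Finsler metric assigns \<open>F x v\<close> to \<open>v \<in> tangent_space A x\<close>; \<open>local_metric A F c\<close> is its
  expression in the bundle chart of the tangent bundle induced by \<open>c\<close>.\<close>

definition local_metric ::
  "('a, 'n::finite) chart set \<Rightarrow> ('a \<Rightarrow> ('a, 'n) tvec \<Rightarrow> real) \<Rightarrow> ('a, 'n) chart \<Rightarrow>
     (real ^ 'n) \<times> (real ^ 'n) \<Rightarrow> real" where
  "local_metric A F c = (\<lambda>(z, w). F (chart_inv c z) (coord_tvec A c (chart_inv c z) w))"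

definition fundamental_tensor ::
  "('a, 'n::finite) chart set \<Rightarrow> ('a \<Rightarrow> ('a, 'n) tvec \<Rightarrow> real) \<Rightarrow> ('a, 'n) chart \<Rightarrow>
     real ^ 'n \<Rightarrow> real ^ 'n \<Rightarrow> real ^ 'n ^ 'n" where
  "fundamental_tensor A F c z w = (\<chi> i j. (1 / 2) *
     frechet_derivative
       (\<lambda>w'. frechet_derivative (\<lambda>y. (local_metric A F c (z, y))\<^sup>2) (at w') (axis i 1))
       (at w) (axis j 1))"

definition finsler_metric ::
  "('a, 'n::finite) chart set \<Rightarrow> ('a \<Rightarrow> ('a, 'n) tvec \<Rightarrow> real) \<Rightarrow> bool" where
  "finsler_metric A F \<longleftrightarrow>
     (\<forall>x. \<forall>v\<in>tangent_space A x. F x v \<ge> 0) \<and>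
     (\<forall>x. \<forall>v\<in>tangent_space A x. \<forall>a>0. F x (\<lambda>c. a *\<^sub>R v c) = a * F x v) \<and>
     (\<forall>c\<in>A. continuous_on ((snd c ` fst c) \<times> UNIV) (local_metric A F c)) \<and>
     (\<forall>c\<in>A. smooth_on ((snd c ` fst c) \<times> (UNIV - {0})) (local_metric A F c)) \<and>
     (\<forall>c\<in>A. \<forall>z\<in>snd c ` fst c. \<forall>w. w \<noteq> 0 \<longrightarrow>
        (\<forall>a. a \<noteq> 0 \<longrightarrow> a \<bullet> (fundamental_tensor A F c z w *v a) > 0))"

text \<open>A smooth measure has a smooth positive density with respect to Lebesgue measure in every
  chart.\<close>

definition smooth_measure ::
  "('a::topological_space, 'n::finite) chart set \<Rightarrow> 'a measure \<Rightarrow> bool" where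
  "smooth_measure A \<mm> \<longleftrightarrow> sets \<mm> = sets borel \<and>
     (\<forall>c\<in>A. \<exists>\<sigma>. smooth_on (snd c ` fst c) \<sigma> \<and> (\<forall>z\<in>snd c ` fst c. \<sigma> z > (0::real)) \<and>
        (\<forall>B\<in>sets borel. B \<subseteq> fst c \<longrightarrow>
           emeasure \<mm> B = (\<integral>\<^sup>+z\<in>snd c ` B. ennreal (\<sigma> z) \<partial>lborel)))"

text \<open>Manifolds are connected, so that the distance is finite.\<close>

definition finsler_measure_space ::
  "('a::{second_countable_topology,t2_space}, 'n::finite) chart set \<Rightarrow>
     ('a \<Rightarrow> ('a, 'n) tvec \<Rightarrow> real) \<Rightarrow> 'a measure \<Rightarrow> bool" where
  "finsler_measure_space A F \<mm> \<longleftrightarrow>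
     smooth_atlas A \<and> connected (UNIV :: 'a set) \<and> finsler_metric A F \<and> smooth_measure A \<mm>"


section \<open>Distance, geodesics and completeness\<close>

text \<open>\<open>J\<close> is a nondegenerate interval; derivatives at its end points are one-sided.\<close>

definition velocity ::
  "('a, 'n::finite) chart set \<Rightarrow> real set \<Rightarrow> (real \<Rightarrow> 'a) \<Rightarrow> real \<Rightarrow> ('a, 'n) tvec" where
  "velocity A J \<gamma> t = (\<lambda>c. if c \<in> A \<and> \<gamma> t \<in> fst c
     then vector_derivative (snd c \<circ> \<gamma>) (at t within J) else 0)"

definition C1_curve ::
  "('a::topological_space, 'n::finite) chart set \<Rightarrow> real set \<Rightarrow> (real \<Rightarrow> 'a) \<Rightarrow> bool" where
  "C1_curve A J \<gamma> \<longleftrightarrow> continuous_on J \<gamma> \<and>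
     (\<forall>c\<in>A. (\<forall>t\<in>J. \<gamma> t \<in> fst c \<longrightarrow> (snd c \<circ> \<gamma>) differentiable (at t within J)) \<and>
        continuous_on {t\<in>J. \<gamma> t \<in> fst c} (\<lambda>t. velocity A J \<gamma> t c))"

definition finsler_dist ::
  "('a::topological_space, 'n::finite) chart set \<Rightarrow> ('a \<Rightarrow> ('a, 'n) tvec \<Rightarrow> real) \<Rightarrow>
     'a \<Rightarrow> 'a \<Rightarrow> real" where
  "finsler_dist A F x y = Inf {integral {0..1} (\<lambda>t. F (\<gamma> t) (velocity A {0..1} \<gamma> t)) | \<gamma>.
     C1_curve A {0..1} \<gamma> \<and> \<gamma> 0 = x \<and> \<gamma> 1 = y}"

definition finsler_geodesic ::
  "('a::topological_space, 'n::finite) chart set \<Rightarrow> ('a \<Rightarrow> ('a, 'n) tvec \<Rightarrow> real) \<Rightarrow>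
     real set \<Rightarrow> (real \<Rightarrow> 'a) \<Rightarrow> bool" where
  "finsler_geodesic A F J \<gamma> \<longleftrightarrow> C1_curve A J \<gamma> \<and>
     (\<exists>k. \<forall>t\<in>J. F (\<gamma> t) (velocity A J \<gamma> t) = k) \<and>
     (\<forall>t\<in>J. \<exists>\<epsilon>>0. \<forall>s\<in>J. \<forall>s'\<in>J. \<bar>s - t\<bar> < \<epsilon> \<and> \<bar>s' - t\<bar> < \<epsilon> \<and> s \<le> s' \<longrightarrow>
        integral {s..s'} (\<lambda>\<tau>. F (\<gamma> \<tau>) (velocity A J \<gamma> \<tau>)) = finsler_dist A F (\<gamma> s) (\<gamma> s'))"

definition forward_complete ::
  "('a::topological_space, 'n::finite) chart set \<Rightarrow> ('a \<Rightarrow> ('a, 'n) tvec \<Rightarrow> real) \<Rightarrow> bool" where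
  "forward_complete A F \<longleftrightarrow>
     (\<forall>l>0. \<forall>\<gamma>. finsler_geodesic A F {0..<l} \<gamma> \<longrightarrow>
        (\<exists>\<gamma>'. finsler_geodesic A F {0..} \<gamma>' \<and> (\<forall>t\<in>{0..<l}. \<gamma>' t = \<gamma> t)))"


section \<open>Dual metric, gradient and weak Laplacian\<close>

definition dual_metric ::
  "('a, 'n::finite) chart set \<Rightarrow> ('a \<Rightarrow> ('a, 'n) tvec \<Rightarrow> real) \<Rightarrow>
     'a \<Rightarrow> (('a, 'n) tvec \<Rightarrow> real) \<Rightarrow> real" where
  "dual_metric A F x \<xi> = (SUP v \<in> tangent_space A x - {\<lambda>_. 0}. \<xi> v / F x v)"

definition legendre_dual ::
  "('a, 'n::finite) chart set \<Rightarrow> ('a \<Rightarrow> ('a, 'n) tvec \<Rightarrow> real) \<Rightarrow>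
     'a \<Rightarrow> (('a, 'n) tvec \<Rightarrow> real) \<Rightarrow> ('a, 'n) tvec" where
  "legendre_dual A F x \<xi> = (THE v. v \<in> tangent_space A x \<and>
     F x v = dual_metric A F x \<xi> \<and> \<xi> v = (dual_metric A F x \<xi>)\<^sup>2)"

definition finsler_gradient ::
  "('a, 'n::finite) chart set \<Rightarrow> ('a \<Rightarrow> ('a, 'n) tvec \<Rightarrow> real) \<Rightarrow>
     ('a \<Rightarrow> real) \<Rightarrow> 'a \<Rightarrow> ('a, 'n) tvec" where
  "finsler_gradient A F f x = legendre_dual A F x (differential A f x)"

text \<open>The integral of \<open>h + \<phi> \<Delta>f\<close> over \<open>M\<close>, with \<open>\<phi> \<Delta>f\<close> understood in the weak sense, that is,
  replaced by \<open>- d\<phi>(\<nabla>f)\<close>. This is a single integral, since the two parts need not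
  be integrable separately when \<open>h\<close> and \<open>\<phi>\<close> are singular at a point.\<close>

definition weak_laplacian_integral ::
  "('a, 'n::finite) chart set \<Rightarrow> ('a \<Rightarrow> ('a, 'n) tvec \<Rightarrow> real) \<Rightarrow> 'a measure \<Rightarrow>
     ('a \<Rightarrow> real) \<Rightarrow> ('a \<Rightarrow> real) \<Rightarrow> ('a \<Rightarrow> real) \<Rightarrow> real" where
  "weak_laplacian_integral A F \<mm> h \<phi> f =
     (\<integral>x. h x - differential A \<phi> x (finsler_gradient A F f x) \<partial>\<mm>)"

text \<open>The function \<open>max {F*\<^sup>p(\<plusminus>du)}\<close>.\<close>

definition max_dual_powr ::
  "('a, 'n::finite) chart set \<Rightarrow> ('a \<Rightarrow> ('a, 'n) tvec \<Rightarrow> real) \<Rightarrow> real \<Rightarrow>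
     ('a \<Rightarrow> real) \<Rightarrow> 'a \<Rightarrow> real" where
  "max_dual_powr A F p u x =
     max (dual_metric A F x (differential A u x) powr p)
         (dual_metric A F x (\<lambda>v. - differential A u x v) powr p)"

definition Lq_loc ::
  "'a::topological_space measure \<Rightarrow> real \<Rightarrow> 'a set \<Rightarrow> ('a \<Rightarrow> real) \<Rightarrow> bool" where
  "Lq_loc \<mm> q \<Omega> f \<longleftrightarrow> (\<forall>K. compact K \<and> K \<subseteq> \<Omega> \<longrightarrow>
     set_borel_measurable \<mm> K f \<and> set_integrable \<mm> K (\<lambda>x. \<bar>f x\<bar> powr q))"

text \<open>The equality case \<open>du = - sgn(K) \<bar>K\<bar>\<^bsup>1/(p-1)\<^esup> dr\<close>, \<open>max {F*(\<plusminus>dr)} = F*(dr)\<close>. Since \<open>dr\<close> only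
  exists almost everywhere, both relations are imposed almost everywhere. The second one is imposed
  where \<open>du \<noteq> 0\<close>: where \<open>du = 0\<close> the first relation does not involve \<open>dr\<close>, and equality in the
  inequalities (for instance for \<open>u = 0\<close>) carries no information about \<open>F*(\<plusminus>dr)\<close> there.\<close>

definition equality_case ::
  "('a, 'n::finite) chart set \<Rightarrow> ('a \<Rightarrow> ('a, 'n) tvec \<Rightarrow> real) \<Rightarrow> 'a measure \<Rightarrow> real \<Rightarrow>
     ('a \<Rightarrow> real) \<Rightarrow> ('a \<Rightarrow> real) \<Rightarrow> ('a \<Rightarrow> real) \<Rightarrow> bool" where
  "equality_case A F \<mm> p r u K \<longleftrightarrow> (AE x in \<mm>.
     (\<forall>v\<in>tangent_space A x.
        differential A u x v = - sgn (K x) * \<bar>K x\<bar> powr (1 / (p - 1)) * differential A r x v) \<and>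
     ((\<exists>v\<in>tangent_space A x. differential A u x v \<noteq> 0) \<longrightarrow>
        max (dual_metric A F x (differential A r x))
            (dual_metric A F x (\<lambda>v. - differential A r x v))
          = dual_metric A F x (differential A r x)))"

text \<open>Conventions for the inequalities involving \<open>D = \<integral> \<bar>G(r) H'(u)\<bar>\<^bsup>p'\<^esup>\<close>, which may be infinite since
  \<open>G(r)\<close> is only controlled away from the base point: where \<open>D\<close> is subtracted, the inequality is
  stated in the extended reals; where \<open>D\<close> is a denominator, the HOL values (\<open>0\<close> for a divergent
  integral and \<open>x / 0 = 0\<close>) give the quotient \<open>0\<close>, which is the intended value for
  \<open>D = \<infinity>\<close> and a harmless convention for \<open>D = 0\<close>. The quotient does not change when \<open>H\<close> is
  multiplied by a nonzero constant, so its equality case is \<open>equality_case\<close> for some multiple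
  of \<open>H\<close>; the multiple \<open>0\<close> only accounts for constant \<open>u\<close>.\<close>

end

theory Submission
  imports Defs
begin

text \<open>Let \<open>K = G(r) H'(u)\<close>. Since \<open>dr(\<nabla>r) = F\<^sup>*(dr)\<^sup>2 = 1\<close> almost everywhere, the integrand
  \<open>G'(r) H(u) - d(G(r) H(u))(\<nabla>r)\<close> reduces to \<open>- K du(\<nabla>r)\<close>, which is at most \<open>\<bar>K\<bar> max F\<^sup>*(\<plusminus>du)\<close>, and (a) is
  Young's inequality. In the equality case \<open>\<nabla>r\<close> is a common maximizer of \<open>dr\<close> and \<open>\<plusminus>du\<close> on the unit
  sphere of \<open>F\<close>, whose supporting functional is unique, so \<open>du\<close> is a multiple of \<open>dr\<close>. Inequality (b) is
  (a) for \<open>\<mu>H\<close> with the optimal constant \<open>\<mu>\<close>.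

  The distance \<open>r\<close> is locally Lipschitz in charts, hence differentiable almost everywhere by Rademacher's
  theorem. There \<open>F\<^sup>*(dr) \<le> 1\<close> follows from the triangle inequality along coordinate segments; for the
  converse, the last piece of an almost minimal curve inside a small coordinate ball shows that \<open>r\<close> grows
  at almost unit rate along it.\<close>

text \<open>The weak Laplacian enters only through its definition, so nothing is integrated by
  parts: what is needed is an identity and an inequality at almost every point, under one integral
  in which the singular terms G'(r) H(u) cancel. The obstacle is that r is neither smooth nor
  symmetric. Its gradient is controlled only off a null set, so it has to be shown to be Borel
  there, and the integrand has to be measurable on all of M, default values included. The asymmetry
  of F makes every length estimate respect orientation and keeps F*(du) and F*(-du) apart. Positive
  definiteness of the fundamental tensor acts through the second derivative of F^2 along lines that
  avoid the origin; it gives positivity of F and uniqueness of the Legendre vector. Finally, |G(r)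
  H'(u)|^p' may fail to be integrable. Then the right-hand side of (a) is minus infinity, and
  equality is impossible, because in the equality case this function agrees almost everywhere with
  the larger of F*(du)^p and F*(-du)^p, which is integrable for a test function u.\<close>

section \<open>Sets of small density\<close>

text \<open>Vitali's theorem exhausts T up to a null set by disjoint balls inside W, and each ball
  is replaced by its set U. Since T is not assumed measurable, smallness is expressed by measurable
  sets containing parts of T.\<close>

lemma Vitali_cover_shrink:
  fixes T W :: "'a::euclidean_space set"
  assumes "0 \<le> c" "open W" "W \<in> lmeasurable" "T \<subseteq> W"
    and cov: "\<And>x d. x \<in> T \<Longrightarrow> 0 < d \<Longrightarrow> \<exists>a s U. 0 < s \<and> s < d \<and> x \<in> cball a s \<and>
      T \<inter> cball a s \<subseteq> U \<and> U \<in> lmeasurable \<and> measure lebesgue U \<le> c * measure lebesgue (cball a s)"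
  obtains V where "T \<subseteq> V" "V \<in> lmeasurable" "measure lebesgue V \<le> c * measure lebesgue W"
proof -
  let ?\<mu> = "measure lebesgue"
  define good where "good = (\<lambda>(a, s) U. T \<inter> cball a s \<subseteq> U \<and> U \<in> lmeasurable \<and>
    ?\<mu> U \<le> c * ?\<mu> (cball a s))"
  define K where "K = {(a, s). 0 < s \<and> cball a s \<subseteq> W \<and> (\<exists>U. good (a, s) U)}"
  have cover: "\<exists>i. i \<in> K \<and> x \<in> cball (fst i) (snd i) \<and> snd i < d" if xT: "x \<in> T" and d: "0 < d" for x d
  proof -
    obtain e where e: "e > 0" "ball x e \<subseteq> W"
      using openE[OF assms(2), of x] assms(4) xT by blast
    obtain a s U where U: "0 < s" "s < min d (e/2)" "x \<in> cball a s" "T \<inter> cball a s \<subseteq> U"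
      "U \<in> lmeasurable" "?\<mu> U \<le> c * ?\<mu> (cball a s)"
      using cov[OF xT, of "min d (e/2)"] d e(1) by auto
    have "cball a s \<subseteq> ball x e"
    proof
      fix y assume "y \<in> cball a s"
      then have "dist x y \<le> s + s"
        using U(3) dist_triangle2[of x y a] by (simp add: dist_commute)
      then show "y \<in> ball x e" using U(2) by simp
    qed
    then have "cball a s \<subseteq> W" using e by blast
    moreover have "good (a, s) U" using U unfolding good_def by simp
    ultimately have "(a, s) \<in> K"
      using U(1) unfolding K_def by blast
    moreover have "x \<in> cball a s" "s < d" using U by auto
    ultimately show ?thesis by (intro exI[of _ "(a, s)"]) simp
  qed
  have Kpos: "0 < snd i" if "i \<in> K" for i
    using that unfolding K_def by auto
  obtain C where C: "countable C" "C \<subseteq> K"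
    and pw: "pairwise (\<lambda>i j. disjnt (cball (fst i) (snd i)) (cball (fst j) (snd j))) C"
    and neg: "negligible (T - (\<Union>i\<in>C. cball (fst i) (snd i)))"
    by (rule Vitali_covering_theorem_cballs[of K snd "T" fst, OF Kpos cover])
  have "\<forall>i\<in>C. \<exists>U. good i U"
    using C(2) unfolding K_def by blast
  then obtain U where U: "\<And>i. i \<in> C \<Longrightarrow> good i (U i)" by metis
  have Um: "U i \<in> lmeasurable" if "i \<in> C" for i
    using U[OF that] by (auto simp: good_def split: prod.splits)
  have le: "?\<mu> (\<Union>i\<in>I. U i) \<le> c * ?\<mu> W" if "I \<subseteq> C" "finite I" for I
  proof -
    have "?\<mu> (\<Union>i\<in>I. U i) \<le> (\<Sum>i\<in>I. ?\<mu> (U i))"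
      using that Um by (blast intro: measure_UNION_le)
    also have "\<dots> \<le> (\<Sum>i\<in>I. c * ?\<mu> (cball (fst i) (snd i)))"
      by (rule sum_mono) (use that U in \<open>force simp: good_def\<close>)
    also have "\<dots> = c * (\<Sum>i\<in>I. ?\<mu> (cball (fst i) (snd i)))"
      by (simp add: sum_distrib_left)
    also have "(\<Sum>i\<in>I. ?\<mu> (cball (fst i) (snd i))) = ?\<mu> (\<Union>i\<in>I. cball (fst i) (snd i))"
      by (rule measure_UNION'[symmetric]) (use that pairwise_subset[OF pw] in auto)
    also have "c * \<dots> \<le> c * ?\<mu> W"
    proof -
      have "(\<Union>i\<in>I. cball (fst i) (snd i)) \<subseteq> W"
        using that(1) C(2) unfolding K_def by fastforce
      moreover have "(\<Union>i\<in>I. cball (fst i) (snd i)) \<in> lmeasurable"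
        using that(2) by (intro fmeasurable.finite_UN) auto
      ultimately show ?thesis
        using assms(1,3) by (intro mult_left_mono measure_mono_fmeasurable) (auto dest: fmeasurableD)
    qed
    finally show ?thesis .
  qed
  have UC: "(\<Union>i\<in>C. U i) \<in> lmeasurable" "?\<mu> (\<Union>i\<in>C. U i) \<le> c * ?\<mu> W"
    using Um le assms(1)
    by (auto intro!: fmeasurable_UN_bound[OF C(1)] measure_UN_bound[OF C(1)])
  let ?V = "(T - (\<Union>i\<in>C. cball (fst i) (snd i))) \<union> (\<Union>i\<in>C. U i)"
  show ?thesis
  proof
    show "T \<subseteq> ?V"
      using U by (force simp: good_def)
    show "?V \<in> lmeasurable"
      using UC neg by (simp add: fmeasurable.Un negligible_imp_measurable)
    have "?\<mu> ?V = ?\<mu> (\<Union>i\<in>C. U i)"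
      by (rule measure_negligible_symdiff[OF UC(1)]) (force intro!: negligible_subset[OF neg])
    then show "?\<mu> ?V \<le> c * ?\<mu> W" using UC by simp
  qed
qed

text \<open>If the infimum of the measures of open sets containing a bounded piece of T were
  positive, a nearly optimal W could be shrunk by a factor below 1, against the choice of the
  infimum. Cutting T with balls keeps the measures finite.\<close>

lemma negligible_if_small_density:
  fixes T :: "'a::euclidean_space set"
  assumes c: "0 \<le> c" "c < 1"
    and cov: "\<And>x d. x \<in> T \<Longrightarrow> 0 < d \<Longrightarrow> \<exists>a s U. 0 < s \<and> s < d \<and> x \<in> cball a s \<and>
      T \<inter> cball a s \<subseteq> U \<and> U \<in> lmeasurable \<and> measure lebesgue U \<le> c * measure lebesgue (cball a s)"
  shows "negligible T"
proof -
  let ?\<mu> = "measure lebesgue"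
  have "negligible (T \<inter> ball 0 (real n))" for n
  proof -
    let ?T = "T \<inter> ball 0 (real n)"
    have cov': "\<exists>a s U. 0 < s \<and> s < d \<and> x \<in> cball a s \<and> ?T \<inter> cball a s \<subseteq> U \<and> U \<in> lmeasurable \<and>
        ?\<mu> U \<le> c * ?\<mu> (cball a s)" if xd: "x \<in> ?T" "0 < d" for x d
    proof -
      obtain a s U where "0 < s" "s < d" "x \<in> cball a s" "T \<inter> cball a s \<subseteq> U" "U \<in> lmeasurable"
        "?\<mu> U \<le> c * ?\<mu> (cball a s)"
        using cov[of x d] xd by blast
      then show ?thesis
        by (intro exI[of _ a] exI[of _ s] exI[of _ U]) auto
    qed
    define X where "X = {?\<mu> W |W. open W \<and> W \<in> lmeasurable \<and> ?T \<subseteq> W}"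
    have bdd: "bdd_below X" by (auto simp: X_def intro: bdd_belowI[of _ 0])
    have ne: "?\<mu> (ball (0::'a) (real n)) \<in> X"
      unfolding X_def by (intro CollectI exI[of _ "ball 0 (real n)"]) auto
    have "0 \<le> Inf X"
      using ne by (intro cInf_greatest) (auto simp: X_def)
    have "\<not> 0 < Inf X"
    proof
      assume pos: "0 < Inf X"
      \<comment> \<open>Strictly between c and 1: W is chosen within the factor 1 / ?c of the
        infimum, and the slack (?c - c) times the measure of W is spent on enlarging V to an open
        set.\<close>
      let ?c = "(1 + c) / 2"
      have c': "c < ?c" "?c < 1" "0 < ?c" using c by (auto simp: field_simps)
      have "Inf X < Inf X / ?c" using pos c' by (simp add: field_simps)
      then obtain y where y: "y \<in> X" "y < Inf X / ?c"
        using cInf_lessD[of X] ne by blast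
      then obtain W where W: "open W" "W \<in> lmeasurable" "?T \<subseteq> W" "?\<mu> W < Inf X / ?c"
        unfolding X_def by blast
      have Wpos: "0 < ?\<mu> W"
      proof -
        have "?\<mu> W \<in> X" using W(1-3) unfolding X_def by blast
        then show ?thesis using cInf_lower[OF _ bdd] pos by fastforce
      qed
      obtain V where V: "?T \<subseteq> V" "V \<in> lmeasurable" "?\<mu> V \<le> c * ?\<mu> W"
        using Vitali_cover_shrink[OF c(1) W(1-3) cov'] by blast
      have "0 < (?c - c) * ?\<mu> W" using c' Wpos by simp
      then obtain W' where W': "open W'" "V \<subseteq> W'" "W' - V \<in> lmeasurable"
        "emeasure lebesgue (W' - V) < ennreal ((?c - c) * ?\<mu> W)"
        using sets_lebesgue_outer_open[of V] fmeasurableD[OF V(2)] by metis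
      have W'm: "W' \<in> lmeasurable"
        using fmeasurable.Un[OF V(2) W'(3)] W'(2) by (simp add: Un_absorb1)
      have "?\<mu> (W' - V) < (?c - c) * ?\<mu> W"
        using W'(3,4) \<open>0 < (?c - c) * ?\<mu> W\<close> by (simp add: emeasure_eq_measure2 ennreal_less_iff)
      then have "?\<mu> W' < ?\<mu> V + (?c - c) * ?\<mu> W"
        using measurable_measure_Diff[OF W'm fmeasurableD[OF V(2)] W'(2)] by simp
      moreover have "(?c - c) * ?\<mu> W = ?c * ?\<mu> W - c * ?\<mu> W" by (rule left_diff_distrib)
      ultimately have "?\<mu> W' < ?c * ?\<mu> W" using V(3) by linarith
      also have "\<dots> < Inf X" using W(4) c' by (simp add: field_simps)
      finally have "?\<mu> W' < Inf X" .
      moreover have "?\<mu> W' \<in> X" using W'(1,2) W'm V(1) unfolding X_def by blast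
      ultimately show False using cInf_lower[OF _ bdd] by force
    qed
    then have Inf0: "Inf X = 0" using \<open>0 \<le> Inf X\<close> by simp
    show ?thesis
      unfolding negligible_outer
    proof (intro allI impI)
      fix e :: real assume "e > 0"
      then obtain y where "y \<in> X" "y < e"
        using cInf_lessD[of X e] ne Inf0 by auto
      then show "\<exists>S. ?T \<subseteq> S \<and> S \<in> lmeasurable \<and> ?\<mu> S < e"
        unfolding X_def by blast
    qed
  qed
  then have "negligible (\<Union>n. T \<inter> ball 0 (real n))"
    by (intro negligible_countable_Union) auto
  moreover have "(\<Union>n. T \<inter> ball 0 (real n)) = T"
    using reals_Archimedean2 by auto
  ultimately show ?thesis by simp
qed

text \<open>The hole of radius \<eta> s lies in the ball of radius 2 s about x and occupies the
  fraction (\<eta> / 2)^n of it, where n is the dimension. So T misses a fixed proportion of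
  arbitrarily small balls.\<close>

lemma negligible_porous:
  fixes T :: "'a::euclidean_space set"
  assumes \<eta>: "0 < \<eta>" "\<eta> \<le> 1"
    and hole: "\<And>x d. x \<in> T \<Longrightarrow> 0 < d \<Longrightarrow> \<exists>s y. 0 < s \<and> s < d \<and> y \<in> cball x s \<and> ball y (\<eta> * s) \<inter> T = {}"
  shows "negligible T"
proof (rule negligible_if_small_density)
  let ?c = "1 - (\<eta> / 2) ^ DIM('a)"
  have *: "0 < (\<eta> / 2) ^ DIM('a)" "(\<eta> / 2) ^ DIM('a) \<le> 1"
    using \<eta> by (auto intro: power_le_one)
  then show "0 \<le> ?c" "?c < 1" by auto
  fix x :: 'a and d :: real assume "x \<in> T" "0 < d"
  then obtain s y where s: "0 < s" "s < d / 2" "y \<in> cball x s" "ball y (\<eta> * s) \<inter> T = {}"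
    using hole[of x "d / 2"] by auto
  have sub: "ball y (\<eta> * s) \<subseteq> cball x (2 * s)"
  proof
    fix z assume "z \<in> ball y (\<eta> * s)"
    then have "dist y z < \<eta> * s" by simp
    also have "\<dots> \<le> 1 * s" using \<eta> s by (intro mult_right_mono) auto
    finally show "z \<in> cball x (2 * s)"
      using s(3) dist_triangle[of x z y] by simp
  qed
  have "measure lebesgue (cball x (2 * s) - ball y (\<eta> * s)) =
      measure lebesgue (cball x (2 * s)) - measure lebesgue (ball y (\<eta> * s))"
    using sub by (intro measurable_measure_Diff) auto
  also have "measure lebesgue (ball y (\<eta> * s)) = (\<eta> / 2) ^ DIM('a) * measure lebesgue (cball x (2 * s))"
    using content_ball_conv_unit_ball[of "\<eta> * s" y] content_ball_conv_unit_ball[of "2 * s" x] s \<eta>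
    by (simp add: content_cball_conv_ball power_mult_distrib power_divide)
  finally have "measure lebesgue (cball x (2 * s) - ball y (\<eta> * s)) = ?c * measure lebesgue (cball x (2 * s))"
    by (simp add: algebra_simps)
  then show "\<exists>a s U. 0 < s \<and> s < d \<and> x \<in> cball a s \<and> T \<inter> cball a s \<subseteq> U \<and> U \<in> lmeasurable \<and>
      measure lebesgue U \<le> ?c * measure lebesgue (cball a s)"
    using s by (intro exI[of _ x] exI[of _ "2 * s"] exI[of _ "cball x (2 * s) - ball y (\<eta> * s)"])
      (auto intro: fmeasurable_Diff)
qed

section \<open>Differentiability almost everywhere of Lipschitz functions\<close>

lemma cball_between:
  fixes x y :: real
  shows "cball ((x + y) / 2) (\<bar>y - x\<bar> / 2) = {min x y..max x y}"
  by (auto simp: dist_real_def abs_if min_def max_def field_simps split: if_splits)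

text \<open>A strictly increasing g maps disjoint intervals to disjoint intervals, so the sum of the
  increments is the measure of a disjoint union inside [g l, g u].\<close>

lemma sum_increments_le:
  fixes g :: "real \<Rightarrow> real"
  assumes mono: "strict_mono g" and fin: "finite I"
    and disj: "pairwise (\<lambda>i j. disjnt {a i..b i} {a j..b j}) I"
    and sub: "\<And>i. i \<in> I \<Longrightarrow> a i \<le> b i \<and> l \<le> a i \<and> b i \<le> u"
    and lu: "l \<le> u"
  shows "(\<Sum>i\<in>I. g (b i) - g (a i)) \<le> g u - g l"
proof -
  have mg: "g x \<le> g y \<longleftrightarrow> x \<le> y" for x y using mono by (simp add: strict_mono_less_eq)
  have dg: "pairwise (\<lambda>i j. disjnt {g (a i)..g (b i)} {g (a j)..g (b j)}) I"
  proof (rule pairwiseI)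
    fix i j assume ij: "i \<in> I" "j \<in> I" "i \<noteq> j"
    then have "disjnt {a i..b i} {a j..b j}" using disj by (auto simp: pairwise_def)
    then have "b i < a j \<or> b j < a i"
      using sub[OF ij(1)] sub[OF ij(2)] by (auto simp: disjnt_iff) (metis leI le_cases order_trans)
    then have "g (b i) < g (a j) \<or> g (b j) < g (a i)"
      using mono by (auto simp: strict_mono_def)
    then show "disjnt {g (a i)..g (b i)} {g (a j)..g (b j)}" by (auto simp: disjnt_iff)
  qed
  have gsub: "g l \<le> g (a i) \<and> g (b i) \<le> g u" if "i \<in> I" for i
    using sub[OF that] by (simp add: mg)
  have "(\<Sum>i\<in>I. g (b i) - g (a i)) = (\<Sum>i\<in>I. measure lebesgue {g (a i)..g (b i)})"
    using sub by (intro sum.cong) (auto simp: mg)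
  also have "\<dots> = measure lebesgue (\<Union>i\<in>I. {g (a i)..g (b i)})"
    by (rule measure_UNION'[symmetric]) (use fin dg in auto)
  also have "\<dots> \<le> measure lebesgue {g l..g u}"
    using gsub fin by (intro measure_mono_fmeasurable) (fastforce intro: order_trans)+
  also have "\<dots> = g u - g l" using lu by (simp add: mg)
  finally show ?thesis .
qed

text \<open>The Vitali cover by intervals with small difference quotients is refined by one with large
  difference quotients.\<close>

lemma negligible_oscillating_quotient:
  fixes g :: "real \<Rightarrow> real"
  assumes mono: "strict_mono g" and pq: "0 < p" "p < q"
  shows "negligible {x. (\<forall>d>0. \<exists>y. y \<noteq> x \<and> \<bar>y - x\<bar> < d \<and> (g y - g x) / (y - x) < p) \<and>
     (\<forall>d>0. \<exists>y. y \<noteq> x \<and> \<bar>y - x\<bar> < d \<and> (g y - g x) / (y - x) > q)}" (is "negligible ?T")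
proof (rule negligible_if_small_density[of "p / q"])
  let ?\<mu> = "measure lebesgue"
  show "0 \<le> p / q" "p / q < 1" using pq by auto
  have quot: "(g y - g x) / (y - x) = (g (max x y) - g (min x y)) / (max x y - min x y)" for x y
    by (cases "x = y") (auto simp: max_def min_def field_simps)
  fix x d :: real assume xT: "x \<in> ?T" and d: "0 < d"
  from xT have "\<forall>d>0. \<exists>y. y \<noteq> x \<and> \<bar>y - x\<bar> < d \<and> (g y - g x) / (y - x) < p"
    unfolding mem_Collect_eq by (rule conjunct1)
  then obtain y where y: "y \<noteq> x" "\<bar>y - x\<bar> < d" "(g y - g x) / (y - x) < p" using d by meson
  define l u where "l = min x y" and "u = max x y"
  have lu: "l < u" "u - l = \<bar>y - x\<bar>" using y by (auto simp: l_def u_def)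
  have incr: "g u - g l < p * (u - l)"
    using y(3) lu quot[of y x] unfolding l_def[symmetric] u_def[symmetric] by (simp add: field_simps)
  \<comment> \<open>The intervals inside [l, u] on which g grows faster than q, encoded by centre
    and radius so that Vitali's theorem for balls applies.\<close>
  define K where "K = {(a, s). 0 < s \<and> l \<le> a - s \<and> a + s \<le> u \<and> q * (2 * s) < g (a + s) - g (a - s)}"
  let ?T' = "?T \<inter> {l<..<u}"
  have cover: "\<exists>i. i \<in> K \<and> z \<in> cball (fst i) (snd i) \<and> snd i < e" if z: "z \<in> ?T'" and "0 < e" for z e
  proof -
    have "z \<in> ?T" using z by (rule IntD1)
    then have "\<forall>d>0. \<exists>y. y \<noteq> z \<and> \<bar>y - z\<bar> < d \<and> (g y - g z) / (y - z) > q"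
      unfolding mem_Collect_eq by (rule conjunct2)
    moreover have "0 < Min {e, z - l, u - z}" using that by auto
    ultimately obtain w where w: "w \<noteq> z" "\<bar>w - z\<bar> < Min {e, z - l, u - z}" "(g w - g z) / (w - z) > q"
      by meson
    let ?a = "(z + w) / 2" and ?s = "\<bar>w - z\<bar> / 2"
    have 1: "?a - ?s = min z w" "?a + ?s = max z w" by (auto simp: min_def max_def abs_if field_simps)
    have 2: "max z w - min z w > 0" "2 * ?s = max z w - min z w" using w(1) by (auto simp: min_def max_def)
    have "q * (2 * ?s) < g (?a + ?s) - g (?a - ?s)"
      using w(3) 2(1) quot[of w z] unfolding 1 2(2) by (simp add: field_simps)
    moreover have "l \<le> ?a - ?s" "?a + ?s \<le> u" unfolding 1 using w(2) z by auto
    ultimately have "(?a, ?s) \<in> K" using w(1) by (simp add: K_def)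
    moreover have "z \<in> cball ?a ?s" unfolding cball_between by simp
    moreover have "?s < e" using w(2) by auto
    ultimately show ?thesis by force
  qed
  have Kpos: "0 < snd i" if "i \<in> K" for i
    using that unfolding K_def by auto
  obtain C where C: "countable C" "C \<subseteq> K"
    and pw: "pairwise (\<lambda>i j. disjnt (cball (fst i) (snd i)) (cball (fst j) (snd j))) C"
    and neg: "negligible (?T' - (\<Union>i\<in>C. cball (fst i) (snd i)))"
    by (rule Vitali_covering_theorem_cballs[of K snd "?T'" fst, OF Kpos cover])
  \<comment> \<open>Each interval contributes more than q times its length to the increments, whose
    total is at most g u - g l < p (u - l); this gives the factor p / q.\<close>
  have le: "?\<mu> (\<Union>i\<in>I. cball (fst i) (snd i)) \<le> p / q * (u - l)" if "I \<subseteq> C" "finite I" for I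
  proof -
    have pwI: "pairwise (\<lambda>i j. disjnt (cball (fst i) (snd i)) (cball (fst j) (snd j))) I"
      by (rule pairwise_subset[OF pw that(1)])
    have K: "0 < snd i" "l \<le> fst i - snd i" "fst i + snd i \<le> u"
      "q * (2 * snd i) < g (fst i + snd i) - g (fst i - snd i)" if "i \<in> I" for i
      using that \<open>I \<subseteq> C\<close> C(2) by (auto simp: K_def)
    have "q * ?\<mu> (\<Union>i\<in>I. cball (fst i) (snd i)) = q * (\<Sum>i\<in>I. ?\<mu> (cball (fst i) (snd i)))"
      by (subst measure_UNION') (use that pwI in auto)
    also have "\<dots> = (\<Sum>i\<in>I. q * (2 * snd i))"
      unfolding sum_distrib_left
    proof (rule sum.cong)
      show "q * ?\<mu> (cball (fst i) (snd i)) = q * (2 * snd i)" if "i \<in> I" for i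
        using K(1)[OF that] by (simp add: cball_eq_atLeastAtMost)
    qed simp
    also have "\<dots> \<le> (\<Sum>i\<in>I. g (fst i + snd i) - g (fst i - snd i))"
      using K(4) by (intro sum_mono) (auto intro: less_imp_le)
    also have "\<dots> \<le> g u - g l"
      using pwI lu K by (intro sum_increments_le[OF mono that(2)])
        (auto simp: cball_eq_atLeastAtMost less_imp_le intro: order_trans)
    finally show ?thesis using incr pq by (simp add: field_simps)
  qed
  have UC: "(\<Union>i\<in>C. cball (fst i) (snd i)) \<in> lmeasurable"
    "?\<mu> (\<Union>i\<in>C. cball (fst i) (snd i)) \<le> p / q * (u - l)"
    using le pq lu by (auto intro!: fmeasurable_UN_bound[OF C(1)] measure_UN_bound[OF C(1)])
  \<comment> \<open>\<open>?T'\<close> leaves out the endpoints l and u, one of which is x itself;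
    they are put into the null set.\<close>
  define N where "N = {l, u} \<union> (?T' - (\<Union>i\<in>C. cball (fst i) (snd i)))"
  have N: "negligible N" unfolding N_def using neg by (intro negligible_Un) auto
  define U where "U = N \<union> (\<Union>i\<in>C. cball (fst i) (snd i))"
  have cb: "cball ((x + y) / 2) (\<bar>y - x\<bar> / 2) = {l..u}"
    unfolding cball_between l_def u_def ..
  have "U \<in> lmeasurable"
    unfolding U_def using N UC(1) by (simp add: fmeasurable.Un negligible_imp_measurable)
  moreover have "?\<mu> U = ?\<mu> (\<Union>i\<in>C. cball (fst i) (snd i))"
  proof (rule measure_negligible_symdiff[OF UC(1)])
    show "negligible (((\<Union>i\<in>C. cball (fst i) (snd i)) - U) \<union> (U - (\<Union>i\<in>C. cball (fst i) (snd i))))"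
      unfolding U_def by (rule negligible_subset[OF N]) blast
  qed
  moreover have "?T \<inter> {l..u} \<subseteq> U"
  proof
    fix z assume z: "z \<in> ?T \<inter> {l..u}"
    then have "z = l \<or> z = u \<or> z \<in> {l<..<u}" by (simp add: less_le) blast
    then show "z \<in> U" using z unfolding U_def N_def by blast
  qed
  moreover have "?\<mu> {l..u} = u - l" using lu by simp
  moreover have "x \<in> {l..u}" by (simp add: l_def u_def)
  moreover have "0 < \<bar>y - x\<bar> / 2" "\<bar>y - x\<bar> / 2 < d" using y by auto
  ultimately show "\<exists>a s U. 0 < s \<and> s < d \<and> x \<in> cball a s \<and> ?T \<inter> cball a s \<subseteq> U \<and>
      U \<in> lmeasurable \<and> ?\<mu> U \<le> p / q * ?\<mu> (cball a s)"
    using UC(2)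
    by (intro exI[of _ "(x + y) / 2"] exI[of _ "\<bar>y - x\<bar> / 2"] exI[of _ U]) (simp only: cb simp_thms)
qed

text \<open>The bounds keep the lower and upper limit of the quotients finite. If the two coincided,
  the common value would be the derivative; so two rationals fit strictly between them.\<close>

lemma bounded_quotient_not_differentiable:
  fixes g :: "real \<Rightarrow> real"
  assumes bd: "\<And>y. y \<noteq> x \<Longrightarrow> a \<le> (g y - g x) / (y - x) \<and> (g y - g x) / (y - x) \<le> b"
    and nd: "\<not> g differentiable (at x)"
  obtains p q where "p \<in> \<rat>" "q \<in> \<rat>" "p < q"
     "\<forall>d>0. \<exists>y. y \<noteq> x \<and> \<bar>y - x\<bar> < d \<and> (g y - g x) / (y - x) < p"
     "\<forall>d>0. \<exists>y. y \<noteq> x \<and> \<bar>y - x\<bar> < d \<and> (g y - g x) / (y - x) > q"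
proof -
  let ?Q = "\<lambda>y. ereal ((g y - g x) / (y - x))"
  have fr: "\<forall>d>0. \<exists>y. y \<noteq> x \<and> \<bar>y - x\<bar> < d \<and> P y" if "\<not> eventually (\<lambda>y. \<not> P y) (at x)" for P
    using that unfolding eventually_at by (auto simp: dist_real_def)
  have ev: "eventually (\<lambda>y. ereal a \<le> ?Q y \<and> ?Q y \<le> ereal b) (at x)"
    using bd by (auto simp: eventually_at_filter)
  have L1: "ereal a \<le> Liminf (at x) ?Q" and L2: "Limsup (at x) ?Q \<le> ereal b"
    using ev by (auto intro!: Liminf_bounded Limsup_bounded elim: eventually_mono)
  have le: "Liminf (at x) ?Q \<le> Limsup (at x) ?Q" by (rule Liminf_le_Limsup) simp
  have "Liminf (at x) ?Q \<noteq> Limsup (at x) ?Q"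
  proof
    assume eq: "Liminf (at x) ?Q = Limsup (at x) ?Q"
    obtain r where r: "Liminf (at x) ?Q = ereal r"
      using L1 L2 unfolding eq by (cases "Limsup (at x) ?Q") auto
    have "(?Q \<longlongrightarrow> ereal r) (at x)"
      using eq r by (intro tendsto_iff_Liminf_eq_Limsup[THEN iffD2]) auto
    then have "((\<lambda>y. (g y - g x) / (y - x)) \<longlongrightarrow> r) (at x)" by simp
    then have "(g has_field_derivative r) (at x)" by (simp add: has_field_derivative_iff)
    then show False using nd by (auto simp: has_field_derivative_def differentiable_def)
  qed
  then have "Liminf (at x) ?Q < Limsup (at x) ?Q" using le by (rule le_neq_trans[rotated])
  from ereal_dense3[OF this] obtain p' where p': "Liminf (at x) ?Q < ereal (real_of_rat p')"
    "ereal (real_of_rat p') < Limsup (at x) ?Q" by auto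
  from ereal_dense3[OF p'(2)] obtain q' where q': "ereal (real_of_rat p') < ereal (real_of_rat q')"
    "ereal (real_of_rat q') < Limsup (at x) ?Q" by auto
  define p q :: real where "p = real_of_rat p'" and "q = real_of_rat q'"
  have p: "p \<in> \<rat>" "Liminf (at x) ?Q < ereal p" and q: "q \<in> \<rat>" "ereal p < ereal q" "ereal q < Limsup (at x) ?Q"
    using p' q' by (auto simp: p_def q_def)
  have "\<not> eventually (\<lambda>y. \<not> (g y - g x) / (y - x) < p) (at x)"
  proof
    assume "eventually (\<lambda>y. \<not> (g y - g x) / (y - x) < p) (at x)"
    then have "ereal p \<le> Liminf (at x) ?Q"
      by (intro Liminf_bounded) (auto elim: eventually_mono)
    then show False using p by simp
  qed
  moreover have "\<not> eventually (\<lambda>y. \<not> (g y - g x) / (y - x) > q) (at x)"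
  proof
    assume "eventually (\<lambda>y. \<not> (g y - g x) / (y - x) > q) (at x)"
    then have "Limsup (at x) ?Q \<le> ereal q"
      by (intro Limsup_bounded) (auto elim: eventually_mono)
    then show False using q by simp
  qed
  ultimately show ?thesis
    using that[of p q] p(1) q(1,2) fr by simp
qed

text \<open>The exceptional set is covered by countably many negligible sets, indexed by the pairs
  of rationals that separate the lower from the upper derivative.\<close>

lemma Lipschitz_real_imp_differentiable_AE:
  fixes g :: "real \<Rightarrow> real"
  assumes "C-lipschitz_on UNIV g"
  shows "negligible {x. \<not> g differentiable (at x)}"
proof -
  have C: "0 \<le> C" using assms by (rule lipschitz_on_nonneg)
  \<comment> \<open>A linear summand does not affect differentiability. The slope C + 1 puts all
    quotients into [1, 2 C + 1], so h is strictly increasing and the rationals p that occur are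
    positive.\<close>
  define h where "h = (\<lambda>x. g x + (C + 1) * x)"
  have lip: "\<bar>g y - g x\<bar> \<le> C * \<bar>y - x\<bar>" for x y
    using lipschitz_onD[OF assms, of y x] by (simp add: dist_real_def)
  have quot: "1 \<le> (h y - h x) / (y - x) \<and> (h y - h x) / (y - x) \<le> 2 * C + 1" if "y \<noteq> x" for x y
  proof -
    have "(h y - h x) / (y - x) = (g y - g x) / (y - x) + (C + 1)"
      using that by (simp add: h_def field_simps)
    moreover have "\<bar>(g y - g x) / (y - x)\<bar> \<le> C"
      using lip[of y x] that by (simp add: field_simps)
    then have "- C \<le> (g y - g x) / (y - x)" "(g y - g x) / (y - x) \<le> C"
      unfolding abs_le_iff by auto
    ultimately show ?thesis by auto
  qed
  have mono: "strict_mono h"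
  proof (rule strict_monoI)
    fix x y :: real assume "x < y"
    then have "1 * (y - x) \<le> h y - h x" using quot[of y x] by (simp add: field_simps)
    then show "h x < h y" using \<open>x < y\<close> by simp
  qed
  define E where "E = (\<lambda>(p, q). {x. (\<forall>d>0. \<exists>y. y \<noteq> x \<and> \<bar>y - x\<bar> < d \<and> (h y - h x) / (y - x) < p) \<and>
     (\<forall>d>0. \<exists>y. y \<noteq> x \<and> \<bar>y - x\<bar> < d \<and> (h y - h x) / (y - x) > q)})"
  have "{x. \<not> g differentiable (at x)} \<subseteq> (\<Union>i\<in>{(p, q). p \<in> \<rat> \<and> q \<in> \<rat> \<and> 0 < p \<and> p < q}. E i)"
  proof
    fix x assume "x \<in> {x. \<not> g differentiable (at x)}"
    moreover have "g differentiable (at x)" if "h differentiable (at x)"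
    proof -
      have "(\<lambda>x. h x - (C + 1) * x) differentiable (at x)"
        using that by (intro derivative_intros differentiable_mult) auto
      then show ?thesis by (simp add: h_def)
    qed
    ultimately have nd: "\<not> h differentiable (at x)" by blast
    obtain p q where pq: "p \<in> \<rat>" "q \<in> \<rat>" "p < q"
      "\<forall>d>0. \<exists>y. y \<noteq> x \<and> \<bar>y - x\<bar> < d \<and> (h y - h x) / (y - x) < p"
      "\<forall>d>0. \<exists>y. y \<noteq> x \<and> \<bar>y - x\<bar> < d \<and> (h y - h x) / (y - x) > q"
      by (rule bounded_quotient_not_differentiable[OF quot nd])
    obtain y where "y \<noteq> x" "(h y - h x) / (y - x) < p" using pq(4) zero_less_one by blast
    then have "0 < p" using quot[of y x] by auto
    then show "x \<in> (\<Union>i\<in>{(p, q). p \<in> \<rat> \<and> q \<in> \<rat> \<and> 0 < p \<and> p < q}. E i)"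
      using pq unfolding E_def by blast
  qed
  moreover have "negligible (\<Union>i\<in>{(p, q). p \<in> \<rat> \<and> q \<in> \<rat> \<and> 0 < p \<and> p < q}. E i)"
  proof (rule negligible_countable_Union)
    have "countable ((\<rat>::real set) \<times> (\<rat>::real set))" by (simp add: countable_rat)
    then show "countable (E ` {(p, q). p \<in> \<rat> \<and> q \<in> \<rat> \<and> 0 < p \<and> p < q})"
      by (intro countable_image) (rule countable_subset[rotated], auto)
    show "negligible S" if "S \<in> E ` {(p, q). p \<in> \<rat> \<and> q \<in> \<rat> \<and> 0 < p \<and> p < q}" for S
      using that negligible_oscillating_quotient[OF mono] by (auto simp: E_def)
  qed
  ultimately show ?thesis by (rule negligible_subset[rotated])
qed

text \<open>Two slopes that are valid with relative errors e and e' on a common ball differ by at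
  most e + e', as testing in the direction of their difference shows. Hence the slopes form a Cauchy
  sequence, whose limit is the derivative.\<close>

lemma linear_approximations_imp_differentiable:
  fixes f :: "'a::euclidean_space \<Rightarrow> real"
  assumes "\<And>\<epsilon>. 0 < \<epsilon> \<Longrightarrow> \<exists>a d. 0 < d \<and> (\<forall>h. norm h < d \<longrightarrow> \<bar>f (x + h) - f x - a \<bullet> h\<bar> \<le> \<epsilon> * norm h)"
  shows "f differentiable (at x)"
proof -
  define e where "e = (\<lambda>n. 1 / real (Suc n))"
  have e: "0 < e n" for n by (simp add: e_def)
  have e_lim: "e \<longlonglongrightarrow> 0" unfolding e_def using LIMSEQ_inverse_real_of_nat by (simp add: inverse_eq_divide)
  have "\<forall>n. \<exists>a d. 0 < d \<and> (\<forall>h. norm h < d \<longrightarrow> \<bar>f (x + h) - f x - a \<bullet> h\<bar> \<le> e n * norm h)"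
    using assms e by blast
  then obtain a d where d: "\<And>n. 0 < d n"
    and ad: "\<And>n h. norm h < d n \<Longrightarrow> \<bar>f (x + h) - f x - a n \<bullet> h\<bar> \<le> e n * norm h"
    by metis
  have close: "norm (a m - a n) \<le> e m + e n" for m n
  proof (cases "a m = a n")
    case True then show ?thesis using e[of m] e[of n] by simp
  next
    case False
    let ?v = "a m - a n"
    \<comment> \<open>The test vector s ?v gets half the smaller radius as its length, so that both
      approximations apply to it.\<close>
    define s where "s = min (d m) (d n) / (2 * norm ?v)"
    have s: "0 < s" "norm (s *\<^sub>R ?v) < d m" "norm (s *\<^sub>R ?v) < d n"
      using False d[of m] d[of n] by (auto simp: s_def min_def)
    have "\<bar>a m \<bullet> (s *\<^sub>R ?v) - a n \<bullet> (s *\<^sub>R ?v)\<bar> \<le> e m * norm (s *\<^sub>R ?v) + e n * norm (s *\<^sub>R ?v)"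
      using ad[OF s(2)] ad[OF s(3)] by linarith
    also have "a m \<bullet> (s *\<^sub>R ?v) - a n \<bullet> (s *\<^sub>R ?v) = s * (norm ?v)\<^sup>2"
      by (simp add: power2_norm_eq_inner inner_diff_left flip: right_diff_distrib)
    also have "norm (s *\<^sub>R ?v) = s * norm ?v" using s(1) by simp
    finally have "s * (norm ?v)\<^sup>2 \<le> s * norm ?v * (e m + e n)"
      using s(1) by (simp only: distrib_left distrib_right mult_ac abs_mult abs_of_pos abs_power2)
    then have "(s * norm ?v) * norm ?v \<le> (s * norm ?v) * (e m + e n)"
      by (simp add: power2_eq_square mult.assoc)
    then show ?thesis using s(1) False by (simp add: mult_le_cancel_left)
  qed
  have "Cauchy a"
  proof (rule metric_CauchyI)
    fix \<epsilon> :: real assume "0 < \<epsilon>"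
    then obtain N where N: "\<And>n. N \<le> n \<Longrightarrow> e n < \<epsilon> / 2"
      using order_tendstoD(2)[OF e_lim, of "\<epsilon> / 2"] by (auto simp: eventually_sequentially)
    show "\<exists>N. \<forall>m\<ge>N. \<forall>n\<ge>N. dist (a m) (a n) < \<epsilon>"
      using close N by (intro exI[of _ N]) (smt (verit, best) dist_norm field_sum_of_halves)
  qed
  then obtain A where A: "a \<longlonglongrightarrow> A" using Cauchy_convergent convergentD by blast
  have closeA: "norm (a m - A) \<le> e m" for m
  proof (rule tendsto_le)
    show "(\<lambda>n. norm (a m - a n)) \<longlonglongrightarrow> norm (a m - A)" by (intro tendsto_intros A)
    show "(\<lambda>n. e m + e n) \<longlonglongrightarrow> e m" using tendsto_add[OF tendsto_const e_lim] by simp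
  qed (use close in auto)
  have "(f has_derivative (\<lambda>h. A \<bullet> h)) (at x)"
    unfolding has_derivative_at_alt
  proof (intro conjI allI impI bounded_linear_inner_right)
    fix \<epsilon> :: real assume "0 < \<epsilon>"
    then obtain n where n: "e n < \<epsilon> / 2"
      using order_tendstoD(2)[OF e_lim, of "\<epsilon> / 2"] eventually_happens by force
    have "norm (f y - f x - A \<bullet> (y - x)) \<le> \<epsilon> * norm (y - x)" if "norm (y - x) < d n" for y
    proof -
      have "\<bar>(a n - A) \<bullet> (y - x)\<bar> \<le> e n * norm (y - x)"
        using Cauchy_Schwarz_ineq2 closeA by (meson mult_right_mono norm_ge_zero order_trans)
      moreover have "\<bar>f y - f x - a n \<bullet> (y - x)\<bar> \<le> e n * norm (y - x)"
        using ad[OF that] by simp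
      ultimately have "\<bar>f y - f x - A \<bullet> (y - x)\<bar> \<le> 2 * e n * norm (y - x)"
        by (simp add: inner_diff_left)
      also have "\<dots> \<le> \<epsilon> * norm (y - x)" using n by (intro mult_right_mono) auto
      finally show ?thesis by simp
    qed
    then show "\<exists>d>0. \<forall>y. norm (y - x) < d \<longrightarrow> norm (f y - f x - A \<bullet> (y - x)) \<le> \<epsilon> * norm (y - x)"
      using d by blast
  qed
  then show ?thesis by (auto simp: differentiable_def)
qed

text \<open>The slope comes from a dense set and the radius has the form 1/(k+1); with D countable,
  differentiability becomes a condition with countable quantifiers over slopes and radii.\<close>

lemma differentiable_imp_linear_approximation:
  fixes f :: "'a::euclidean_space \<Rightarrow> real"
  assumes "f differentiable (at x)" "0 < \<epsilon>" and D: "\<And>X. open X \<Longrightarrow> X \<noteq> {} \<Longrightarrow> \<exists>d\<in>D. d \<in> X"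
  shows "\<exists>a\<in>D. \<exists>k. \<forall>h. norm h < 1 / real (Suc k) \<longrightarrow> \<bar>f (x + h) - f x - a \<bullet> h\<bar> \<le> \<epsilon> * norm h"
proof -
  obtain f' where f': "(f has_derivative f') (at x)" using assms by (auto simp: differentiable_def)
  then interpret bounded_linear f' by (rule has_derivative_bounded_linear)
  define A where "A = adjoint f' 1"
  have A: "f' h = A \<bullet> h" for h
    using adjoint_works[OF linear_axioms, of h 1] by (simp add: A_def inner_commute)
  obtain d where d: "0 < d" "\<And>y. norm (y - x) < d \<Longrightarrow> \<bar>f y - f x - A \<bullet> (y - x)\<bar> \<le> \<epsilon> / 2 * norm (y - x)"
    using f'[unfolded has_derivative_at_alt A] \<open>0 < \<epsilon>\<close> by (metis half_gt_zero real_norm_def)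
  obtain a where a: "a \<in> D" "a \<in> ball A (\<epsilon> / 2)" using D[of "ball A (\<epsilon> / 2)"] \<open>0 < \<epsilon>\<close> by auto
  obtain k where k: "1 / real (Suc k) < d" using nat_approx_posE[OF d(1)] by metis
  have "\<bar>f (x + h) - f x - a \<bullet> h\<bar> \<le> \<epsilon> * norm h" if "norm h < 1 / real (Suc k)" for h
  proof -
    have "\<bar>f (x + h) - f x - A \<bullet> h\<bar> \<le> \<epsilon> / 2 * norm h" using d(2)[of "x + h"] that k by simp
    moreover have "\<bar>(A - a) \<bullet> h\<bar> \<le> \<epsilon> / 2 * norm h"
      using Cauchy_Schwarz_ineq2[of "A - a" h] a(2)
      by (smt (verit) dist_norm mem_ball mult_right_mono norm_ge_zero)
    ultimately have "\<bar>f (x + h) - f x - A \<bullet> h\<bar> + \<bar>A \<bullet> h - a \<bullet> h\<bar> \<le> \<epsilon> * norm h"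
      by (simp add: inner_diff_left)
    then show ?thesis by linarith
  qed
  then show ?thesis using a(1) by blast
qed

text \<open>Differentiability at 0 is a countable combination of conditions that are closed in x.
  The parametrized form covers both differentiability at a point, with h in the whole space, and
  differentiability along a line, with h a real number.\<close>

lemma borel_differentiability_set:
  fixes g :: "'p::euclidean_space \<Rightarrow> 'h::euclidean_space \<Rightarrow> real"
  assumes cont: "\<And>h. continuous_on UNIV (\<lambda>x. g x h)"
  shows "{x. g x differentiable (at 0)} \<in> sets borel"
proof -
  obtain D :: "'h set" where D: "countable D" "\<And>X. open X \<Longrightarrow> X \<noteq> {} \<Longrightarrow> \<exists>d\<in>D. d \<in> X"
    using countable_dense_setE by blast
  define S where "S = (\<lambda>a k n. {x. \<forall>h. norm h < 1 / real (Suc k) \<longrightarrow>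
      \<bar>g x h - g x 0 - a \<bullet> h\<bar> \<le> 1 / real (Suc n) * norm h})"
  have "closed (S a k n)" for a k n
    unfolding S_def
    by (intro closed_Collect_all closed_Collect_imp open_Collect_const closed_Collect_le continuous_intros cont)
  then have "(\<Union>k. S a k n) \<in> sets borel" for a n
    by (intro sets.countable_UN) auto
  then have "(\<Union>a\<in>D. \<Union>k. S a k n) \<in> sets borel" for n
    by (intro sets.countable_UN'[OF D(1)]) auto
  then have "(\<Inter>n. \<Union>a\<in>D. \<Union>k. S a k n) \<in> sets borel"
    by (intro sets.countable_INT) auto
  moreover have "{x. g x differentiable (at 0)} = (\<Inter>n. \<Union>a\<in>D. \<Union>k. S a k n)"
  proof (intro set_eqI iffI)
    fix x assume x: "x \<in> {x. g x differentiable (at 0)}"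
    show "x \<in> (\<Inter>n. \<Union>a\<in>D. \<Union>k. S a k n)"
    proof (rule INT_I)
      fix n
      have pos: "0 < 1 / real (Suc n)" by simp
      have "\<exists>a\<in>D. \<exists>k. \<forall>h. norm h < 1 / real (Suc k) \<longrightarrow>
          \<bar>g x (0 + h) - g x 0 - a \<bullet> h\<bar> \<le> 1 / real (Suc n) * norm h"
        by (rule differentiable_imp_linear_approximation[OF x[unfolded mem_Collect_eq] pos D(2)])
      then show "x \<in> (\<Union>a\<in>D. \<Union>k. S a k n)" unfolding S_def by auto
    qed
  next
    fix x assume x: "x \<in> (\<Inter>n. \<Union>a\<in>D. \<Union>k. S a k n)"
    have "g x differentiable (at 0)"
    proof (rule linear_approximations_imp_differentiable)
      fix \<epsilon> :: real assume "0 < \<epsilon>"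
      then obtain n where n: "1 / real (Suc n) < \<epsilon>" using nat_approx_posE by metis
      obtain a k where ak: "x \<in> S a k n" using x by blast
      have "\<bar>g x (0 + h) - g x 0 - a \<bullet> h\<bar> \<le> \<epsilon> * norm h" if "norm h < 1 / real (Suc k)" for h
      proof -
        have "\<bar>g x h - g x 0 - a \<bullet> h\<bar> \<le> 1 / real (Suc n) * norm h"
          using ak that unfolding S_def by blast
        also have "\<dots> \<le> \<epsilon> * norm h" using n by (intro mult_right_mono) auto
        finally show ?thesis by simp
      qed
      then show "\<exists>a d. 0 < d \<and> (\<forall>h. norm h < d \<longrightarrow> \<bar>g x (0 + h) - g x 0 - a \<bullet> h\<bar> \<le> \<epsilon> * norm h)"
        by (intro exI[of _ a] exI[of _ "1 / real (Suc k)"]) auto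
    qed
    then show "x \<in> {x. g x differentiable (at 0)}" by simp
  qed
  ultimately show ?thesis by simp
qed

section \<open>From lines to Rademacher's theorem in several variables\<close>

lemma differentiable_shift:
  fixes f :: "'a::real_normed_vector \<Rightarrow> 'b::real_normed_vector"
  shows "(\<lambda>h. f (x + h)) differentiable (at 0) \<longleftrightarrow> f differentiable (at x)"
proof
  assume "(\<lambda>h. f (x + h)) differentiable (at 0)"
  then have "(\<lambda>h. f (x + h)) differentiable (at (x - x))" by simp
  moreover have "(\<lambda>y. y - x) differentiable (at x)" by (intro derivative_intros)
  ultimately have "((\<lambda>h. f (x + h)) \<circ> (\<lambda>y. y - x)) differentiable (at x)"
    by (intro differentiable_chain_at)
  then show "f differentiable (at x)" by (simp add: o_def)
next
  assume "f differentiable (at x)"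
  then have "f differentiable (at (x + 0))" by simp
  moreover have "(\<lambda>h. x + h) differentiable (at 0)" by (intro derivative_intros)
  ultimately have "(f \<circ> (\<lambda>h. x + h)) differentiable (at 0)"
    by (intro differentiable_chain_at) auto
  then show "(\<lambda>h. f (x + h)) differentiable (at 0)" by (simp add: o_def)
qed

text \<open>Integrating the indicator of a translated set over the translation parameter avoids choosing
  coordinates adapted to the direction \<open>b\<close>.\<close>

lemma null_sets_if_null_on_lines:
  fixes N :: "'a::euclidean_space set" and b :: 'a
  assumes N: "N \<in> sets borel" and lines: "\<And>x. {t::real. x + t *\<^sub>R b \<in> N} \<in> null_sets lborel"
  shows "N \<in> null_sets lborel"
proof -
  have trans: "(\<integral>\<^sup>+x. indicator N (x + t *\<^sub>R b) \<partial>lborel) = emeasure lborel N" for t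
  proof -
    have "emeasure lborel N = emeasure (distr lborel borel ((+) (t *\<^sub>R b))) N"
      by (simp add: lborel_distr_plus)
    also have "\<dots> = (\<integral>\<^sup>+x. indicator N x \<partial>distr lborel borel ((+) (t *\<^sub>R b)))"
      using N by (subst nn_integral_indicator) auto
    also have "\<dots> = (\<integral>\<^sup>+x. indicator N (x + t *\<^sub>R b) \<partial>lborel)"
      using N by (subst nn_integral_distr) (auto simp: add.commute)
    finally show ?thesis by simp
  qed
  have "emeasure lborel N = (\<integral>\<^sup>+t. indicator {0..1::real} t * emeasure lborel N \<partial>lborel)"
    by (subst nn_integral_multc) auto
  also have "\<dots> = (\<integral>\<^sup>+t. (\<integral>\<^sup>+x. indicator {0..1} t * indicator N (x + t *\<^sub>R b) \<partial>lborel) \<partial>lborel)"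
    using N by (subst nn_integral_cmult) (auto simp: trans)
  also have "\<dots> = (\<integral>\<^sup>+x. (\<integral>\<^sup>+t. indicator {0..1} t * indicator N (x + t *\<^sub>R b) \<partial>lborel) \<partial>lborel)"
    using N by (intro lborel_pair.Fubini') (auto simp: case_prod_unfold cong: measurable_cong_sets)
  also have "\<dots> = (\<integral>\<^sup>+x. 0 \<partial>(lborel :: 'a measure))"
  proof (rule nn_integral_cong)
    fix x
    have "AE t in lborel. t \<notin> {t. x + t *\<^sub>R b \<in> N}" by (rule AE_not_in[OF lines])
    then have "(\<integral>\<^sup>+t. indicator {0..1} t * indicator N (x + t *\<^sub>R b) \<partial>lborel) = (\<integral>\<^sup>+t. 0 \<partial>(lborel :: real measure))"
      by (intro nn_integral_cong_AE) (auto simp: indicator_def)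
    then show "(\<integral>\<^sup>+t. indicator {0..1::real} t * indicator N (x + t *\<^sub>R b) \<partial>lborel) = 0" by simp
  qed
  finally have "emeasure lborel N = 0" by simp
  then show ?thesis using N by (intro null_setsI) auto
qed

text \<open>The one-variable theorem holds on every line parallel to b. Borel measurability of the
  exceptional set is what allows the null sets on the lines to be assembled by Fubini's
  theorem.\<close>

lemma Lipschitz_imp_directional_derivative_AE:
  fixes f :: "'a::euclidean_space \<Rightarrow> real"
  assumes L: "C-lipschitz_on UNIV f"
  shows "negligible {x. \<not> (\<lambda>t. f (x + t *\<^sub>R b)) differentiable (at 0)}"
proof -
  have cont: "continuous_on UNIV f" by (rule lipschitz_on_continuous_on[OF L])
  let ?N = "{x. \<not> (\<lambda>t. f (x + t *\<^sub>R b)) differentiable (at 0)}"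
  have "{x. (\<lambda>t. f (x + t *\<^sub>R b)) differentiable (at 0)} \<in> sets borel"
    by (rule borel_differentiability_set) (intro continuous_on_compose2[OF cont] continuous_intros, auto)
  then have N: "?N \<in> sets borel"
    using sets.compl_sets[of "{x. (\<lambda>t. f (x + t *\<^sub>R b)) differentiable (at 0)}" borel]
    by (simp add: Diff_eq Collect_neg_eq[symmetric])
  have "?N \<in> null_sets lborel"
  proof (rule null_sets_if_null_on_lines[OF N, of b])
    fix x
    let ?g = "\<lambda>t. f (x + t *\<^sub>R b)"
    have "(C * norm b)-lipschitz_on UNIV ?g"
    proof (rule lipschitz_onI)
      fix s t :: real
      have "dist (?g s) (?g t) \<le> C * dist (x + s *\<^sub>R b) (x + t *\<^sub>R b)"
        using lipschitz_onD[OF L] by blast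
      also have "\<dots> = C * norm b * dist s t"
        by (simp add: dist_norm flip: scaleR_diff_left)
      finally show "dist (?g s) (?g t) \<le> C * norm b * dist s t" .
    qed (use lipschitz_on_nonneg[OF L] in auto)
    then have "negligible {t. \<not> ?g differentiable (at t)}"
      by (rule Lipschitz_real_imp_differentiable_AE)
    moreover have "{t. x + t *\<^sub>R b \<in> ?N} = {t. \<not> ?g differentiable (at t)}"
      using differentiable_shift[of ?g] by (auto simp: algebra_simps)
    moreover have "{t. x + t *\<^sub>R b \<in> ?N} \<in> sets borel"
      using measurable_sets_borel[of "\<lambda>t. x + t *\<^sub>R b" borel ?N] N by (simp add: vimage_def)
    ultimately show "{t. x + t *\<^sub>R b \<in> ?N} \<in> null_sets lborel"
      by (simp add: negligible_iff_null_sets null_sets_def)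
  qed
  then show ?thesis
    using negligible_iff_null_sets null_sets_completionI by blast
qed

text \<open>Coordinate projections do not increase the norm, so the vertices of the polygonal path
  from x to x + h stay in the ball of radius norm h about x.\<close>

lemma sum_Basis_subset_norm_le:
  fixes h :: "'a::euclidean_space"
  assumes "B \<subseteq> Basis"
  shows "norm (\<Sum>b\<in>B. (h \<bullet> b) *\<^sub>R b) \<le> norm h"
proof -
  have fin: "finite B" using assms finite_Basis finite_subset by blast
  have "(\<Sum>b\<in>B. (h \<bullet> b) *\<^sub>R b) \<bullet> (\<Sum>b\<in>B. (h \<bullet> b) *\<^sub>R b) = (\<Sum>b\<in>B. (h \<bullet> b) * (h \<bullet> b))"
  proof -
    have "(\<Sum>b\<in>B. (h \<bullet> b) *\<^sub>R b) \<bullet> c = h \<bullet> c" if "c \<in> B" for c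
    proof -
      have "(\<Sum>b\<in>B. (h \<bullet> b) *\<^sub>R b) \<bullet> c = (\<Sum>b\<in>B. if b = c then h \<bullet> c else 0)"
        unfolding inner_sum_left using that assms by (intro sum.cong) (auto simp: inner_not_same_Basis subsetD inner_same_Basis)
      then show ?thesis using that fin by simp
    qed
    then have "(\<Sum>b\<in>B. (h \<bullet> b) *\<^sub>R b) \<bullet> ((h \<bullet> c) *\<^sub>R c) = (h \<bullet> c) * (h \<bullet> c)" if "c \<in> B" for c
      using that by simp
    then show ?thesis unfolding inner_sum_right by (intro sum.cong) auto
  qed
  also have "\<dots> \<le> (\<Sum>b\<in>Basis. (h \<bullet> b) * (h \<bullet> b))"
    using assms by (intro sum_mono2) auto
  also have "\<dots> = h \<bullet> h" by (simp add: euclidean_inner[of h h])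
  finally show ?thesis by (simp add: norm_eq_sqrt_inner)
qed

text \<open>The increments of \<open>f\<close> along a polygonal path from \<open>x\<close> to \<open>x + h\<close> are read off at nearby points of
  \<open>S\<close>.\<close>

lemma nonporous_imp_linear_approximation:
  fixes f :: "'a::euclidean_space \<Rightarrow> real"
  assumes L: "C-lipschitz_on UNIV f" and \<epsilon>: "0 < \<epsilon>" and d: "0 < d"
    and S: "\<And>z b t. z \<in> S \<Longrightarrow> b \<in> Basis \<Longrightarrow> \<bar>t\<bar> < d \<Longrightarrow> \<bar>f (z + t *\<^sub>R b) - f z - t * (a \<bullet> b)\<bar> \<le> \<epsilon> * \<bar>t\<bar>"
    and dense: "\<And>s y. 0 < s \<Longrightarrow> s < d \<Longrightarrow> y \<in> cball x s \<Longrightarrow> ball y (\<epsilon> * s) \<inter> S \<noteq> {}"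
    and h: "norm h < d"
  shows "\<bar>f (x + h) - f x - a \<bullet> h\<bar> \<le> real DIM('a) * ((2 * C + 1) * \<epsilon>) * norm h"
proof (cases "h = 0")
  case False
  have C: "0 \<le> C" by (rule lipschitz_on_nonneg[OF L])
  have "\<bar>f (x + (\<Sum>b\<in>B. (h \<bullet> b) *\<^sub>R b)) - f x - a \<bullet> (\<Sum>b\<in>B. (h \<bullet> b) *\<^sub>R b)\<bar>
      \<le> real (card B) * ((2 * C + 1) * \<epsilon>) * norm h" if "B \<subseteq> Basis" for B
    using finite_subset[OF that finite_Basis] that
  proof (induction B rule: finite_induct)
    case (insert c B)
    let ?y = "x + (\<Sum>b\<in>B. (h \<bullet> b) *\<^sub>R b)" and ?t = "h \<bullet> c"
    have IH: "\<bar>f ?y - f x - a \<bullet> (\<Sum>b\<in>B. (h \<bullet> b) *\<^sub>R b)\<bar> \<le> real (card B) * ((2 * C + 1) * \<epsilon>) * norm h"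
      using insert by auto
    have "?y \<in> cball x (norm h)"
      using sum_Basis_subset_norm_le[of B h] insert.prems by (simp add: dist_norm)
    \<comment> \<open>A point of S near the vertex: at z the increment along the edge is known up to
      \<epsilon> norm h, and carrying both ends of the edge from z to ?y costs C \<epsilon> norm h
      each. This is the origin of 2 C + 1.\<close>
    then obtain z where z: "z \<in> S" "dist ?y z < \<epsilon> * norm h"
      using dense[of "norm h" ?y] h False by auto
    have t: "\<bar>?t\<bar> \<le> norm h" using Basis_le_norm[of c h] insert.prems by (simp add: inner_commute)
    have 1: "\<bar>f (z + ?t *\<^sub>R c) - f z - ?t * (a \<bullet> c)\<bar> \<le> \<epsilon> * norm h"
    proof -
      have "\<bar>?t\<bar> < d" "c \<in> Basis" using t h insert.prems by auto
      from S[OF z(1) this(2,1)] show ?thesis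
        by (rule order_trans) (use t \<epsilon> in \<open>auto intro: mult_left_mono\<close>)
    qed
    have Cz: "C * dist ?y z \<le> C * (\<epsilon> * norm h)" using z(2) C by (intro mult_left_mono) auto
    have 2: "\<bar>f (?y + ?t *\<^sub>R c) - f (z + ?t *\<^sub>R c)\<bar> \<le> C * (\<epsilon> * norm h)"
      using lipschitz_onD[OF L, of "?y + ?t *\<^sub>R c" "z + ?t *\<^sub>R c"] Cz by (simp add: dist_real_def)
    have 3: "\<bar>f ?y - f z\<bar> \<le> C * (\<epsilon> * norm h)"
      using lipschitz_onD[OF L, of ?y z] Cz by (simp add: dist_real_def)
    have eq: "x + (\<Sum>b\<in>insert c B. (h \<bullet> b) *\<^sub>R b) = ?y + ?t *\<^sub>R c"
      "a \<bullet> (\<Sum>b\<in>insert c B. (h \<bullet> b) *\<^sub>R b) = a \<bullet> (\<Sum>b\<in>B. (h \<bullet> b) *\<^sub>R b) + ?t * (a \<bullet> c)"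
      using insert.hyps by (simp_all add: algebra_simps)
    have "\<bar>f (?y + ?t *\<^sub>R c) - f x - (a \<bullet> (\<Sum>b\<in>B. (h \<bullet> b) *\<^sub>R b) + ?t * (a \<bullet> c))\<bar>
        \<le> real (card B) * ((2 * C + 1) * \<epsilon>) * norm h + (\<epsilon> * norm h + 2 * (C * (\<epsilon> * norm h)))"
      using 1 2 3 IH by linarith
    also have "\<dots> = real (card (insert c B)) * ((2 * C + 1) * \<epsilon>) * norm h"
      using insert.hyps by (simp add: algebra_simps)
    finally show ?case unfolding eq .
  qed simp
  from this[OF subset_refl] show ?thesis by (simp add: euclidean_representation)
qed simp

text \<open>Where all partial derivatives exist, x belongs for every n to some set S (a, k, n) of
  points with uniformly controlled partial increments. If S is not porous at x, it has points near
  every vertex of the polygonal path from x to x + h, and partial control becomes a linear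
  approximation; the porous points are negligible.\<close>

theorem Rademacher:
  fixes f :: "'a::euclidean_space \<Rightarrow> real"
  assumes L: "C-lipschitz_on UNIV f"
  shows "negligible {x. \<not> f differentiable (at x)}"
proof -
  have C: "0 \<le> C" by (rule lipschitz_on_nonneg[OF L])
  have cont: "continuous_on UNIV f" by (rule lipschitz_on_continuous_on[OF L])
  obtain D :: "'a set" where D: "countable D" "\<And>X. open X \<Longrightarrow> X \<noteq> {} \<Longrightarrow> \<exists>d\<in>D. d \<in> X"
    using countable_dense_setE by blast
  define S where "S = (\<lambda>(a, k, n). {x. \<forall>b\<in>Basis. \<forall>t. \<bar>t\<bar> < 1 / real (Suc k) \<longrightarrow>
      \<bar>f (x + t *\<^sub>R b) - f x - t * (a \<bullet> b)\<bar> \<le> 1 / real (Suc n) * \<bar>t\<bar>})"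
  \<comment> \<open>A hole of S is also a hole of its subset P, so P is porous at each of its own
    points.\<close>
  define P where "P = (\<lambda>(a, k, n). {x \<in> S (a, k, n). \<forall>d>0. \<exists>s y. 0 < s \<and> s < d \<and> y \<in> cball x s \<and>
      ball y (1 / real (Suc n) * s) \<inter> S (a, k, n) = {}})"
  have P: "negligible (P i)" for i
  proof -
    obtain a k n where i: "i = (a, k, n)" by (cases i)
    show ?thesis unfolding i P_def split_conv
    proof (rule negligible_porous[of "1 / real (Suc n)"])
      fix x and d :: real
      assume x: "x \<in> {x \<in> S (a, k, n). \<forall>d>0. \<exists>s y. 0 < s \<and> s < d \<and> y \<in> cball x s \<and>
        ball y (1 / real (Suc n) * s) \<inter> S (a, k, n) = {}}" and "0 < d"
      then show "\<exists>s y. 0 < s \<and> s < d \<and> y \<in> cball x s \<and> ball y (1 / real (Suc n) * s) \<inter>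
        {x \<in> S (a, k, n). \<forall>d>0. \<exists>s y. 0 < s \<and> s < d \<and> y \<in> cball x s \<and>
          ball y (1 / real (Suc n) * s) \<inter> S (a, k, n) = {}} = {}"
        by blast
    qed auto
  qed
  define N where "N = (\<Union>i\<in>D \<times> UNIV. P i) \<union> (\<Union>b\<in>Basis. {x. \<not> (\<lambda>t. f (x + t *\<^sub>R b)) differentiable (at 0)})"
  have "negligible (\<Union>b\<in>Basis. {x. \<not> (\<lambda>t. f (x + t *\<^sub>R b)) differentiable (at 0)})"
    using Lipschitz_imp_directional_derivative_AE[OF L] by (intro negligible_Union) auto
  moreover have "negligible (\<Union>i\<in>D \<times> UNIV. P i)"
    using P D(1) by (intro negligible_countable_Union countable_image countable_SIGMA) auto
  ultimately have N: "negligible N" unfolding N_def by (rule negligible_Un[rotated])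
  have "f differentiable (at x)" if x: "x \<notin> N" for x
  proof (rule linear_approximations_imp_differentiable)
    fix \<epsilon> :: real assume \<epsilon>: "0 < \<epsilon>"
    \<comment> \<open>The constant of \<open>nonporous_imp_linear_approximation\<close> without its
      factor \<epsilon>; choosing 1/(n+1) < \<epsilon> / ?M compensates for it.\<close>
    let ?M = "real DIM('a) * (2 * C + 1)"
    have M: "0 < ?M" using C by simp
    then obtain n where n: "1 / real (Suc n) < \<epsilon> / ?M"
      using nat_approx_posE[of "\<epsilon> / ?M"] \<epsilon> by (metis divide_pos_pos)
    let ?e = "1 / real (Suc n)"
    have "\<exists>p k. \<forall>t. \<bar>t\<bar> < 1 / real (Suc k) \<longrightarrow> \<bar>f (x + t *\<^sub>R b) - f x - t * p\<bar> \<le> ?e / 2 * \<bar>t\<bar>" if "b \<in> Basis" for b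
    proof -
      have "(\<lambda>t. f (x + t *\<^sub>R b)) differentiable (at 0)" using x that by (auto simp: N_def)
      then have "\<exists>p\<in>UNIV. \<exists>k. \<forall>t. norm t < 1 / real (Suc k) \<longrightarrow>
          \<bar>f (x + (0 + t) *\<^sub>R b) - f (x + 0 *\<^sub>R b) - p \<bullet> t\<bar> \<le> ?e / 2 * norm t"
        by (rule differentiable_imp_linear_approximation) auto
      then show ?thesis by (simp add: mult.commute)
    qed
    then obtain p k where pk: "\<And>b t. b \<in> Basis \<Longrightarrow> \<bar>t\<bar> < 1 / real (Suc (k b)) \<Longrightarrow>
        \<bar>f (x + t *\<^sub>R b) - f x - t * p b\<bar> \<le> ?e / 2 * \<bar>t\<bar>"
      by metis
    define m where "m = Max (k ` Basis)"
    define A where "A = (\<Sum>b\<in>Basis. p b *\<^sub>R b)"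
    \<comment> \<open>Half of the tolerance ?e is spent on the partial derivatives, half on
      replacing their vector A by an element of the countable dense set.\<close>
    obtain a where a: "a \<in> D" "a \<in> ball A (?e / 2)" using D(2)[of "ball A (?e / 2)"] by auto
    have xS: "x \<in> S (a, m, n)"
      unfolding S_def split_conv
    proof (intro CollectI ballI allI impI)
      fix b :: 'a and t :: real assume b: "b \<in> Basis" and t: "\<bar>t\<bar> < 1 / real (Suc m)"
      have "k b \<le> m" unfolding m_def using b by auto
      then have "1 / real (Suc m) \<le> 1 / real (Suc (k b))" by (simp add: frac_le)
      then have "\<bar>f (x + t *\<^sub>R b) - f x - t * p b\<bar> \<le> ?e / 2 * \<bar>t\<bar>" using pk[OF b] t by simp
      moreover have "\<bar>p b - a \<bullet> b\<bar> \<le> ?e / 2"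
      proof -
        have "p b = A \<bullet> b" using b by (simp add: A_def inner_sum_left_Basis)
        then have "\<bar>p b - a \<bullet> b\<bar> \<le> norm (A - a)"
          using Basis_le_norm[OF b, of "A - a"] by (simp add: inner_diff_left)
        then show ?thesis using a(2) by (simp add: dist_norm)
      qed
      then have "\<bar>t * (p b - a \<bullet> b)\<bar> \<le> ?e / 2 * \<bar>t\<bar>"
        unfolding abs_mult by (subst mult.commute) (rule mult_right_mono, auto)
      moreover have "f (x + t *\<^sub>R b) - f x - t * (a \<bullet> b) = (f (x + t *\<^sub>R b) - f x - t * p b) + t * (p b - a \<bullet> b)"
        by (simp add: algebra_simps)
      moreover have "?e * \<bar>t\<bar> = ?e / 2 * \<bar>t\<bar> + ?e / 2 * \<bar>t\<bar>"
        by (simp only: field_sum_of_halves flip: distrib_right)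
      ultimately show "\<bar>f (x + t *\<^sub>R b) - f x - t * (a \<bullet> b)\<bar> \<le> ?e * \<bar>t\<bar>"
        by (simp only: order_trans[OF abs_triangle_ineq add_mono])
    qed
    have "x \<notin> P (a, m, n)" using x a(1) unfolding N_def by blast
    then have "\<exists>d>0. \<forall>s y. 0 < s \<and> s < d \<and> y \<in> cball x s \<longrightarrow> ball y (?e * s) \<inter> S (a, m, n) \<noteq> {}"
      using xS unfolding P_def split_conv mem_Collect_eq by meson
    then obtain d0 where d0: "0 < d0"
      "\<And>s y. 0 < s \<Longrightarrow> s < d0 \<Longrightarrow> y \<in> cball x s \<Longrightarrow> ball y (?e * s) \<inter> S (a, m, n) \<noteq> {}" by blast
    define d where "d = min d0 (1 / real (Suc m))"
    have d: "0 < d" "d \<le> d0" "d \<le> 1 / real (Suc m)" using d0(1) by (auto simp: d_def)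
    have "\<bar>f (x + h) - f x - a \<bullet> h\<bar> \<le> \<epsilon> * norm h" if "norm h < d" for h
    proof -
      have "\<bar>f (x + h) - f x - a \<bullet> h\<bar> \<le> real DIM('a) * ((2 * C + 1) * ?e) * norm h"
      proof (rule nonporous_imp_linear_approximation[OF L _ d(1) _ _ that, where S = "S (a, m, n)"])
        show "\<bar>f (z + t *\<^sub>R b) - f z - t * (a \<bullet> b)\<bar> \<le> ?e * \<bar>t\<bar>"
          if "z \<in> S (a, m, n)" "b \<in> Basis" "\<bar>t\<bar> < d" for z b t
        proof -
          have "\<bar>t\<bar> < 1 / real (Suc m)" using that d(3) by linarith
          then show ?thesis using that(1,2) unfolding S_def split_conv by blast
        qed
        show "ball y (?e * s) \<inter> S (a, m, n) \<noteq> {}" if "0 < s" "s < d" "y \<in> cball x s" for s y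
          using d0(2)[OF that(1) _ that(3)] that(2) d(2) by linarith
      qed simp
      also have "\<dots> \<le> \<epsilon> * norm h"
      proof (rule mult_right_mono)
        show "real DIM('a) * ((2 * C + 1) * ?e) \<le> \<epsilon>"
          using n M by (simp add: field_simps)
      qed simp
      finally show ?thesis .
    qed
    then show "\<exists>a d. 0 < d \<and> (\<forall>h. norm h < d \<longrightarrow> \<bar>f (x + h) - f x - a \<bullet> h\<bar> \<le> \<epsilon> * norm h)"
      using d(1) by blast
  qed
  then have "{x. \<not> f differentiable (at x)} \<subseteq> N" by blast
  then show ?thesis by (rule negligible_subset[OF N])
qed

section \<open>Minkowski norms and their duals\<close>

text \<open>The mean value theorem on either side of 1, where t powr (p - 1) is below or above 1.
  The equality case of Young's inequality rests on the strictness.\<close>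

lemma powr_Bernoulli_strict:
  fixes x p :: real
  assumes "1 < p" "0 \<le> x" "x \<noteq> 1"
  shows "1 + p * (x - 1) < x powr p"
proof (cases "x = 0")
  case True then show ?thesis using assms by simp
next
  case False
  have der: "((\<lambda>x. x powr p) has_real_derivative p * t powr (p - 1)) (at t)" if "0 < t" for t
    using that by (auto intro!: derivative_eq_intros)
  consider "x < 1" | "1 < x" using assms by linarith
  then show ?thesis
  proof cases
    case 1
    obtain t where t: "x < t" "t < 1" "1 powr p - x powr p = (1 - x) * (p * t powr (p - 1))"
      using MVT2[of x 1 "\<lambda>x. x powr p" "\<lambda>t. p * t powr (p - 1)"] der 1 False assms by auto
    have "t powr (p - 1) < 1" using t False assms powr_less_mono2[of "p - 1" t 1] by simp
    then have "(1 - x) * (p * t powr (p - 1)) < (1 - x) * (p * 1)"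
      using 1 assms by (intro mult_strict_left_mono) auto
    then show ?thesis using t(3) by (simp add: algebra_simps)
  next
    case 2
    obtain t where t: "1 < t" "t < x" "x powr p - 1 powr p = (x - 1) * (p * t powr (p - 1))"
      using MVT2[of 1 x "\<lambda>x. x powr p" "\<lambda>t. p * t powr (p - 1)"] der 2 by auto
    have "1 < t powr (p - 1)" using t assms powr_less_mono2[of "p - 1" 1 t] by simp
    then have "(x - 1) * (p * 1) < (x - 1) * (p * t powr (p - 1))"
      using 2 assms by (intro mult_strict_left_mono) auto
    then show ?thesis using t(3) by (simp add: algebra_simps)
  qed
qed

text \<open>Bernoulli's inequality for a / c, multiplied by c powr p. Writing the second factor as c
  powr (p - 1) makes its conjugate power c powr p and reduces equality to a = c.\<close>

lemma Young_powr:
  fixes a c p :: real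
  assumes p: "1 < p" and "0 \<le> a" "0 \<le> c"
  shows Young_powr_le: "p * (a * c powr (p - 1)) \<le> a powr p + (p - 1) * c powr p"
    and Young_powr_eq: "p * (a * c powr (p - 1)) = a powr p + (p - 1) * c powr p \<Longrightarrow> a = c"
proof -
  have "(a = c \<longrightarrow> p * (a * c powr (p - 1)) = a powr p + (p - 1) * c powr p) \<and>
    (a \<noteq> c \<longrightarrow> p * (a * c powr (p - 1)) < a powr p + (p - 1) * c powr p)"
  proof (cases "c = 0")
    case True then show ?thesis using assms by auto
  next
    case False
    then have c: "0 < c" using assms by simp
    have cp: "c powr p = c * c powr (p - 1)"
      using c by (simp add: powr_diff)
    have eq: "a * c powr (p - 1) = (a / c) * c powr p" "a powr p = (a / c) powr p * c powr p"
      using c assms by (simp_all add: cp powr_divide)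
    have "p * (a / c) < (a / c) powr p + (p - 1)" if "a \<noteq> c"
      using powr_Bernoulli_strict[OF p, of "a / c"] that c assms by (simp add: algebra_simps)
    then have "p * (a / c) * c powr p < ((a / c) powr p + (p - 1)) * c powr p" if "a \<noteq> c"
      using that c by (intro mult_strict_right_mono) auto
    moreover have "p * (a * c powr (p - 1)) = a powr p + (p - 1) * c powr p" if "a = c"
      using that by (simp add: cp algebra_simps)
    ultimately show ?thesis unfolding eq by (auto simp: algebra_simps)
  qed
  then show "p * (a * c powr (p - 1)) \<le> a powr p + (p - 1) * c powr p"
    and "p * (a * c powr (p - 1)) = a powr p + (p - 1) * c powr p \<Longrightarrow> a = c"
    by (cases "a = c"; simp)+
qed

text \<open>Symmetry is not assumed, so \<open>hom\<close> is restricted to positive s.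
  \<open>strict\<close> concerns two vectors of one level set whose segment avoids 0, because the
  Hessian from which it is derived exists only away from 0.\<close>

locale minkowski_norm =
  fixes \<Phi> :: "'a::euclidean_space \<Rightarrow> real"
  assumes cont: "continuous_on UNIV \<Phi>"
    and hom: "\<And>s w. 0 < s \<Longrightarrow> \<Phi> (s *\<^sub>R w) = s * \<Phi> w"
    and pos: "\<And>w. w \<noteq> 0 \<Longrightarrow> 0 < \<Phi> w"
    and diff: "\<And>w. w \<noteq> 0 \<Longrightarrow> \<Phi> differentiable (at w)"
    and strict: "\<And>v w s. v \<noteq> w \<Longrightarrow> 0 \<notin> closed_segment v w \<Longrightarrow> \<Phi> v = s \<Longrightarrow> \<Phi> w = s \<Longrightarrow>
      \<Phi> ((1/2) *\<^sub>R (v + w)) < s"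
begin

section \<open>Dual norm, Legendre vector and supporting functionals\<close>

lemma zero: "\<Phi> 0 = 0"
  using hom[of 2 0] by simp

lemma nonneg: "0 \<le> \<Phi> w"
  using pos[of w] zero by (cases "w = 0") auto

lemma lower_bound: "\<exists>m>0. \<forall>w. m * norm w \<le> \<Phi> w"
proof -
  have ne: "sphere (0::'a) 1 \<noteq> {}" by simp
  obtain v where v: "v \<in> sphere 0 1" "\<And>w. w \<in> sphere 0 1 \<Longrightarrow> \<Phi> v \<le> \<Phi> w"
    using continuous_attains_inf[OF compact_sphere ne continuous_on_subset[OF cont]] by auto
  have "\<Phi> v * norm w \<le> \<Phi> w" for w
  proof (cases "w = 0")
    case False
    then have "\<Phi> v \<le> \<Phi> (w /\<^sub>R norm w)" by (intro v) auto
    also have "\<dots> = \<Phi> w / norm w" using False hom[of "inverse (norm w)" w] by (simp add: divide_inverse)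
    finally show ?thesis using False by (simp add: field_simps)
  qed (simp add: zero)
  moreover have "0 < \<Phi> v" using v(1) by (intro pos) auto
  ultimately show ?thesis by blast
qed

definition dual :: "'a \<Rightarrow> real" where
  "dual a = (SUP w\<in>UNIV - {0}. a \<bullet> w / \<Phi> w)"

lemma bdd_above_quotient: "bdd_above ((\<lambda>w. a \<bullet> w / \<Phi> w) ` (UNIV - {0}))"
proof -
  obtain m where m: "0 < m" "\<And>w. m * norm w \<le> \<Phi> w" using lower_bound by blast
  have "a \<bullet> w / \<Phi> w \<le> norm a / m" if "w \<noteq> 0" for w
  proof -
    have "a \<bullet> w \<le> norm a * norm w" by (rule norm_cauchy_schwarz)
    also have "\<dots> \<le> norm a * (\<Phi> w / m)"
      using m(2)[of w] m(1) by (intro mult_left_mono) (simp_all add: pos_le_divide_eq mult.commute)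
    finally have "a \<bullet> w \<le> norm a / m * \<Phi> w" by simp
    then show ?thesis using pos[OF that] by (simp add: pos_divide_le_eq)
  qed
  then show ?thesis by (intro bdd_aboveI2) auto
qed

lemma inner_le_dual: "a \<bullet> w \<le> dual a * \<Phi> w"
proof (cases "w = 0")
  case False
  then have "a \<bullet> w / \<Phi> w \<le> dual a"
    unfolding dual_def by (intro cSUP_upper bdd_above_quotient) auto
  then show ?thesis using pos[OF False] by (simp add: field_simps)
qed (simp add: zero)

lemma UNIV_minus_0: "UNIV - {0::'a} \<noteq> {}"
  using nonempty_Basis nonzero_Basis by blast

lemma dual_le: "(\<And>w. a \<bullet> w \<le> s * \<Phi> w) \<Longrightarrow> dual a \<le> s"
  unfolding dual_def using UNIV_minus_0 pos by (intro cSUP_least) (auto simp: field_simps)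

text \<open>A functional takes opposite values at b and -b, so testing with both excludes a negative
  supremum.\<close>

lemma dual_nonneg: "0 \<le> dual a"
proof -
  obtain b :: 'a where "b \<noteq> 0" using UNIV_minus_0 by blast
  then have "0 < \<Phi> b" "0 < \<Phi> (- b)" by (auto intro!: pos)
  moreover have "a \<bullet> b \<le> dual a * \<Phi> b" "- (a \<bullet> b) \<le> dual a * \<Phi> (- b)"
    using inner_le_dual[of a b] inner_le_dual[of a "- b"] by auto
  ultimately show ?thesis by (smt (verit) mult_neg_pos)
qed

lemma dual_zero: "dual 0 = 0"
  using dual_le[of 0 0] dual_nonneg[of 0] by simp

lemma dual_eq_0_iff: "dual a = 0 \<longleftrightarrow> a = 0"
proof
  assume "dual a = 0"
  then have "a \<bullet> a \<le> 0" using inner_le_dual[of a a] by simp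
  then have "a \<bullet> a = 0" using inner_ge_zero[of a] by linarith
  then show "a = 0" by simp
qed (simp add: dual_zero)

lemma dual_scaleR: "0 \<le> s \<Longrightarrow> dual (s *\<^sub>R a) = s * dual a"
proof (cases "s = 0")
  case False
  assume "0 \<le> s"
  then have s: "0 < s" using False by simp
  have le: "dual (t *\<^sub>R c) \<le> t * dual c" if "0 < t" for t c
    using mult_left_mono[OF inner_le_dual[of c], of t] that by (intro dual_le) (simp add: mult.assoc)
  show ?thesis
    using le[OF s, of a] le[of "inverse s" "s *\<^sub>R a"] s by (simp add: field_simps)
qed (simp add: dual_zero)

text \<open>The quotient is homogeneous of degree 0, so its supremum is attained on the compact
  Euclidean sphere; dividing the maximizer by its value of \<Phi> normalizes it.\<close>

lemma dual_attained: "\<exists>w. \<Phi> w = 1 \<and> a \<bullet> w = dual a"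
proof -
  have ne: "sphere (0::'a) 1 \<noteq> {}" by simp
  have "continuous_on (sphere 0 1) (\<lambda>w. a \<bullet> w / \<Phi> w)"
  proof (intro continuous_intros continuous_on_subset[OF cont] ballI)
    show "\<Phi> w \<noteq> 0" if "w \<in> sphere 0 1" for w
    proof -
      have "w \<noteq> 0" using that by auto
      then show ?thesis using pos[of w] by simp
    qed
  qed simp
  then obtain v where v: "v \<in> sphere 0 1" "\<And>w. w \<in> sphere 0 1 \<Longrightarrow> a \<bullet> w / \<Phi> w \<le> a \<bullet> v / \<Phi> v"
    using continuous_attains_sup[OF compact_sphere ne] by blast
  have "v \<noteq> 0" using v(1) by auto
  then have v0: "v \<noteq> 0" "0 < \<Phi> v" using pos by auto
  have "a \<bullet> w \<le> a \<bullet> v / \<Phi> v * \<Phi> w" for w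
  proof (cases "w = 0")
    case False
    have "a \<bullet> (w /\<^sub>R norm w) / \<Phi> (w /\<^sub>R norm w) \<le> a \<bullet> v / \<Phi> v"
      using False by (intro v(2)) auto
    then have "a \<bullet> w / \<Phi> w \<le> a \<bullet> v / \<Phi> v"
      using False hom[of "inverse (norm w)" w] by simp
    then show ?thesis using pos[OF False] by (simp add: field_simps)
  qed (simp add: zero)
  then have "dual a \<le> a \<bullet> v / \<Phi> v" by (rule dual_le)
  moreover have "a \<bullet> v / \<Phi> v \<le> dual a" using inner_le_dual[of a v] v0 by (simp add: field_simps)
  ultimately have "a \<bullet> (v /\<^sub>R \<Phi> v) = dual a" by (simp add: divide_inverse mult.commute)
  moreover have "\<Phi> (v /\<^sub>R \<Phi> v) = 1" using v0 hom[of "inverse (\<Phi> v)" v] by simp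
  ultimately show ?thesis by blast
qed

text \<open>A maximizer with \<Phi> = 1, scaled by \<open>dual a\<close>, has both properties. Two
  different such vectors would have a midpoint with the same value of a but smaller \<Phi>, against
  \<open>inner_le_dual\<close>.\<close>

lemma legendre_ex1: "\<exists>!v. \<Phi> v = dual a \<and> a \<bullet> v = (dual a)\<^sup>2"
proof (cases "dual a = 0")
  case True
  show ?thesis
  proof (rule ex1I[of _ 0])
    show "v = 0" if "\<Phi> v = dual a \<and> a \<bullet> v = (dual a)\<^sup>2" for v
      using that True pos[of v] by force
  qed (simp add: True zero)
next
  case False
  then have s: "0 < dual a" using dual_nonneg[of a] by simp
  obtain w where w: "\<Phi> w = 1" "a \<bullet> w = dual a" using dual_attained by blast
  show ?thesis
  proof (rule ex_ex1I)
    show "\<exists>v. \<Phi> v = dual a \<and> a \<bullet> v = (dual a)\<^sup>2"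
      using w s hom by (intro exI[of _ "dual a *\<^sub>R w"]) (simp add: power2_eq_square)
  next
    fix v v' assume v: "\<Phi> v = dual a \<and> a \<bullet> v = (dual a)\<^sup>2" and v': "\<Phi> v' = dual a \<and> a \<bullet> v' = (dual a)\<^sup>2"
    show "v = v'"
    proof (rule ccontr)
      assume "v \<noteq> v'"
      \<comment> \<open>The functional a has the constant positive value (dual a)^2 on the segment,
        which therefore avoids 0.\<close>
      moreover have "0 \<notin> closed_segment v v'"
      proof
        assume "0 \<in> closed_segment v v'"
        then obtain t where t: "0 = (1 - t) *\<^sub>R v + t *\<^sub>R v'" by (auto simp: closed_segment_def)
        have "a \<bullet> ((1 - t) *\<^sub>R v + t *\<^sub>R v') = (dual a)\<^sup>2"
          using v v' by (simp add: inner_add_right algebra_simps)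
        then show False using s unfolding t[symmetric] by simp
      qed
      ultimately have lt: "\<Phi> ((1/2) *\<^sub>R (v + v')) < dual a" using v v' by (intro strict) auto
      have "(dual a)\<^sup>2 = a \<bullet> ((1/2) *\<^sub>R (v + v'))"
        using v v' by (simp add: inner_add_right)
      also have "\<dots> \<le> dual a * \<Phi> ((1/2) *\<^sub>R (v + v'))" by (rule inner_le_dual)
      also have "\<dots> < dual a * dual a" using lt s by simp
      finally show False by (simp add: power2_eq_square)
    qed
  qed
qed

text \<open>The function s \<Phi> - a has its minimum 0 at v, so a is s times the derivative of
  \<Phi> at v; in the same way b is this derivative itself.\<close>

lemma support_unique:
  assumes v: "v \<noteq> 0" and a: "\<And>w. a \<bullet> w \<le> s * \<Phi> w" "a \<bullet> v = s * \<Phi> v"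
    and b: "\<And>w. b \<bullet> w \<le> \<Phi> w" "b \<bullet> v = \<Phi> v"
  shows "a = s *\<^sub>R b"
proof -
  obtain D where D: "(\<Phi> has_derivative D) (at v)" using diff[OF v] by (auto simp: differentiable_def)
  have *: "c \<bullet> w = t * D w" if "\<And>w. c \<bullet> w \<le> t * \<Phi> w" "c \<bullet> v = t * \<Phi> v" for c t w
  proof -
    have "((\<lambda>w. t * \<Phi> w - c \<bullet> w) has_derivative (\<lambda>w. t * D w - c \<bullet> w)) (at v)"
      by (intro derivative_intros D)
    then have "(\<lambda>w. t * D w - c \<bullet> w) = (\<lambda>h. 0)"
      by (rule has_derivative_local_min) (use that in auto)
    then show ?thesis by (metis eq_iff_diff_eq_0)
  qed
  have "a \<bullet> w = (s *\<^sub>R b) \<bullet> w" for w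
    using *[of a s w] *[of b 1 w] a b by simp
  then show ?thesis using vector_eq_rdot[of a "s *\<^sub>R b"] by blast
qed

text \<open>Young's inequality for c = |K|^(1/(p-1)) and the larger dual norm M of a and -a,
  combined with |a \<bullet> v| \<le> M. Equality forces M = c and makes - sgn K a a support of M
  \<Phi> at v; as b supports \<Phi> there, a is a multiple of b. The last statement supplies an
  integrable majorant later on.\<close>

lemma Finsler_Young:
  fixes K p :: real and a b v :: 'a
  assumes p: "1 < p" and b: "dual b = 1" and v: "\<Phi> v = 1" "b \<bullet> v = 1"
  defines "N \<equiv> max (dual a powr p) (dual (- a) powr p)"
    and "E \<equiv> a = (- sgn K * \<bar>K\<bar> powr (1 / (p - 1))) *\<^sub>R b \<and> (a \<noteq> 0 \<longrightarrow> max (dual b) (dual (- b)) = dual b)"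
  shows Finsler_Young_le: "p * (- K * (a \<bullet> v)) \<le> N + (p - 1) * \<bar>K\<bar> powr (p / (p - 1))"
    and Finsler_Young_eq: "p * (- K * (a \<bullet> v)) = N + (p - 1) * \<bar>K\<bar> powr (p / (p - 1)) \<longleftrightarrow> E"
    and Finsler_Young_norm: "E \<Longrightarrow> N = \<bar>K\<bar> powr (p / (p - 1))"
    and Finsler_Young_abs: "\<bar>K * (a \<bullet> v)\<bar> \<le> N + (p - 1) * \<bar>K\<bar> powr (p / (p - 1))"
proof -
  define M where "M = max (dual a) (dual (- a))"
  define c where "c = \<bar>K\<bar> powr (1 / (p - 1))"
  have M0: "0 \<le> M" using dual_nonneg[of a] by (simp add: M_def)
  have c0: "0 \<le> c" by (simp add: c_def)
  have NM: "N = M powr p"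
    using p dual_nonneg[of a] dual_nonneg[of "- a"] powr_mono2[of p "dual a" "dual (- a)"]
      powr_mono2[of p "dual (- a)" "dual a"] by (auto simp: N_def M_def max_def)
  have cK: "c powr (p - 1) = \<bar>K\<bar>" "c powr p = \<bar>K\<bar> powr (p / (p - 1))"
    using p by (simp_all add: c_def powr_powr)
  have c_eq_0: "c = 0 \<longleftrightarrow> K = 0" by (simp add: c_def)
  have av: "\<bar>a \<bullet> v\<bar> \<le> M"
    using inner_le_dual[of a v] inner_le_dual[of "- a" v] v by (auto simp: M_def)
  have v0: "v \<noteq> 0" using v zero by auto
  have ble: "b \<bullet> w \<le> \<Phi> w" for w using inner_le_dual[of b w] b by simp
  have KM: "\<bar>K * (a \<bullet> v)\<bar> \<le> M * \<bar>K\<bar>"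
    using mult_left_mono[OF av, of "\<bar>K\<bar>"] by (simp add: abs_mult mult.commute)
  have Y: "p * (M * \<bar>K\<bar>) \<le> N + (p - 1) * \<bar>K\<bar> powr (p / (p - 1))"
    using Young_powr_le[OF p M0 c0] unfolding cK NM .
  have "p * (- K * (a \<bullet> v)) \<le> p * (M * \<bar>K\<bar>)" using KM p by (intro mult_left_mono) auto
  with Y show le: "p * (- K * (a \<bullet> v)) \<le> N + (p - 1) * \<bar>K\<bar> powr (p / (p - 1))" by linarith
  have "1 * (M * \<bar>K\<bar>) \<le> p * (M * \<bar>K\<bar>)" using p M0 by (intro mult_right_mono) auto
  with Y KM show "\<bar>K * (a \<bullet> v)\<bar> \<le> N + (p - 1) * \<bar>K\<bar> powr (p / (p - 1))" by linarith
  \<comment> \<open>If a is nonzero, a and -a are c b and - c b in an order given by the sign of K,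
    and the condition on b makes the larger dual norm equal to c. If a = 0, then K = 0 because b is
    nonzero.\<close>
  have E_M: "M = c" if E
  proof (cases "a = 0")
    case True
    have "b \<noteq> 0" using b dual_zero by auto
    then have "K = 0" using that True p by (auto simp: E_def sgn_zero_iff)
    then show ?thesis using True by (simp add: M_def dual_zero c_def)
  next
    case False
    then have mb: "max (dual b) (dual (- b)) = 1" using that b by (auto simp: E_def)
    consider "0 < K" | "K < 0" | "K = 0" by linarith
    then show ?thesis
    proof cases
      case 1
      then have "a = c *\<^sub>R (- b)" "- a = c *\<^sub>R b" using that by (auto simp: E_def c_def)
      then have "dual a = c * dual (- b)" "dual (- a) = c * dual b" using dual_scaleR[OF c0] by metis+
      then show ?thesis using mb c0 unfolding M_def by (metis max.commute max_mult_distrib_left mult.right_neutral)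
    next
      case 2
      then have "a = c *\<^sub>R b" "- a = c *\<^sub>R (- b)" using that by (auto simp: E_def c_def)
      then have "dual a = c * dual b" "dual (- a) = c * dual (- b)" using dual_scaleR[OF c0] by metis+
      then show ?thesis using mb c0 unfolding M_def by (metis max_mult_distrib_left mult.right_neutral)
    qed (use that False in \<open>simp add: E_def\<close>)
  qed
  then show "E \<Longrightarrow> N = \<bar>K\<bar> powr (p / (p - 1))" unfolding NM cK(2)[symmetric] by simp
  show "p * (- K * (a \<bullet> v)) = N + (p - 1) * \<bar>K\<bar> powr (p / (p - 1)) \<longleftrightarrow> E"
  proof
    assume E: E
    have "a \<bullet> v = - sgn K * c" using E v by (simp add: E_def c_def)
    then have "- K * (a \<bullet> v) = c * c powr (p - 1)" by (simp add: cK abs_sgn mult.assoc)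
    also have "\<dots> = c powr p" using c0 p by (cases "c = 0") (auto simp: powr_diff)
    finally show "p * (- K * (a \<bullet> v)) = N + (p - 1) * \<bar>K\<bar> powr (p / (p - 1))"
      unfolding NM E_M[OF E] cK(2)[symmetric] by (simp add: algebra_simps)
  next
    assume eq: "p * (- K * (a \<bullet> v)) = N + (p - 1) * \<bar>K\<bar> powr (p / (p - 1))"
    then have "p * (M * \<bar>K\<bar>) = N + (p - 1) * \<bar>K\<bar> powr (p / (p - 1))"
      using Y \<open>p * (- K * (a \<bullet> v)) \<le> p * (M * \<bar>K\<bar>)\<close> by linarith
    then have Mc: "M = c" using Young_powr_eq[OF p M0 c0] unfolding cK NM by simp
    have w: "- K * (a \<bullet> v) = M * \<bar>K\<bar>"
    proof -
      have "p * (- K * (a \<bullet> v)) = p * (M * \<bar>K\<bar>)"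
        using eq Y \<open>p * (- K * (a \<bullet> v)) \<le> p * (M * \<bar>K\<bar>)\<close> by linarith
      then show ?thesis using p by (simp only: mult_cancel_left) simp
    qed
    show E
    proof (cases "K = 0")
      case True
      then have "M = 0" using Mc by (simp add: c_def)
      then have "a = 0" using dual_nonneg[of a] dual_nonneg[of "- a"] dual_eq_0_iff[of a] by (auto simp: M_def max_def split: if_splits)
      then show ?thesis using True by (simp add: E_def)
    next
      case False
      have sg: "(- sgn K *\<^sub>R a) \<bullet> v = M * \<Phi> v"
      proof -
        have "\<bar>K\<bar> * (- sgn K * (a \<bullet> v)) = \<bar>K\<bar> * M" using w by (simp add: abs_sgn mult_ac sgn_if split: if_splits)
        then have "- sgn K * (a \<bullet> v) = M" using False by (simp only: mult_cancel_left) simp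
        then show ?thesis using v by simp
      qed
      have dM: "dual (- sgn K *\<^sub>R a) \<le> M" using False by (auto simp: sgn_if M_def)
      have "- sgn K *\<^sub>R a = M *\<^sub>R b"
      proof (rule support_unique[OF v0])
        show "(- sgn K *\<^sub>R a) \<bullet> w \<le> M * \<Phi> w" for w
          using inner_le_dual[of "- sgn K *\<^sub>R a" w] mult_right_mono[OF dM nonneg[of w]] by linarith
      qed (use sg ble v in auto)
      then have a: "a = (- sgn K * c) *\<^sub>R b"
        using False Mc by (auto simp: sgn_if split: if_splits) (metis minus_minus scaleR_minus_left)
      have cpos: "0 < c" using c0 c_eq_0 False by simp
      \<comment> \<open>One of a and -a equals c (-b), so c times the dual norm of -b is at most M =
        c, and c can be cancelled.\<close>
      have "max (dual b) (dual (- b)) = dual b"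
      proof -
        have "a = c *\<^sub>R b \<or> - a = c *\<^sub>R b" "- a = c *\<^sub>R (- b) \<or> a = c *\<^sub>R (- b)" using a False by (auto simp: sgn_if)
        then have "c * dual (- b) \<le> M"
          using dual_scaleR[OF c0, of "- b"] by (auto simp: M_def)
        then show ?thesis using b Mc cpos by simp
      qed
      then show ?thesis using a by (simp add: E_def c_def)
    qed
  qed
qed

end

section \<open>Charts and tangent vectors\<close>

locale finsler_space =
  fixes A :: "('a::{second_countable_topology,t2_space}, 'n::finite) chart set"
    and F :: "'a \<Rightarrow> ('a, 'n) tvec \<Rightarrow> real"
  assumes atlas: "smooth_atlas A" and metric: "finsler_metric A F"
    and conn: "connected (UNIV :: 'a set)"
begin

section \<open>Charts, coordinate changes and tangent vectors in coordinates\<close>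

lemma ex_chart: "\<exists>c. c \<in> A \<and> x \<in> fst c"
proof -
  have "x \<in> (\<Union>c\<in>A. fst c)" using atlas by (simp add: smooth_atlas_def)
  then show ?thesis by blast
qed

lemma some_chart:
  "(SOME c. c \<in> A \<and> x \<in> fst c) \<in> A" "x \<in> fst (SOME c. c \<in> A \<and> x \<in> fst c)"
  using someI_ex[OF ex_chart[of x]] by auto

lemma chart_homeomorphism: "c \<in> A \<Longrightarrow> homeomorphism (fst c) (snd c ` fst c) (snd c) (chart_inv c)"
  and open_chart: "c \<in> A \<Longrightarrow> open (fst c)"
  and open_chart_image: "c \<in> A \<Longrightarrow> open (snd c ` fst c)"
  using atlas by (auto simp: smooth_atlas_def)

lemma chart_inv_chart [simp]: "c \<in> A \<Longrightarrow> x \<in> fst c \<Longrightarrow> chart_inv c (snd c x) = x"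
  using chart_homeomorphism by (auto simp: homeomorphism_def)

lemma chart_chart_inv [simp]: "c \<in> A \<Longrightarrow> z \<in> snd c ` fst c \<Longrightarrow> snd c (chart_inv c z) = z"
  using chart_homeomorphism by (auto simp: homeomorphism_def)

lemma chart_inv_in: "c \<in> A \<Longrightarrow> z \<in> snd c ` fst c \<Longrightarrow> chart_inv c z \<in> fst c"
  by auto

lemma continuous_on_chart: "c \<in> A \<Longrightarrow> continuous_on (fst c) (snd c)"
  using chart_homeomorphism by (auto simp: homeomorphism_def)

lemma continuous_on_chart_inv: "c \<in> A \<Longrightarrow> continuous_on (snd c ` fst c) (chart_inv c)"
  using chart_homeomorphism by (auto simp: homeomorphism_def)

lemma open_chart_preimage:
  assumes "c \<in> A" "open W"
  shows "open (fst c \<inter> snd c -` W)"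
  by (rule continuous_open_preimage[OF continuous_on_chart open_chart]) (use assms in auto)

lemma open_chart_inv_preimage:
  assumes "c \<in> A" "open W"
  shows "open (snd c ` fst c \<inter> chart_inv c -` W)"
  by (rule continuous_open_preimage[OF continuous_on_chart_inv open_chart_image]) (use assms in auto)

lemma chart_image_Int:
  assumes "c \<in> A"
  shows "snd c ` (fst c \<inter> W) = snd c ` fst c \<inter> chart_inv c -` W"
  using assms by (auto intro!: image_eqI)

definition trans_deriv :: "('a, 'n) chart \<Rightarrow> ('a, 'n) chart \<Rightarrow> 'a \<Rightarrow> real ^ 'n \<Rightarrow> real ^ 'n" where
  "trans_deriv c c' x = frechet_derivative (snd c' \<circ> chart_inv c) (at (snd c x))"

lemma transition_has_derivative:
  assumes "c \<in> A" "c' \<in> A" "x \<in> fst c" "x \<in> fst c'"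
  shows "((snd c' \<circ> chart_inv c) has_derivative trans_deriv c c' x) (at (snd c x))"
proof -
  have "smooth_on (snd c ` (fst c \<inter> fst c')) (snd c' \<circ> chart_inv c)"
    using atlas assms by (auto simp: smooth_atlas_def)
  then have "Ck_on 1 (snd c' \<circ> chart_inv c) (snd c ` (fst c \<inter> fst c'))"
    unfolding smooth_on_def by blast
  then have "(snd c' \<circ> chart_inv c) differentiable (at (snd c x))"
    using assms by (auto simp: One_nat_def)
  then show ?thesis unfolding trans_deriv_def frechet_derivative_works .
qed

lemma linear_trans_deriv:
  assumes "c \<in> A" "c' \<in> A" "x \<in> fst c" "x \<in> fst c'"
  shows "linear (trans_deriv c c' x)"
  using transition_has_derivative[OF assms] has_derivative_linear by blast

text \<open>The chain rule on the open overlap of the charts. This cocycle property is what makes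
  \<open>coord_tvec\<close> a tangent vector.\<close>

lemma trans_deriv_comp:
  assumes c: "c \<in> A" "c' \<in> A" "c'' \<in> A" and x: "x \<in> fst c" "x \<in> fst c'" "x \<in> fst c''"
  shows "trans_deriv c' c'' x (trans_deriv c c' x w) = trans_deriv c c'' x w"
proof -
  have "((snd c'' \<circ> chart_inv c') \<circ> (snd c' \<circ> chart_inv c) has_derivative
      trans_deriv c' c'' x \<circ> trans_deriv c c' x) (at (snd c x))"
    using transition_has_derivative[of c c' x] transition_has_derivative[of c' c'' x] c x
    by (intro diff_chain_at) auto
  moreover have "open (snd c ` fst c \<inter> chart_inv c -` fst c')"
    by (rule open_chart_inv_preimage[OF c(1) open_chart[OF c(2)]])
  ultimately have "((snd c'' \<circ> chart_inv c) has_derivative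
      trans_deriv c' c'' x \<circ> trans_deriv c c' x) (at (snd c x))"
    by (rule has_derivative_transform_within_open) (use c x in auto)
  then have "trans_deriv c c'' x = trans_deriv c' c'' x \<circ> trans_deriv c c' x"
    by (rule has_derivative_unique[OF transition_has_derivative[OF c(1,3) x(1,3)]])
  then show ?thesis by simp
qed

lemma trans_deriv_same:
  assumes c: "c \<in> A" and x: "x \<in> fst c"
  shows "trans_deriv c c x w = w"
proof -
  have "((\<lambda>z. z) has_derivative (\<lambda>w. w)) (at (snd c x))" by (rule has_derivative_ident)
  then have "((snd c \<circ> chart_inv c) has_derivative (\<lambda>w. w)) (at (snd c x))"
    by (rule has_derivative_transform_within_open[OF _ open_chart_image[OF c]]) (use c x in auto)
  then have "trans_deriv c c x = (\<lambda>w. w)"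
    by (rule has_derivative_unique[OF transition_has_derivative[OF c c x x]])
  then show ?thesis by simp
qed

lemma coord_tvec_eq: "coord_tvec A c x w = (\<lambda>c'. if c' \<in> A \<and> x \<in> fst c' then trans_deriv c c' x w else 0)"
  by (simp add: coord_tvec_def trans_deriv_def fun_eq_iff)

lemma coord_tvec_in_tangent_space:
  assumes "c \<in> A" "x \<in> fst c"
  shows "coord_tvec A c x w \<in> tangent_space A x"
  unfolding tangent_space_def trans_deriv_def[symmetric]
proof (intro CollectI conjI allI ballI impI)
  show "coord_tvec A c x w c'' = trans_deriv c' c'' x (coord_tvec A c x w c')"
    if "c' \<in> A" "c'' \<in> A" "x \<in> fst c' \<and> x \<in> fst c''" for c' c''
    using trans_deriv_comp[of c c' c'' x w] that assms by (simp add: coord_tvec_eq)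
qed (auto simp: coord_tvec_eq)

lemma coord_tvec_same [simp]:
  assumes "c \<in> A" "x \<in> fst c"
  shows "coord_tvec A c x w c = w"
  using assms trans_deriv_same by (simp add: coord_tvec_eq)

text \<open>Together with \<open>coord_tvec_same\<close> this identifies the tangent space at x with
  the coordinate space of c, where the computations take place.\<close>

lemma coord_tvec_tangent [simp]:
  assumes "c \<in> A" "x \<in> fst c" "v \<in> tangent_space A x"
  shows "coord_tvec A c x (v c) = v"
proof
  fix c'
  have v: "c' \<in> A \<and> x \<in> fst c' \<Longrightarrow> v c' = trans_deriv c c' x (v c)"
    "\<not> (c' \<in> A \<and> x \<in> fst c') \<Longrightarrow> v c' = 0"
    using assms unfolding tangent_space_def trans_deriv_def[symmetric] by blast+
  then have "v c' = (if c' \<in> A \<and> x \<in> fst c' then trans_deriv c c' x (v c) else 0)"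
    by (simp only: if_split) blast
  then show "coord_tvec A c x (v c) c' = v c'" by (simp add: coord_tvec_eq)
qed

lemma coord_tvec_0: "c \<in> A \<Longrightarrow> x \<in> fst c \<Longrightarrow> coord_tvec A c x 0 = (\<lambda>_. 0)"
  using linear_0[OF linear_trans_deriv] by (auto simp: coord_tvec_eq fun_eq_iff)

lemma coord_tvec_scaleR:
  "c \<in> A \<Longrightarrow> x \<in> fst c \<Longrightarrow> coord_tvec A c x (s *\<^sub>R w) = (\<lambda>c'. s *\<^sub>R coord_tvec A c x w c')"
  using linear_scale[OF linear_trans_deriv] by (auto simp: coord_tvec_eq fun_eq_iff)

lemma tangent_eq_0_iff:
  assumes "c \<in> A" "x \<in> fst c" "v \<in> tangent_space A x"
  shows "v = (\<lambda>_. 0) \<longleftrightarrow> v c = 0"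
  using coord_tvec_tangent[OF assms] coord_tvec_0[OF assms(1,2)] by auto

lemma zero_in_tangent_space: "(\<lambda>_. 0) \<in> tangent_space A x"
  using coord_tvec_0 coord_tvec_in_tangent_space ex_chart by metis

text \<open>The coordinate covector of df, identified with a vector by the Euclidean inner product
  so that \<open>dual\<close> can be applied to it.\<close>

definition grad_in :: "('a, 'n) chart \<Rightarrow> ('a \<Rightarrow> real) \<Rightarrow> real ^ 'n \<Rightarrow> real ^ 'n" where
  "grad_in c f z = (\<Sum>b\<in>Basis. frechet_derivative (f \<circ> chart_inv c) (at z) b *\<^sub>R b)"

lemma grad_in:
  assumes "(f \<circ> chart_inv c) differentiable (at z)"
  shows "frechet_derivative (f \<circ> chart_inv c) (at z) w = grad_in c f z \<bullet> w"
proof -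
  have lin: "linear (frechet_derivative (f \<circ> chart_inv c) (at z))"
    by (rule linear_frechet_derivative[OF assms])
  have "frechet_derivative (f \<circ> chart_inv c) (at z) w =
      frechet_derivative (f \<circ> chart_inv c) (at z) (\<Sum>b\<in>Basis. (w \<bullet> b) *\<^sub>R b)"
    by (simp add: euclidean_representation)
  also have "\<dots> = (\<Sum>b\<in>Basis. (w \<bullet> b) * frechet_derivative (f \<circ> chart_inv c) (at z) b)"
    by (simp add: linear_sum[OF lin] linear_scale[OF lin])
  also have "\<dots> = grad_in c f z \<bullet> w"
    unfolding grad_in_def inner_sum_left by (intro sum.cong) (auto simp: inner_commute)
  finally show ?thesis .
qed

lemma grad_in_has_derivative:
  assumes "(f \<circ> chart_inv c) differentiable (at z)"
  shows "((f \<circ> chart_inv c) has_derivative (\<lambda>w. grad_in c f z \<bullet> w)) (at z)"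
proof -
  have "frechet_derivative (f \<circ> chart_inv c) (at z) = (\<lambda>w. grad_in c f z \<bullet> w)"
    using grad_in[OF assms] by (simp add: fun_eq_iff)
  then show ?thesis using frechet_derivative_works[THEN iffD1, OF assms] by simp
qed

lemma grad_in_unique:
  assumes "((f \<circ> chart_inv c) has_derivative (\<lambda>w. a \<bullet> w)) (at z)"
  shows "grad_in c f z = a"
proof -
  have d: "(f \<circ> chart_inv c) differentiable (at z)" using assms by (auto simp: differentiable_def)
  have "(\<lambda>w. grad_in c f z \<bullet> w) = (\<lambda>w. a \<bullet> w)"
    by (rule has_derivative_unique[OF grad_in_has_derivative[OF d] assms])
  then show ?thesis by (metis vector_eq_rdot)
qed

definition diff_at :: "('a \<Rightarrow> real) \<Rightarrow> 'a \<Rightarrow> bool" where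
  "diff_at f x \<longleftrightarrow> (\<exists>c\<in>A. x \<in> fst c \<and> (f \<circ> chart_inv c) differentiable (at (snd c x)))"

lemma change_chart_has_derivative:
  assumes c: "c \<in> A" "c' \<in> A" and x: "x \<in> fst c" "x \<in> fst c'"
    and D: "((f \<circ> chart_inv c') has_derivative D) (at (snd c' x))"
  shows "((f \<circ> chart_inv c) has_derivative D \<circ> trans_deriv c c' x) (at (snd c x))"
proof -
  have "((f \<circ> chart_inv c') \<circ> (snd c' \<circ> chart_inv c) has_derivative D \<circ> trans_deriv c c' x) (at (snd c x))"
    using transition_has_derivative[OF c x] D c x by (intro diff_chain_at) auto
  moreover have "open (snd c ` fst c \<inter> chart_inv c -` fst c')"
    by (rule open_chart_inv_preimage[OF c(1) open_chart[OF c(2)]])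
  ultimately show ?thesis
    by (rule has_derivative_transform_within_open) (use c x in auto)
qed

lemma diff_at_iff:
  assumes "c \<in> A" "x \<in> fst c"
  shows "diff_at f x \<longleftrightarrow> (f \<circ> chart_inv c) differentiable (at (snd c x))"
proof
  assume "diff_at f x"
  then obtain c' D where c': "c' \<in> A" "x \<in> fst c'"
    and D: "((f \<circ> chart_inv c') has_derivative D) (at (snd c' x))"
    unfolding diff_at_def differentiable_def by blast
  from change_chart_has_derivative[OF assms(1) c'(1) assms(2) c'(2) D]
  show "(f \<circ> chart_inv c) differentiable (at (snd c x))" unfolding differentiable_def by blast
qed (use assms in \<open>unfold diff_at_def, blast\<close>)

text \<open>The chain rule for coordinate changes removes the arbitrary chart chosen inside
  \<open>differential\<close>: from here on any chart around x may be used.\<close>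

lemma differential_eq:
  assumes c: "c \<in> A" "x \<in> fst c" and v: "v \<in> tangent_space A x" and f: "diff_at f x"
  shows "differential A f x v = grad_in c f (snd c x) \<bullet> v c"
proof -
  define c' where "c' = (SOME c. c \<in> A \<and> x \<in> fst c)"
  have c': "c' \<in> A" "x \<in> fst c'" using some_chart unfolding c'_def by auto
  have d: "(f \<circ> chart_inv c) differentiable (at (snd c x))" and d': "(f \<circ> chart_inv c') differentiable (at (snd c' x))"
    using f diff_at_iff[OF c] diff_at_iff[OF c'] by blast+
  have "((f \<circ> chart_inv c) has_derivative (\<lambda>w. grad_in c' f (snd c' x) \<bullet> w) \<circ> trans_deriv c c' x) (at (snd c x))"
    using change_chart_has_derivative[OF c(1) c'(1) c(2) c'(2) grad_in_has_derivative[OF d']] .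
  then have "(\<lambda>w. grad_in c f (snd c x) \<bullet> w) = (\<lambda>w. grad_in c' f (snd c' x) \<bullet> w) \<circ> trans_deriv c c' x"
    by (rule has_derivative_unique[OF grad_in_has_derivative[OF d]])
  then have "grad_in c f (snd c x) \<bullet> v c = grad_in c' f (snd c' x) \<bullet> trans_deriv c c' x (v c)"
    by (metis comp_apply)
  also have "trans_deriv c c' x (v c) = v c'"
    using fun_cong[OF coord_tvec_tangent[OF c v], of c'] c' by (simp add: coord_tvec_eq)
  finally show ?thesis
    unfolding differential_def Let_def c'_def[symmetric] using d' by (simp only: if_True grad_in[OF d'])
qed

lemma differential_not_diff:
  assumes "\<not> diff_at f x"
  shows "differential A f x v = 0"
  using assms[unfolded diff_at_iff[OF some_chart]] unfolding differential_def Let_def by (rule if_not_P)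

section \<open>The metric in coordinates: positivity and strict convexity\<close>

abbreviation "L \<equiv> local_metric A F"

lemma F_eq_local:
  assumes "c \<in> A" "x \<in> fst c" "v \<in> tangent_space A x"
  shows "F x v = L c (snd c x, v c)"
  using assms by (simp add: local_metric_def)

lemma local_metric_smooth:
  assumes "c \<in> A"
  shows "Ck_on k (L c) ((snd c ` fst c) \<times> (UNIV - {0}))"
  using metric assms unfolding finsler_metric_def smooth_on_def by blast

lemma local_metric_differentiable:
  assumes c: "c \<in> A" and z: "z \<in> snd c ` fst c" and w: "w \<noteq> 0"
  shows "L c differentiable (at (z, w))"
  using local_metric_smooth[OF c, of 1] z w by (auto simp: One_nat_def)

lemma local_metric_partial_differentiable:
  assumes c: "c \<in> A" and z: "z \<in> snd c ` fst c" and w: "w \<noteq> 0" and b: "b \<in> Basis"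
  shows "(\<lambda>q. frechet_derivative (L c) (at q) b) differentiable (at (z, w))"
proof -
  have "Ck_on (Suc (Suc 0)) (L c) ((snd c ` fst c) \<times> (UNIV - {0}))" by (rule local_metric_smooth[OF c])
  then show ?thesis using z w b by auto
qed

lemma local_metric_continuous:
  assumes "c \<in> A"
  shows "continuous_on ((snd c ` fst c) \<times> UNIV) (L c)"
  using metric assms unfolding finsler_metric_def by blast

lemma local_metric_hom:
  assumes c: "c \<in> A" and z: "z \<in> snd c ` fst c" and s: "0 < s"
  shows "L c (z, s *\<^sub>R w) = s * L c (z, w)"
proof -
  have x: "chart_inv c z \<in> fst c" by (rule chart_inv_in[OF c z])
  have "F (chart_inv c z) (\<lambda>c'. s *\<^sub>R coord_tvec A c (chart_inv c z) w c') =
      s * F (chart_inv c z) (coord_tvec A c (chart_inv c z) w)"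
    using metric s coord_tvec_in_tangent_space[OF c x, of w] unfolding finsler_metric_def by blast
  then show ?thesis by (simp add: local_metric_def coord_tvec_scaleR[OF c x])
qed

lemma local_metric_nonneg:
  assumes c: "c \<in> A" and z: "z \<in> snd c ` fst c"
  shows "0 \<le> L c (z, w)"
proof -
  have "0 \<le> F (chart_inv c z) (coord_tvec A c (chart_inv c z) w)"
    using metric coord_tvec_in_tangent_space[OF c chart_inv_in[OF c z]]
    unfolding finsler_metric_def by blast
  then show ?thesis by (simp add: local_metric_def)
qed

lemma local_metric_snd_has_derivative:
  assumes c: "c \<in> A" and z: "z \<in> snd c ` fst c" and w: "w \<noteq> 0"
  shows "((\<lambda>y. L c (z, y)) has_derivative (\<lambda>h. frechet_derivative (L c) (at (z, w)) (0, h))) (at w)"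
proof -
  have "((\<lambda>y. (z, y)) has_derivative (\<lambda>h. (0, h))) (at w)"
    by (intro has_derivative_Pair has_derivative_const has_derivative_ident)
  moreover have "(L c has_derivative frechet_derivative (L c) (at (z, w))) (at (z, w))"
    using local_metric_differentiable[OF c z w] unfolding frechet_derivative_works .
  ultimately have "(L c \<circ> (\<lambda>y. (z, y)) has_derivative frechet_derivative (L c) (at (z, w)) \<circ> (\<lambda>h. (0, h))) (at w)"
    by (rule diff_chain_at)
  then show ?thesis by (simp add: o_def)
qed

lemma energy_has_derivative:
  assumes c: "c \<in> A" and z: "z \<in> snd c ` fst c" and w: "w \<noteq> 0"
  shows "((\<lambda>y. (L c (z, y))\<^sup>2) has_derivative
    (\<lambda>h. 2 * L c (z, w) * frechet_derivative (L c) (at (z, w)) (0, h))) (at w)"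
  using has_derivative_power[OF local_metric_snd_has_derivative[OF assms], of 2]
  by (simp add: mult_ac)

text \<open>The inner derivative of \<open>fundamental_tensor\<close>, isolated so that it can be
  differentiated once more.\<close>

definition energy_partial :: "('a, 'n) chart \<Rightarrow> real ^ 'n \<Rightarrow> 'n \<Rightarrow> real ^ 'n \<Rightarrow> real" where
  "energy_partial c z i w = frechet_derivative (\<lambda>y. (L c (z, y))\<^sup>2) (at w) (axis i 1)"

text \<open>Smoothness is assumed for L on the bundle chart, not for its square on a fibre. Away
  from 0 the partial derivative is 2 L times a derivative of L in a fibre direction, and both
  factors are differentiable.\<close>

lemma energy_partial_differentiable:
  assumes c: "c \<in> A" and z: "z \<in> snd c ` fst c" and w: "w \<noteq> 0"
  shows "energy_partial c z i differentiable (at w)"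
proof -
  let ?P = "\<lambda>q. frechet_derivative (L c) (at q) (0, axis i 1)"
  have "?P differentiable (at (z, w))"
    by (rule local_metric_partial_differentiable[OF c z w]) (simp add: Basis_prod_def axis_in_Basis_iff)
  moreover have "(\<lambda>y. (z, y)) differentiable (at w)"
    by (intro differentiable_Pair differentiable_const differentiable_ident)
  ultimately have "(?P \<circ> (\<lambda>y. (z, y))) differentiable (at w)"
    by (intro differentiable_chain_at) auto
  moreover have "(\<lambda>y. L c (z, y)) differentiable (at w)"
    using local_metric_snd_has_derivative[OF assms] by (auto simp: differentiable_def)
  ultimately have "(\<lambda>y. 2 * L c (z, y) * ?P (z, y)) differentiable (at w)"
    by (intro derivative_intros differentiable_mult) (auto simp: o_def)
  then obtain D where D: "((\<lambda>y. 2 * L c (z, y) * ?P (z, y)) has_derivative D) (at w)"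
    by (auto simp: differentiable_def)
  have "(energy_partial c z i has_derivative D) (at w)"
  proof (rule has_derivative_transform_within_open[OF D, of "- {0}"])
    show "2 * L c (z, y) * ?P (z, y) = energy_partial c z i y" if "y \<in> - {0}" for y
      using frechet_derivative_at[OF energy_has_derivative[OF c z, of y]] that
      by (simp add: energy_partial_def fun_eq_iff)
  qed (use w in auto)
  then show ?thesis by (auto simp: differentiable_def)
qed

lemma sum_axis_representation: "(\<Sum>i\<in>UNIV. (d $ i) *\<^sub>R axis i 1) = (d :: real ^ 'n)"
  using basis_expansion[of d] by (simp add: scalar_mult_eq_scaleR)

text \<open>The second derivative of F^2 along a line in a tangent space is 2 g(d, d), which makes
  positive definiteness accessible to one-variable calculus.\<close>

lemma energy_along_line:
  assumes c: "c \<in> A" and z: "z \<in> snd c ` fst c" and nz: "v + t *\<^sub>R d \<noteq> 0"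
  shows "((\<lambda>t. (L c (z, v + t *\<^sub>R d))\<^sup>2) has_real_derivative
      (\<Sum>i\<in>UNIV. d $ i * energy_partial c z i (v + t *\<^sub>R d))) (at t)"
    and "((\<lambda>t. \<Sum>i\<in>UNIV. d $ i * energy_partial c z i (v + t *\<^sub>R d)) has_real_derivative
      2 * (d \<bullet> (fundamental_tensor A F c z (v + t *\<^sub>R d) *v d))) (at t)"
proof -
  let ?w = "v + t *\<^sub>R d"
  have line: "((\<lambda>t. v + t *\<^sub>R d) has_derivative (\<lambda>s. s *\<^sub>R d)) (at t)"
    by (auto intro!: derivative_eq_intros)
  let ?D = "frechet_derivative (\<lambda>y. (L c (z, y))\<^sup>2) (at ?w)"
  have D: "((\<lambda>y. (L c (z, y))\<^sup>2) has_derivative ?D) (at ?w)"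
    using energy_has_derivative[OF c z nz] frechet_derivative_works differentiable_def by blast
  have Dd: "?D d = (\<Sum>i\<in>UNIV. d $ i * energy_partial c z i ?w)"
  proof -
    have "?D d = ?D (\<Sum>i\<in>UNIV. (d $ i) *\<^sub>R axis i 1)" by (simp only: sum_axis_representation)
    also have "\<dots> = (\<Sum>i\<in>UNIV. d $ i * energy_partial c z i ?w)"
      using has_derivative_linear[OF D] by (simp add: linear_sum linear_scale energy_partial_def)
    finally show ?thesis .
  qed
  have "((\<lambda>t. (L c (z, v + t *\<^sub>R d))\<^sup>2) has_derivative (\<lambda>s. ?D (s *\<^sub>R d))) (at t)"
    using diff_chain_at[OF line D] by (simp add: o_def)
  then show "((\<lambda>t. (L c (z, v + t *\<^sub>R d))\<^sup>2) has_real_derivative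
      (\<Sum>i\<in>UNIV. d $ i * energy_partial c z i ?w)) (at t)"
    unfolding has_field_derivative_def
    by (rule has_derivative_eq_rhs)
      (use linear_scale[OF has_derivative_linear[OF D]] Dd in \<open>simp add: fun_eq_iff mult.commute\<close>)
  let ?E = "\<lambda>i. frechet_derivative (energy_partial c z i) (at ?w)"
  have E: "(energy_partial c z i has_derivative ?E i) (at ?w)" for i
    using energy_partial_differentiable[OF c z nz] unfolding frechet_derivative_works .
  have Ed: "?E i d = (\<Sum>j\<in>UNIV. d $ j * (2 * fundamental_tensor A F c z ?w $ i $ j))" for i
  proof -
    have "?E i d = ?E i (\<Sum>j\<in>UNIV. (d $ j) *\<^sub>R axis j 1)" by (simp only: sum_axis_representation)
    also have "\<dots> = (\<Sum>j\<in>UNIV. d $ j * ?E i (axis j 1))"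
      using has_derivative_linear[OF E] by (simp add: linear_sum linear_scale)
    also have "\<dots> = (\<Sum>j\<in>UNIV. d $ j * (2 * fundamental_tensor A F c z ?w $ i $ j))"
      by (simp add: fundamental_tensor_def energy_partial_def[abs_def])
    finally show ?thesis .
  qed
  have "((\<lambda>t. energy_partial c z i (v + t *\<^sub>R d)) has_real_derivative ?E i d) (at t)" for i
  proof -
    have "((\<lambda>t. energy_partial c z i (v + t *\<^sub>R d)) has_derivative (\<lambda>s. ?E i (s *\<^sub>R d))) (at t)"
      using diff_chain_at[OF line E] by (simp add: o_def)
    then show ?thesis
      unfolding has_field_derivative_def
      by (rule has_derivative_eq_rhs)
        (use linear_scale[OF has_derivative_linear[OF E]] in \<open>simp add: fun_eq_iff mult.commute\<close>)
  qed
  then have "((\<lambda>t. \<Sum>i\<in>UNIV. d $ i * energy_partial c z i (v + t *\<^sub>R d)) has_real_derivative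
      (\<Sum>i\<in>UNIV. d $ i * ?E i d)) (at t)"
    by (intro DERIV_sum DERIV_cmult)
  also have "(\<Sum>i\<in>UNIV. d $ i * ?E i d) = 2 * (d \<bullet> (fundamental_tensor A F c z ?w *v d))"
    by (simp add: Ed inner_vec_def matrix_vector_mult_def sum_distrib_left mult_ac)
  finally show "((\<lambda>t. \<Sum>i\<in>UNIV. d $ i * energy_partial c z i (v + t *\<^sub>R d)) has_real_derivative
      2 * (d \<bullet> (fundamental_tensor A F c z ?w *v d))) (at t)" .
qed

lemma fundamental_tensor_pos:
  assumes "c \<in> A" "z \<in> snd c ` fst c" "w \<noteq> 0" "d \<noteq> 0"
  shows "0 < d \<bullet> (fundamental_tensor A F c z w *v d)"
  using metric assms unfolding finsler_metric_def by blast

text \<open>If L vanished at w, homogeneity would make L^2 vanish along the ray through w, and its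
  second derivative 2 g(w, w) would be 0.\<close>

lemma local_metric_pos:
  assumes c: "c \<in> A" and z: "z \<in> snd c ` fst c" and w: "w \<noteq> 0"
  shows "0 < L c (z, w)"
proof (rule ccontr)
  assume "\<not> 0 < L c (z, w)"
  then have L0: "L c (z, w) = 0" using local_metric_nonneg[OF c z, of w] by simp
  let ?f = "\<lambda>t. (L c (z, w + t *\<^sub>R w))\<^sup>2"
  let ?f' = "\<lambda>t. \<Sum>i\<in>UNIV. w $ i * energy_partial c z i (w + t *\<^sub>R w)"
  have wt: "w + t *\<^sub>R w = (1 + t) *\<^sub>R w" for t by (simp add: scaleR_add_left)
  have nz: "w + t *\<^sub>R w \<noteq> 0" if "t \<in> {-1<..<1}" for t using that w unfolding wt by simp
  have f0: "?f t = 0" if "t \<in> {-1<..<1}" for t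
    using that local_metric_hom[OF c z, of "1 + t" w] L0 by (simp add: wt)
  have f'0: "?f' t = 0" if t: "t \<in> {-1<..<1}" for t
  proof -
    have "((\<lambda>_. 0) has_real_derivative 0) (at t)" by simp
    then have "(?f has_real_derivative 0) (at t)"
      by (rule DERIV_cong_ev[THEN iffD1, OF refl _ refl, rotated])
        (use f0 t in \<open>auto intro!: eventually_nhds_in_open[THEN eventually_mono, of "{-1<..<1}"]\<close>)
    then show ?thesis by (rule DERIV_unique[OF energy_along_line(1)[OF c z nz[OF t]]])
  qed
  have "((\<lambda>_. 0) has_real_derivative 0) (at 0)" by simp
  then have "(?f' has_real_derivative 0) (at 0)"
    by (rule DERIV_cong_ev[THEN iffD1, OF refl _ refl, rotated])
      (use f'0 in \<open>auto intro!: eventually_nhds_in_open[THEN eventually_mono, of "{-1<..<1}"]\<close>)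
  then have "2 * (w \<bullet> (fundamental_tensor A F c z (w + 0 *\<^sub>R w) *v w)) = 0"
    by (rule DERIV_unique[OF energy_along_line(2)[OF c z nz], rotated]) simp
  then show False using fundamental_tensor_pos[OF c z w w] by simp
qed

text \<open>L^2 has a positive second derivative along the segment. A midpoint value of at least s^2
  would produce a nonnegative slope in the first half and a nonpositive one in the second.\<close>

lemma local_metric_strict:
  assumes c: "c \<in> A" and z: "z \<in> snd c ` fst c" and vw: "v \<noteq> w" "0 \<notin> closed_segment v w"
    and s: "L c (z, v) = s" "L c (z, w) = s"
  shows "L c (z, (1/2) *\<^sub>R (v + w)) < s"
proof (rule ccontr)
  assume not: "\<not> L c (z, (1/2) *\<^sub>R (v + w)) < s"
  define d where "d = w - v"
  have d: "d \<noteq> 0" using vw by (simp add: d_def)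
  let ?f = "\<lambda>t. (L c (z, v + t *\<^sub>R d))\<^sup>2"
  let ?f' = "\<lambda>t. \<Sum>i\<in>UNIV. d $ i * energy_partial c z i (v + t *\<^sub>R d)"
  let ?f'' = "\<lambda>t. 2 * (d \<bullet> (fundamental_tensor A F c z (v + t *\<^sub>R d) *v d))"
  have nz: "v + t *\<^sub>R d \<noteq> 0" if "0 \<le> t" "t \<le> 1" for t
  proof
    assume "v + t *\<^sub>R d = 0"
    then have "0 = (1 - t) *\<^sub>R v + t *\<^sub>R w" by (simp add: d_def algebra_simps)
    then show False using vw(2) that unfolding closed_segment_def by blast
  qed
  have half: "v + (1/2) *\<^sub>R d = (1/2) *\<^sub>R (v + w)"
  proof -
    have "v = (1/2) *\<^sub>R v + (1/2) *\<^sub>R v" by (simp flip: scaleR_add_left)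
    then show ?thesis unfolding d_def by (simp add: scaleR_diff_right scaleR_add_right)
  qed
  have f: "?f 0 = s\<^sup>2" "?f 1 = s\<^sup>2" "s\<^sup>2 \<le> ?f (1/2)"
  proof -
    have "0 \<le> s" using local_metric_nonneg[OF c z, of v] s by simp
    then show "s\<^sup>2 \<le> ?f (1/2)" using not unfolding half by (intro power_mono) auto
  qed (use s in \<open>auto simp: d_def\<close>)
  obtain t1 where t1: "0 < t1" "t1 < 1/2" "?f (1/2) - ?f 0 = (1/2 - 0) * ?f' t1"
    using MVT2[of 0 "1/2" ?f ?f'] energy_along_line(1)[OF c z nz] by auto
  obtain t2 where t2: "1/2 < t2" "t2 < 1" "?f 1 - ?f (1/2) = (1 - 1/2) * ?f' t2"
    using MVT2[of "1/2" 1 ?f ?f'] energy_along_line(1)[OF c z nz] by auto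
  have "?f' t2 \<le> ?f' t1" using f t1(3) t2(3) by simp
  moreover obtain t3 where t3: "t1 < t3" "t3 < t2" "?f' t2 - ?f' t1 = (t2 - t1) * ?f'' t3"
    using MVT2[of t1 t2 ?f' ?f''] energy_along_line(2)[OF c z nz] t1 t2 by auto
  moreover have "0 < ?f'' t3" using fundamental_tensor_pos[OF c z nz d] t1 t2 t3 by simp
  then have "0 < (t2 - t1) * ?f'' t3" using t1 t2 by (intro mult_pos_pos) auto
  ultimately show False by linarith
qed

lemma minkowski_local:
  assumes c: "c \<in> A" and z: "z \<in> snd c ` fst c"
  shows "minkowski_norm (\<lambda>w. L c (z, w))"
proof (rule minkowski_norm.intro)
  show "continuous_on UNIV (\<lambda>w. L c (z, w))"
    by (rule continuous_on_compose2[OF local_metric_continuous[OF c]]) (use z in \<open>auto intro!: continuous_intros\<close>)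
next
  fix w :: "real ^ 'n" assume "w \<noteq> 0"
  then show "(\<lambda>w. L c (z, w)) differentiable (at w)"
    using local_metric_snd_has_derivative[OF c z] unfolding differentiable_def by blast
qed (use local_metric_hom[OF c z] local_metric_pos[OF c z] local_metric_strict[OF c z] in auto)

section \<open>Dual metric, Legendre transformation and gradient in coordinates\<close>

definition dual_in :: "('a, 'n) chart \<Rightarrow> real ^ 'n \<Rightarrow> real ^ 'n \<Rightarrow> real" where
  "dual_in c z a = minkowski_norm.dual (\<lambda>w. L c (z, w)) a"

text \<open>Nonzero tangent vectors at x correspond to nonzero coordinate vectors, which turns one
  supremum into the other. The hypothesis is restricted to tangent vectors, since a covector has a
  meaning only there.\<close>

lemma dual_metric_eq:
  assumes c: "c \<in> A" "x \<in> fst c" and \<xi>: "\<And>v. v \<in> tangent_space A x \<Longrightarrow> \<xi> v = a \<bullet> v c"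
  shows "dual_metric A F x \<xi> = dual_in c (snd c x) a"
proof -
  interpret minkowski_norm "\<lambda>w. L c (snd c x, w)" using minkowski_local c by blast
  have "(\<lambda>v. \<xi> v / F x v) ` (tangent_space A x - {\<lambda>_. 0}) =
      (\<lambda>w. a \<bullet> w / L c (snd c x, w)) ` (UNIV - {0})" (is "?l = ?r")
  proof
    show "?l \<subseteq> ?r"
    proof (rule image_subsetI)
      fix v assume "v \<in> tangent_space A x - {\<lambda>_. 0}"
      then have v: "v \<in> tangent_space A x" "v \<noteq> (\<lambda>_. 0)" by auto
      then show "\<xi> v / F x v \<in> ?r"
        using \<xi>[OF v(1)] F_eq_local[OF c v(1)] tangent_eq_0_iff[OF c v(1)]
        by (intro image_eqI[of _ _ "v c"]) auto
    qed
    show "?r \<subseteq> ?l"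
    proof (rule image_subsetI)
      fix w :: "real ^ 'n" assume "w \<in> UNIV - {0}"
      then have w: "w \<noteq> 0" by simp
      let ?v = "coord_tvec A c x w"
      have v: "?v \<in> tangent_space A x" by (rule coord_tvec_in_tangent_space[OF c])
      show "a \<bullet> w / L c (snd c x, w) \<in> ?l"
        using \<xi>[OF v] F_eq_local[OF c v] tangent_eq_0_iff[OF c v] v w c
        by (intro image_eqI[of _ _ ?v]) auto
    qed
  qed
  then show ?thesis by (simp add: dual_metric_def dual_in_def dual_def)
qed

text \<open>\<open>legendre_ex1\<close>, carried over to the tangent space, gives the existence and
  uniqueness that the description by THE presupposes.\<close>

lemma legendre_dual_eq:
  assumes c: "c \<in> A" "x \<in> fst c" and \<xi>: "\<And>v. v \<in> tangent_space A x \<Longrightarrow> \<xi> v = a \<bullet> v c"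
  shows "legendre_dual A F x \<xi> \<in> tangent_space A x"
    and "L c (snd c x, legendre_dual A F x \<xi> c) = dual_in c (snd c x) a"
    and "a \<bullet> legendre_dual A F x \<xi> c = (dual_in c (snd c x) a)\<^sup>2"
proof -
  interpret minkowski_norm "\<lambda>w. L c (snd c x, w)" using minkowski_local c by blast
  obtain w where w: "L c (snd c x, w) = dual_in c (snd c x) a" "a \<bullet> w = (dual_in c (snd c x) a)\<^sup>2"
    and uniq: "\<And>w'. L c (snd c x, w') = dual_in c (snd c x) a \<Longrightarrow> a \<bullet> w' = (dual_in c (snd c x) a)\<^sup>2 \<Longrightarrow> w' = w"
    using legendre_ex1[of a] unfolding dual_in_def by blast
  let ?P = "\<lambda>v. v \<in> tangent_space A x \<and> F x v = dual_metric A F x \<xi> \<and> \<xi> v = (dual_metric A F x \<xi>)\<^sup>2"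
  let ?v = "coord_tvec A c x w"
  have tv: "?v \<in> tangent_space A x" by (rule coord_tvec_in_tangent_space[OF c])
  have "legendre_dual A F x \<xi> = ?v"
    unfolding legendre_dual_def
  proof (rule the_equality)
    have dm: "dual_metric A F x \<xi> = dual_in c (snd c x) a" by (rule dual_metric_eq[OF c]) (rule \<xi>)
    show "?P ?v" using tv w c \<xi>[OF tv] F_eq_local[OF c tv] dm by simp
    fix v assume v: "?P v"
    then have "v c = w"
      using uniq[of "v c"] \<xi>[of v] F_eq_local[OF c, of v] dm by simp
    then show "v = ?v" using coord_tvec_tangent[OF c, of v] v by simp
  qed
  then show "legendre_dual A F x \<xi> \<in> tangent_space A x"
    and "L c (snd c x, legendre_dual A F x \<xi> c) = dual_in c (snd c x) a"
    and "a \<bullet> legendre_dual A F x \<xi> c = (dual_in c (snd c x) a)\<^sup>2"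
    using tv w c by auto
qed

lemma dual_metric_differential:
  assumes c: "c \<in> A" "x \<in> fst c" and f: "diff_at f x"
  shows "dual_metric A F x (differential A f x) = dual_in c (snd c x) (grad_in c f (snd c x))"
    and "dual_metric A F x (\<lambda>v. - differential A f x v) = dual_in c (snd c x) (- grad_in c f (snd c x))"
  using differential_eq[OF c _ f] by (auto intro!: dual_metric_eq[OF c])

lemma gradient_unit:
  assumes c: "c \<in> A" "x \<in> fst c" and f: "diff_at f x"
    and unit: "dual_metric A F x (differential A f x) = 1"
  shows "finsler_gradient A F f x \<in> tangent_space A x"
    and "L c (snd c x, finsler_gradient A F f x c) = 1"
    and "grad_in c f (snd c x) \<bullet> finsler_gradient A F f x c = 1"
proof -
  have d: "dual_in c (snd c x) (grad_in c f (snd c x)) = 1"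
    using unit dual_metric_differential[OF c f] by simp
  have \<xi>: "differential A f x v = grad_in c f (snd c x) \<bullet> v c" if "v \<in> tangent_space A x" for v
    by (rule differential_eq[OF c that f])
  note leg = legendre_dual_eq[of c x "differential A f x" "grad_in c f (snd c x)", OF c, folded finsler_gradient_def, unfolded d]
  show "finsler_gradient A F f x \<in> tangent_space A x" by (rule leg(1)) (rule \<xi>)
  show "L c (snd c x, finsler_gradient A F f x c) = 1" by (rule leg(2)) (rule \<xi>)
  have "grad_in c f (snd c x) \<bullet> finsler_gradient A F f x c = 1\<^sup>2" by (rule leg(3)) (rule \<xi>)
  then show "grad_in c f (snd c x) \<bullet> finsler_gradient A F f x c = 1" by simp
qed

text \<open>The differential is 0 by convention, and F vanishes only at 0. This determines the
  integrand of the weak Laplacian on the exceptional set, where its measurability has to be checked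
  as well.\<close>

lemma gradient_not_diff:
  assumes "\<not> diff_at f x"
  shows "finsler_gradient A F f x = (\<lambda>_. 0)"
proof -
  obtain c where c: "c \<in> A" "x \<in> fst c" using ex_chart by blast
  interpret minkowski_norm "\<lambda>w. L c (snd c x, w)" using minkowski_local c by blast
  let ?v = "finsler_gradient A F f x"
  have v: "?v \<in> tangent_space A x" "L c (snd c x, ?v c) = dual_in c (snd c x) 0"
    using legendre_dual_eq[OF c, of "differential A f x" 0] differential_not_diff[OF assms]
    by (auto simp: finsler_gradient_def)
  then have "?v c = 0" using pos[of "?v c"] dual_zero by (force simp: dual_in_def)
  then show ?thesis using tangent_eq_0_iff[OF c v(1)] by simp
qed

lemma differential_zero_vector: "differential A f x (\<lambda>_. 0) = 0"
proof (cases "diff_at f x")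
  case True
  then show ?thesis
    using differential_eq[OF _ _ zero_in_tangent_space True] ex_chart[of x] by auto
qed (rule differential_not_diff)

end

section \<open>Curves and the Finsler distance\<close>

context finsler_space
begin

section \<open>Lengths, reparametrization and concatenation of C1 curves\<close>

abbreviation "unit_curve \<equiv> C1_curve A {0..1}"
abbreviation "vel \<equiv> velocity A {0..1}"
abbreviation "speed \<gamma> t \<equiv> F (\<gamma> t) (velocity A {0..1} \<gamma> t)"

lemma unit_curve_continuous: "unit_curve \<gamma> \<Longrightarrow> continuous_on {0..1} \<gamma>"
  by (simp add: C1_curve_def)

lemma unit_curve_has_vector_derivative:
  assumes "unit_curve \<gamma>" "c \<in> A" "t \<in> {0..1}" "\<gamma> t \<in> fst c"
  shows "((snd c \<circ> \<gamma>) has_vector_derivative vel \<gamma> t c) (at t within {0..1})"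
  using assms by (simp add: C1_curve_def velocity_def vector_derivative_works)

lemma unit_curve_continuous_velocity:
  assumes "unit_curve \<gamma>" "c \<in> A"
  shows "continuous_on {t\<in>{0..1}. \<gamma> t \<in> fst c} (\<lambda>t. vel \<gamma> t c)"
  using assms by (simp add: C1_curve_def)

text \<open>Derivatives within a nondegenerate interval are unique, so a continuous candidate W with
  the right derivative property is the velocity.\<close>

lemma unit_curveI:
  assumes cont: "continuous_on {0..1} \<gamma>"
    and der: "\<And>c t. c \<in> A \<Longrightarrow> t \<in> {0..1} \<Longrightarrow> \<gamma> t \<in> fst c \<Longrightarrow>
      ((snd c \<circ> \<gamma>) has_vector_derivative W t c) (at t within {0..1})"
    and contW: "\<And>c. c \<in> A \<Longrightarrow> continuous_on {t\<in>{0..1}. \<gamma> t \<in> fst c} (\<lambda>t. W t c)"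
  shows "unit_curve \<gamma>"
    and "\<And>c t. c \<in> A \<Longrightarrow> t \<in> {0..1} \<Longrightarrow> \<gamma> t \<in> fst c \<Longrightarrow> vel \<gamma> t c = W t c"
proof -
  show vW: "vel \<gamma> t c = W t c" if "c \<in> A" "t \<in> {0..1}" "\<gamma> t \<in> fst c" for c t
    using vector_derivative_within_closed_interval[OF _ that(2) der[OF that]] that
    by (simp add: velocity_def)
  have "continuous_on {t\<in>{0..1}. \<gamma> t \<in> fst c} (\<lambda>t. vel \<gamma> t c)" if "c \<in> A" for c
    by (rule continuous_on_eq[OF contW[OF that]]) (use vW that in auto)
  then show "unit_curve \<gamma>"
    using cont der unfolding C1_curve_def differentiable_def has_vector_derivative_def by blast
qed

lemma unit_curve_openin:
  assumes "unit_curve \<gamma>" "c \<in> A"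
  shows "\<exists>T. open T \<and> T \<inter> {0..1} = {t\<in>{0..1}. \<gamma> t \<in> fst c}"
proof -
  have "\<exists>T. open T \<and> T \<inter> {0..1} = \<gamma> -` fst c \<inter> {0..1}"
    using unit_curve_continuous[OF assms(1)] open_chart[OF assms(2)]
    unfolding continuous_on_open_invariant by blast
  then show ?thesis by (simp add: vimage_def Int_def conj_commute)
qed

text \<open>The velocity is defined chart by chart. The chain rule for the coordinate change, valid
  as long as the curve stays in the first chart, makes these coordinate vectors compatible.\<close>

lemma velocity_in_tangent_space:
  assumes \<gamma>: "unit_curve \<gamma>" and t: "t \<in> {0..1}"
  shows "vel \<gamma> t \<in> tangent_space A (\<gamma> t)"
  unfolding tangent_space_def trans_deriv_def[symmetric]
proof (intro CollectI conjI allI ballI impI)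
  fix c c' assume c: "c \<in> A" "c' \<in> A" and x: "\<gamma> t \<in> fst c \<and> \<gamma> t \<in> fst c'"
  have "((snd c' \<circ> chart_inv c) has_derivative trans_deriv c c' (\<gamma> t)) (at ((snd c \<circ> \<gamma>) t))"
    unfolding comp_apply[of "snd c" \<gamma>]
    by (rule transition_has_derivative[OF c conjunct1[OF x] conjunct2[OF x]])
  note der = vector_derivative_diff_chain_within[OF
      unit_curve_has_vector_derivative[OF \<gamma> c(1) t conjunct1[OF x]] has_derivative_at_withinI[OF this]]
  obtain T where T: "open T" "T \<inter> {0..1} = {t\<in>{0..1}. \<gamma> t \<in> fst c}"
    using unit_curve_openin[OF \<gamma> c(1)] by blast
  then have "t \<in> T" using t x by blast
  then obtain e where e: "0 < e" "ball t e \<subseteq> T" using T(1) openE by blast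
  have "((snd c' \<circ> \<gamma>) has_vector_derivative trans_deriv c c' (\<gamma> t) (vel \<gamma> t c)) (at t within {0..1})"
  proof (rule has_vector_derivative_transform_within[OF der e(1) t])
    fix s :: real assume s: "s \<in> {0..1}" "dist s t < e"
    then have "s \<in> T \<inter> {0..1}" using e(2) by (auto simp: dist_commute subset_iff)
    then have "\<gamma> s \<in> fst c" unfolding T(2) by simp
    then show "((snd c' \<circ> chart_inv c) \<circ> (snd c \<circ> \<gamma>)) s = (snd c' \<circ> \<gamma>) s" using c by simp
  qed
  then have "vector_derivative (snd c' \<circ> \<gamma>) (at t within {0..1}) = trans_deriv c c' (\<gamma> t) (vel \<gamma> t c)"
    using t by (intro vector_derivative_within_closed_interval) auto
  then show "vel \<gamma> t c' = trans_deriv c c' (\<gamma> t) (vel \<gamma> t c)"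
    using c x by (simp add: velocity_def)
qed (auto simp: velocity_def)

lemma speed_in_chart:
  assumes "unit_curve \<gamma>" "c \<in> A" "t \<in> {0..1}" "\<gamma> t \<in> fst c"
  shows "speed \<gamma> t = L c (snd c (\<gamma> t), vel \<gamma> t c)"
  using F_eq_local[OF assms(2,4) velocity_in_tangent_space[OF assms(1,3)]] .

lemma speed_nonneg: "unit_curve \<gamma> \<Longrightarrow> t \<in> {0..1} \<Longrightarrow> 0 \<le> speed \<gamma> t"
  using metric velocity_in_tangent_space unfolding finsler_metric_def by blast

lemma continuous_on_speed:
  assumes \<gamma>: "unit_curve \<gamma>"
  shows "continuous_on {0..1} (\<lambda>t. speed \<gamma> t)"
  unfolding continuous_on_eq_continuous_within
proof
  fix t :: real assume t: "t \<in> {0..1}"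
  obtain c where c: "c \<in> A" "\<gamma> t \<in> fst c" using ex_chart by blast
  let ?T = "{t\<in>{0..1}. \<gamma> t \<in> fst c}"
  obtain T where T: "open T" "T \<inter> {0..1} = ?T" using unit_curve_openin[OF \<gamma> c(1)] by blast
  have "continuous_on ?T (\<lambda>t. L c (snd c (\<gamma> t), vel \<gamma> t c))"
  proof (rule continuous_on_compose2[OF local_metric_continuous[OF c(1)]])
    have "continuous_on ?T \<gamma>" by (rule continuous_on_subset[OF unit_curve_continuous[OF \<gamma>]]) auto
    then have "continuous_on ?T (\<lambda>t. snd c (\<gamma> t))"
      by (rule continuous_on_compose2[OF continuous_on_chart[OF c(1)]]) auto
    then show "continuous_on ?T (\<lambda>t. (snd c (\<gamma> t), vel \<gamma> t c))"
      by (rule continuous_on_Pair[OF _ unit_curve_continuous_velocity[OF \<gamma> c(1)]])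
  qed auto
  then have "continuous_on ?T (\<lambda>t. speed \<gamma> t)"
    by (rule continuous_on_eq) (use speed_in_chart[OF \<gamma> c(1)] in auto)
  then have "continuous (at t within ?T) (\<lambda>t. speed \<gamma> t)"
    using t c unfolding continuous_on_eq_continuous_within by blast
  moreover have "at t within ?T = at t within {0..1}"
    using T t c by (intro at_within_nhd[of _ T]) auto
  ultimately show "continuous (at t within {0..1}) (\<lambda>t. speed \<gamma> t)" by simp
qed

definition len :: "(real \<Rightarrow> 'a) \<Rightarrow> real" where
  "len \<gamma> = integral {0..1} (\<lambda>t. speed \<gamma> t)"

lemma len_nonneg: "unit_curve \<gamma> \<Longrightarrow> 0 \<le> len \<gamma>"
  unfolding len_def using speed_nonneg by (intro integral_nonneg integrable_continuous_real continuous_on_speed) auto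

text \<open>The parameter interval is [a, b] and not [0, 1], because the concatenation runs through
  each curve in one half of the unit interval.\<close>

lemma reparam_has_vector_derivative:
  assumes \<gamma>: "unit_curve \<gamma>" and \<theta>: "\<theta> ` {a..b} \<subseteq> {0..1}"
    and d: "(\<theta> has_real_derivative \<theta>' t) (at t within {a..b})"
    and c: "c \<in> A" and t: "t \<in> {a..b}" and x: "\<gamma> (\<theta> t) \<in> fst c"
  shows "((\<lambda>t. snd c (\<gamma> (\<theta> t))) has_vector_derivative \<theta>' t *\<^sub>R vel \<gamma> (\<theta> t) c) (at t within {a..b})"
proof -
  have "\<theta> t \<in> {0..1}" using \<theta> t by blast
  then have "((snd c \<circ> \<gamma>) has_vector_derivative vel \<gamma> (\<theta> t) c) (at (\<theta> t) within {0..1})"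
    using unit_curve_has_vector_derivative[OF \<gamma> c _ x] by blast
  then have "((snd c \<circ> \<gamma>) has_vector_derivative vel \<gamma> (\<theta> t) c) (at (\<theta> t) within \<theta> ` {a..b})"
    by (rule has_vector_derivative_within_subset[OF _ \<theta>])
  moreover have "(\<theta> has_vector_derivative \<theta>' t) (at t within {a..b})"
    using d by (simp add: has_real_derivative_iff_has_vector_derivative)
  ultimately show ?thesis using vector_diff_chain_within[of \<theta> "\<theta>' t" t "{a..b}" "snd c \<circ> \<gamma>"]
    by (simp add: o_def)
qed

lemma reparam_continuous_velocity:
  assumes \<gamma>: "unit_curve \<gamma>" and \<theta>: "\<theta> ` {a..b} \<subseteq> {0..1}"
    and cont: "continuous_on {a..b} \<theta>" "continuous_on {a..b} \<theta>'" and c: "c \<in> A"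
    and T: "T \<subseteq> {t\<in>{a..b}. \<gamma> (\<theta> t) \<in> fst c}"
  shows "continuous_on T (\<lambda>t. \<theta>' t *\<^sub>R vel \<gamma> (\<theta> t) c)"
proof -
  have sub: "T \<subseteq> {a..b}" using T by blast
  have "continuous_on T (\<lambda>t. vel \<gamma> (\<theta> t) c)"
    by (rule continuous_on_compose2[OF unit_curve_continuous_velocity[OF \<gamma> c] continuous_on_subset[OF cont(1) sub]])
      (use T \<theta> in blast)
  then show ?thesis by (intro continuous_intros continuous_on_subset[OF cont(2) sub])
qed

lemma reparam_length:
  assumes \<gamma>: "unit_curve \<gamma>" and \<theta>: "\<theta> ` {a..b} \<subseteq> {0..1}" "a \<le> b" "\<theta> a \<le> \<theta> b"
    and d: "\<And>t. t \<in> {a..b} \<Longrightarrow> (\<theta> has_real_derivative \<theta>' t) (at t within {a..b})"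
  shows "((\<lambda>t. \<theta>' t * speed \<gamma> (\<theta> t)) has_integral integral {\<theta> a..\<theta> b} (\<lambda>t. speed \<gamma> t)) {a..b}"
  using has_integral_substitution[OF \<theta>(2,3,1) continuous_on_speed[OF \<gamma>] d] by simp

text \<open>The factor is nonnegative because F is only positively homogeneous; the factor 0 occurs
  at the junction of concatenated curves.\<close>

lemma speed_scaled:
  assumes \<gamma>: "unit_curve \<gamma>" and \<delta>: "unit_curve \<delta>" and t: "t \<in> {0..1}" "s \<in> {0..1}" "\<delta> t = \<gamma> s"
    and k: "0 \<le> k" and v: "\<And>c. c \<in> A \<Longrightarrow> \<gamma> s \<in> fst c \<Longrightarrow> vel \<delta> t c = k *\<^sub>R vel \<gamma> s c"
  shows "speed \<delta> t = k * speed \<gamma> s"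
proof -
  obtain c where c: "c \<in> A" "\<gamma> s \<in> fst c" using ex_chart by blast
  interpret minkowski_norm "\<lambda>w. L c (snd c (\<gamma> s), w)" using minkowski_local c by blast
  have "L c (snd c (\<gamma> s), k *\<^sub>R w) = k * L c (snd c (\<gamma> s), w)" for w
    using hom[of k w] zero k by (cases "k = 0") auto
  then show ?thesis
    using speed_in_chart[OF \<gamma> c(1) t(2) c(2)] speed_in_chart[OF \<delta> c(1) t(1)] v c t(3) by simp
qed

text \<open>With a linear \<theta> this restricts a curve to an initial time interval.\<close>

lemma reparam_unit_curve:
  assumes \<gamma>: "unit_curve \<gamma>" and \<theta>: "\<theta> ` {0..1} \<subseteq> {0..1}" "\<theta> 0 \<le> \<theta> 1"
    and d: "\<And>t. t \<in> {0..1} \<Longrightarrow> (\<theta> has_real_derivative \<theta>' t) (at t within {0..1})"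
    and cont: "continuous_on {0..1} \<theta>'" and nn: "\<And>t. t \<in> {0..1} \<Longrightarrow> 0 \<le> \<theta>' t"
  shows "unit_curve (\<lambda>t. \<gamma> (\<theta> t))" and "len (\<lambda>t. \<gamma> (\<theta> t)) = integral {\<theta> 0..\<theta> 1} (\<lambda>t. speed \<gamma> t)"
proof -
  let ?\<delta> = "\<lambda>t. \<gamma> (\<theta> t)"
  have c\<theta>: "continuous_on {0..1} \<theta>" using DERIV_continuous_on[OF d] .
  have c1: "continuous_on {0..1} ?\<delta>"
    by (rule continuous_on_compose2[OF unit_curve_continuous[OF \<gamma>] c\<theta> \<theta>(1)])
  have c2: "((snd c \<circ> ?\<delta>) has_vector_derivative \<theta>' t *\<^sub>R vel \<gamma> (\<theta> t) c) (at t within {0..1})"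
    if "c \<in> A" "t \<in> {0..1}" "?\<delta> t \<in> fst c" for c t
    using reparam_has_vector_derivative[of \<gamma> \<theta> 0 1 \<theta>' t c, OF \<gamma> \<theta>(1) d[OF that(2)] that] by (simp add: o_def)
  have c3: "continuous_on {t\<in>{0..1}. ?\<delta> t \<in> fst c} (\<lambda>t. \<theta>' t *\<^sub>R vel \<gamma> (\<theta> t) c)" if "c \<in> A" for c
    by (rule reparam_continuous_velocity[OF \<gamma> \<theta>(1) c\<theta> cont that]) auto
  show \<delta>: "unit_curve ?\<delta>" by (rule unit_curveI(1)[OF c1 c2 c3])
  have v: "vel ?\<delta> t c = \<theta>' t *\<^sub>R vel \<gamma> (\<theta> t) c" if "c \<in> A" "t \<in> {0..1}" "?\<delta> t \<in> fst c" for c t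
    by (rule unit_curveI(2)[OF c1 c2 c3 that])
  have "speed ?\<delta> t = \<theta>' t * speed \<gamma> (\<theta> t)" if t: "t \<in> {0..1}" for t
  proof (rule speed_scaled[OF \<gamma> \<delta> t _ refl nn[OF t]])
    show "\<theta> t \<in> {0..1}" using \<theta>(1) t by blast
    show "vel ?\<delta> t c = \<theta>' t *\<^sub>R vel \<gamma> (\<theta> t) c" if "c \<in> A" "\<gamma> (\<theta> t) \<in> fst c" for c
      by (rule v[OF that(1) t that(2)])
  qed
  then have "len ?\<delta> = integral {0..1} (\<lambda>t. \<theta>' t * speed \<gamma> (\<theta> t))"
    unfolding len_def by (intro integral_cong) auto
  also have "\<dots> = integral {\<theta> 0..\<theta> 1} (\<lambda>t. speed \<gamma> t)"
    using reparam_length[OF \<gamma> \<theta>(1) _ \<theta>(2) d] by (intro integral_unique) auto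
  finally show "len ?\<delta> = integral {\<theta> 0..\<theta> 1} (\<lambda>t. speed \<gamma> t)" .
qed

text \<open>The concatenation is made \<open>C\<^sup>1\<close> by slowing both curves down to speed zero at the junction.\<close>

lemma smoothstep:
  fixes t :: real
  assumes "t \<in> {0..1}"
  shows "3 * t\<^sup>2 - 2 * t ^ 3 \<in> {0..1}" "0 \<le> 6 * t - 6 * t\<^sup>2"
proof -
  have "3 * t\<^sup>2 - 2 * t ^ 3 = t\<^sup>2 * (3 - 2 * t)" "1 - (3 * t\<^sup>2 - 2 * t ^ 3) = (1 - t)\<^sup>2 * (1 + 2 * t)"
    "6 * t - 6 * t\<^sup>2 = 6 * t * (1 - t)"
    by (simp_all add: power2_eq_square power3_eq_cube algebra_simps)
  moreover have "0 \<le> t\<^sup>2 * (3 - 2 * t)" "0 \<le> (1 - t)\<^sup>2 * (1 + 2 * t)" "0 \<le> 6 * t * (1 - t)"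
    using assms by auto
  ultimately show "3 * t\<^sup>2 - 2 * t ^ 3 \<in> {0..1}" "0 \<le> 6 * t - 6 * t\<^sup>2" by auto
qed

lemma join_unit_curves:
  assumes \<gamma>1: "unit_curve \<gamma>1" and \<gamma>2: "unit_curve \<gamma>2" and eq: "\<gamma>1 1 = \<gamma>2 0"
  shows "\<exists>\<gamma>. unit_curve \<gamma> \<and> \<gamma> 0 = \<gamma>1 0 \<and> \<gamma> 1 = \<gamma>2 1 \<and> len \<gamma> = len \<gamma>1 + len \<gamma>2"
proof -
  define h h' where "h = (\<lambda>t::real. 3 * t\<^sup>2 - 2 * t ^ 3)" and "h' = (\<lambda>t::real. 6 * t - 6 * t\<^sup>2)"
  define \<theta>1 \<theta>2 where "\<theta>1 = (\<lambda>t::real. h (2 * t))" and "\<theta>2 = (\<lambda>t::real. h (2 * t - 1))"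
  define \<theta>1' \<theta>2' where "\<theta>1' = (\<lambda>t::real. 2 * h' (2 * t))" and "\<theta>2' = (\<lambda>t::real. 2 * h' (2 * t - 1))"
  have im: "\<theta>1 ` {0..1/2} \<subseteq> {0..1}" "\<theta>2 ` {1/2..1} \<subseteq> {0..1}"
    unfolding \<theta>1_def \<theta>2_def h_def by (intro image_subsetI smoothstep; simp)+
  have nn: "t \<in> {0..1/2} \<Longrightarrow> 0 \<le> \<theta>1' t" "t \<in> {1/2..1} \<Longrightarrow> 0 \<le> \<theta>2' t" for t
    using smoothstep(2)[of "2 * t"] smoothstep(2)[of "2 * t - 1"] by (auto simp: \<theta>1'_def \<theta>2'_def h'_def)
  have d: "(\<theta>1 has_real_derivative \<theta>1' t) (at t within S)" "(\<theta>2 has_real_derivative \<theta>2' t) (at t within S)" for t S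
    unfolding \<theta>1_def \<theta>2_def h_def \<theta>1'_def \<theta>2'_def h'_def
    by (auto intro!: derivative_eq_intros simp: algebra_simps power2_eq_square)
  have c\<theta>: "continuous_on S \<theta>1" "continuous_on S \<theta>2" "continuous_on S \<theta>1'" "continuous_on S \<theta>2'" for S
    unfolding \<theta>1_def \<theta>2_def h_def \<theta>1'_def \<theta>2'_def h'_def by (auto intro!: continuous_intros)
  \<comment> \<open>Both derivatives vanish at 1/2, so the two velocities agree there although
    \<open>vel\<close> of \<gamma>1 at 1 and of \<gamma>2 at 0 are unrelated.\<close>
  have ends: "\<theta>1 0 = 0" "\<theta>1 (1/2) = 1" "\<theta>2 (1/2) = 0" "\<theta>2 1 = 1" "\<theta>1' (1/2) = 0" "\<theta>2' (1/2) = 0"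
    by (simp_all add: \<theta>1_def \<theta>2_def h_def \<theta>1'_def \<theta>2'_def h'_def power_divide)
  define \<gamma> where "\<gamma> = (\<lambda>t. if t \<le> 1/2 then \<gamma>1 (\<theta>1 t) else \<gamma>2 (\<theta>2 t))"
  define W where "W = (\<lambda>t c. if t \<le> 1/2 then \<theta>1' t *\<^sub>R vel \<gamma>1 (\<theta>1 t) c else \<theta>2' t *\<^sub>R vel \<gamma>2 (\<theta>2 t) c)"
  have un: "{0..1} = {0..1/2} \<union> {1/2..1::real}" by auto
  have c1: "continuous_on {0..1} \<gamma>"
    unfolding \<gamma>_def
  proof (rule continuous_on_cases_le)
    show "continuous_on {t \<in> {0..1}. t \<le> 1/2} (\<lambda>t. \<gamma>1 (\<theta>1 t))"
      by (rule continuous_on_compose2[OF unit_curve_continuous[OF \<gamma>1] c\<theta>(1)]) (use im in force)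
    show "continuous_on {t \<in> {0..1}. 1/2 \<le> t} (\<lambda>t. \<gamma>2 (\<theta>2 t))"
      by (rule continuous_on_compose2[OF unit_curve_continuous[OF \<gamma>2] c\<theta>(2)]) (use im in force)
    show "\<gamma>1 (\<theta>1 t) = \<gamma>2 (\<theta>2 t)" if "t = 1/2" for t
      unfolding that ends by (rule eq)
  qed (auto intro: continuous_on_id)
  have half: "\<gamma> (1/2) = \<gamma>1 1" "\<gamma>2 (\<theta>2 (1/2)) = \<gamma>1 1" using ends eq by (simp_all add: \<gamma>_def)
  have right: "\<gamma> t = \<gamma>2 (\<theta>2 t)" if "1/2 \<le> t" for t
  proof (cases "t = 1/2")
    case True
    show ?thesis unfolding True half ..
  next
    case False
    then have "\<not> t \<le> 1/2" using that by linarith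
    then show ?thesis by (simp add: \<gamma>_def)
  qed
  have rightW: "W t c = \<theta>2' t *\<^sub>R vel \<gamma>2 (\<theta>2 t) c" if "1/2 \<le> t" for t c
  proof (cases "t = 1/2")
    case True
    show ?thesis unfolding True W_def ends by simp
  next
    case False
    then have "\<not> t \<le> 1/2" using that by linarith
    then show ?thesis by (simp add: W_def)
  qed
  have c2: "((snd c \<circ> \<gamma>) has_vector_derivative W t c) (at t within {0..1})"
    if c: "c \<in> A" and t: "t \<in> {0..1}" and x: "\<gamma> t \<in> fst c" for c t
  proof -
    have "((\<lambda>t. if t \<in> {0..1/2} then snd c (\<gamma>1 (\<theta>1 t)) else snd c (\<gamma>2 (\<theta>2 t))) has_vector_derivative
        (if t \<in> {0..1/2} then \<theta>1' t *\<^sub>R vel \<gamma>1 (\<theta>1 t) c else \<theta>2' t *\<^sub>R vel \<gamma>2 (\<theta>2 t) c)) (at t within {0..1})"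
    proof (rule has_vector_derivative_If_within_closures[of _ "{0..1/2}" "{1/2..1}"])
      have cl: "{0..1/2} \<union> (closure {0..1/2} \<inter> closure {1/2..1}) = {0..1/2::real}"
        "{1/2..1} \<union> (closure {0..1/2} \<inter> closure {1/2..1}) = {1/2..1::real}" by auto
      show "((\<lambda>t. snd c (\<gamma>1 (\<theta>1 t))) has_vector_derivative \<theta>1' t *\<^sub>R vel \<gamma>1 (\<theta>1 t) c)
          (at t within {0..1/2} \<union> (closure {0..1/2} \<inter> closure {1/2..1}))"
        if "t \<in> {0..1/2} \<union> (closure {0..1/2} \<inter> closure {1/2..1})"
        using that x unfolding cl
        by (intro reparam_has_vector_derivative[OF \<gamma>1 im(1) d(1) c]) (auto simp: \<gamma>_def)
      show "((\<lambda>t. snd c (\<gamma>2 (\<theta>2 t))) has_vector_derivative \<theta>2' t *\<^sub>R vel \<gamma>2 (\<theta>2 t) c)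
          (at t within {1/2..1} \<union> (closure {0..1/2} \<inter> closure {1/2..1}))"
        if t': "t \<in> {1/2..1} \<union> (closure {0..1/2} \<inter> closure {1/2..1})"
      proof -
        have "\<gamma> t = \<gamma>2 (\<theta>2 t)" using t' unfolding cl by (intro right) simp
        then show ?thesis
          using t' x unfolding cl by (intro reparam_has_vector_derivative[OF \<gamma>2 im(2) d(2) c]) auto
      qed
      show "snd c (\<gamma>1 (\<theta>1 t)) = snd c (\<gamma>2 (\<theta>2 t))" if "t \<in> closure {0..1/2}" "t \<in> closure {1/2..1}"
      proof -
        have t: "t = 1/2" using that by simp
        show ?thesis unfolding t ends eq ..
      qed
      show "\<theta>1' t *\<^sub>R vel \<gamma>1 (\<theta>1 t) c = \<theta>2' t *\<^sub>R vel \<gamma>2 (\<theta>2 t) c" if "t \<in> closure {0..1/2}" "t \<in> closure {1/2..1}"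
      proof -
        have t: "t = 1/2" using that by simp
        show ?thesis unfolding t ends by simp
      qed
    qed (use t in auto)
    then have "((snd c \<circ> \<gamma>) has_vector_derivative
        (if t \<in> {0..1/2} then \<theta>1' t *\<^sub>R vel \<gamma>1 (\<theta>1 t) c else \<theta>2' t *\<^sub>R vel \<gamma>2 (\<theta>2 t) c)) (at t within {0..1})"
      by (rule has_vector_derivative_transform_within[OF _ zero_less_one t]) (auto simp: \<gamma>_def)
    then show ?thesis using t by (simp add: W_def)
  qed
  have c3: "continuous_on {t\<in>{0..1}. \<gamma> t \<in> fst c} (\<lambda>t. W t c)" if c: "c \<in> A" for c
    unfolding W_def
  proof (rule continuous_on_cases_le)
    show "continuous_on {t \<in> {t \<in> {0..1}. \<gamma> t \<in> fst c}. t \<le> 1/2} (\<lambda>t. \<theta>1' t *\<^sub>R vel \<gamma>1 (\<theta>1 t) c)"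
      by (rule reparam_continuous_velocity[OF \<gamma>1 im(1) c\<theta>(1,3) c]) (auto simp: \<gamma>_def)
    show "continuous_on {t \<in> {t \<in> {0..1}. \<gamma> t \<in> fst c}. 1/2 \<le> t} (\<lambda>t. \<theta>2' t *\<^sub>R vel \<gamma>2 (\<theta>2 t) c)"
    proof (rule reparam_continuous_velocity[OF \<gamma>2 im(2) c\<theta>(2,4) c])
      show "{t \<in> {t \<in> {0..1}. \<gamma> t \<in> fst c}. 1/2 \<le> t} \<subseteq> {t \<in> {1/2..1}. \<gamma>2 (\<theta>2 t) \<in> fst c}"
      proof clarify
        fix t assume t: "t \<in> {0..1}" "\<gamma> t \<in> fst c" "1/2 \<le> t"
        then have "\<gamma> t = \<gamma>2 (\<theta>2 t)" by (intro right)
        then show "t \<in> {1/2..1} \<and> \<gamma>2 (\<theta>2 t) \<in> fst c" using t by auto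
      qed
    qed
    show "\<theta>1' t *\<^sub>R vel \<gamma>1 (\<theta>1 t) c = \<theta>2' t *\<^sub>R vel \<gamma>2 (\<theta>2 t) c" if "t = 1/2" for t
      unfolding that ends by simp
  qed (auto intro: continuous_on_id)
  have \<gamma>: "unit_curve \<gamma>" by (rule unit_curveI(1)[OF c1 c2 c3])
  have v: "vel \<gamma> t c = W t c" if "c \<in> A" "t \<in> {0..1}" "\<gamma> t \<in> fst c" for c t
    by (rule unit_curveI(2)[OF c1 c2 c3 that])
  have s1: "\<theta>1' t * speed \<gamma>1 (\<theta>1 t) = speed \<gamma> t" if t: "t \<in> {0..1/2}" for t
  proof (rule speed_scaled[OF \<gamma>1 \<gamma> _ _ _ nn(1)[OF t], symmetric])
    show t01: "t \<in> {0..1}" using t by simp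
    show "\<theta>1 t \<in> {0..1}" using im(1) t by blast
    show \<gamma>t: "\<gamma> t = \<gamma>1 (\<theta>1 t)" using t by (simp add: \<gamma>_def)
    show "vel \<gamma> t c = \<theta>1' t *\<^sub>R vel \<gamma>1 (\<theta>1 t) c" if "c \<in> A" "\<gamma>1 (\<theta>1 t) \<in> fst c" for c
      using v[OF that(1) t01] that(2) t \<gamma>t by (simp add: W_def)
  qed
  have s2: "\<theta>2' t * speed \<gamma>2 (\<theta>2 t) = speed \<gamma> t" if t: "t \<in> {1/2..1}" for t
  proof -
    have t01: "t \<in> {0..1}" and \<gamma>t: "\<gamma> t = \<gamma>2 (\<theta>2 t)" using t right by auto
    show ?thesis
    proof (rule speed_scaled[OF \<gamma>2 \<gamma> t01 _ \<gamma>t nn(2)[OF t], symmetric])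
      show "\<theta>2 t \<in> {0..1}" using im(2) t by blast
      show "vel \<gamma> t c = \<theta>2' t *\<^sub>R vel \<gamma>2 (\<theta>2 t) c" if "c \<in> A" "\<gamma>2 (\<theta>2 t) \<in> fst c" for c
        using v[OF that(1) t01] that(2) t \<gamma>t rightW by simp
    qed
  qed
  have "((\<lambda>t. speed \<gamma> t) has_integral len \<gamma>1) {0..1/2}"
    using reparam_length[OF \<gamma>1 im(1) _ _ d(1)] ends by (intro has_integral_eq[OF s1]) (auto simp: len_def)
  moreover have "((\<lambda>t. speed \<gamma> t) has_integral len \<gamma>2) {1/2..1}"
    using reparam_length[OF \<gamma>2 im(2) _ _ d(2)] ends by (intro has_integral_eq[OF s2]) (auto simp: len_def)
  ultimately have "((\<lambda>t. speed \<gamma> t) has_integral len \<gamma>1 + len \<gamma>2) {0..1}"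
    by (rule has_integral_combine[rotated 2]) auto
  then have "len \<gamma> = len \<gamma>1 + len \<gamma>2" unfolding len_def[of \<gamma>] by (rule integral_unique)
  moreover have "\<gamma> 0 = \<gamma>1 0" "\<gamma> 1 = \<gamma>2 1" using ends by (simp_all add: \<gamma>_def)
  ultimately show ?thesis using \<gamma> by blast
qed

text \<open>Smoothness provides continuity of the derivative in basis directions; linearity extends
  it to an arbitrary fixed w.\<close>

lemma continuous_on_trans_deriv:
  assumes c: "c \<in> A" "c' \<in> A"
  shows "continuous_on (snd c ` (fst c \<inter> fst c')) (\<lambda>z. trans_deriv c c' (chart_inv c z) w)"
proof -
  let ?S = "snd c ` (fst c \<inter> fst c')"
  have "smooth_on ?S (snd c' \<circ> chart_inv c)"
    using atlas assms by (auto simp: smooth_atlas_def)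
  then have "Ck_on (Suc 0) (snd c' \<circ> chart_inv c) ?S" unfolding smooth_on_def by blast
  then have b: "continuous_on ?S (\<lambda>z. frechet_derivative (snd c' \<circ> chart_inv c) (at z) b)" if "b \<in> Basis" for b
    using that by simp
  have "continuous_on ?S (\<lambda>z. \<Sum>b\<in>Basis. (w \<bullet> b) *\<^sub>R frechet_derivative (snd c' \<circ> chart_inv c) (at z) b)"
    by (intro continuous_intros b)
  then show ?thesis
  proof (rule continuous_on_eq)
    fix z assume "z \<in> ?S"
    then obtain x where x: "z = snd c x" "x \<in> fst c" "x \<in> fst c'" by blast
    have lin: "linear (trans_deriv c c' x)" by (rule linear_trans_deriv[OF c x(2,3)])
    have "trans_deriv c c' x w = trans_deriv c c' x (\<Sum>b\<in>Basis. (w \<bullet> b) *\<^sub>R b)"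
      by (simp add: euclidean_representation)
    also have "\<dots> = (\<Sum>b\<in>Basis. (w \<bullet> b) *\<^sub>R frechet_derivative (snd c' \<circ> chart_inv c) (at z) b)"
      by (simp add: linear_sum[OF lin] linear_scale[OF lin]) (simp add: trans_deriv_def x(1))
    finally show "(\<Sum>b\<in>Basis. (w \<bullet> b) *\<^sub>R frechet_derivative (snd c' \<circ> chart_inv c) (at z) b) =
        trans_deriv c c' (chart_inv c z) w" using x c by simp
  qed
qed

text \<open>The velocity of a coordinate segment in another chart is the image of z' - z under the
  derivative of the coordinate change, which varies continuously along the segment.\<close>

lemma chart_segment:
  assumes c: "c \<in> A" and seg: "closed_segment z z' \<subseteq> snd c ` fst c"
  defines "\<gamma> \<equiv> \<lambda>t. chart_inv c (z + t *\<^sub>R (z' - z))"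
  shows "unit_curve \<gamma>" and "len \<gamma> = integral {0..1} (\<lambda>t. L c (z + t *\<^sub>R (z' - z), z' - z))"
proof -
  have inV: "z + t *\<^sub>R (z' - z) \<in> snd c ` fst c" if "t \<in> {0..1}" for t
    using that seg by (force simp: closed_segment_def algebra_simps)
  have \<gamma>c: "\<gamma> t \<in> fst c" "snd c (\<gamma> t) = z + t *\<^sub>R (z' - z)" if "t \<in> {0..1}" for t
    using inV[OF that] c by (auto simp: \<gamma>_def)
  have c1: "continuous_on {0..1} \<gamma>"
    unfolding \<gamma>_def
    by (rule continuous_on_compose2[OF continuous_on_chart_inv[OF c]]) (use inV in \<open>auto intro!: continuous_intros\<close>)
  have c2: "((snd c' \<circ> \<gamma>) has_vector_derivative trans_deriv c c' (\<gamma> t) (z' - z)) (at t within {0..1})"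
    if c': "c' \<in> A" and t: "t \<in> {0..1}" and x: "\<gamma> t \<in> fst c'" for c' t
  proof -
    have "((\<lambda>t. z + t *\<^sub>R (z' - z)) has_vector_derivative (z' - z)) (at t within {0..1})"
      by (auto intro!: derivative_eq_intros)
    moreover have "((snd c' \<circ> chart_inv c) has_derivative trans_deriv c c' (\<gamma> t)) (at (z + t *\<^sub>R (z' - z)))"
      using transition_has_derivative[OF c c' \<gamma>c(1)[OF t] x] \<gamma>c(2)[OF t] by simp
    ultimately have "((snd c' \<circ> chart_inv c) \<circ> (\<lambda>t. z + t *\<^sub>R (z' - z)) has_vector_derivative
        trans_deriv c c' (\<gamma> t) (z' - z)) (at t within {0..1})"
      by (rule vector_derivative_diff_chain_within[where f' = "z' - z" and g' = "trans_deriv c c' (\<gamma> t)",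
            OF _ has_derivative_at_withinI])
    then show ?thesis by (simp add: \<gamma>_def o_def)
  qed
  have c3: "continuous_on {t\<in>{0..1}. \<gamma> t \<in> fst c'} (\<lambda>t. trans_deriv c c' (\<gamma> t) (z' - z))" if c': "c' \<in> A" for c'
    unfolding \<gamma>_def
    by (rule continuous_on_compose2[OF continuous_on_trans_deriv[OF c c']])
      (use inV c in \<open>auto intro!: continuous_intros simp: chart_image_Int[OF c]\<close>)
  show \<gamma>: "unit_curve \<gamma>" by (rule unit_curveI(1)[OF c1 c2 c3])
  have v: "vel \<gamma> t c = z' - z" if "t \<in> {0..1}" for t
    using unit_curveI(2)[OF c1 c2 c3 c that \<gamma>c(1)[OF that]] trans_deriv_same[OF c \<gamma>c(1)[OF that]] by simp
  have "speed \<gamma> t = L c (z + t *\<^sub>R (z' - z), z' - z)" if "t \<in> {0..1}" for t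
    using speed_in_chart[OF \<gamma> c that \<gamma>c(1)[OF that]] v[OF that] \<gamma>c(2)[OF that] by simp
  then show "len \<gamma> = integral {0..1} (\<lambda>t. L c (z + t *\<^sub>R (z' - z), z' - z))"
    unfolding len_def by (intro integral_cong) auto
qed

section \<open>Local comparison with the Euclidean norm and connecting curves\<close>

lemma chart_cball:
  assumes "c \<in> A" "x \<in> fst c"
  shows "\<exists>\<rho>>0. cball (snd c x) \<rho> \<subseteq> snd c ` fst c"
  using open_chart_image[OF assms(1)] assms(2) unfolding open_contains_cball by blast

text \<open>Extrema of L on the product of K with the unit sphere, extended to all w by homogeneity;
  positivity of L makes the lower constant positive.\<close>

lemma local_metric_bounds:
  assumes c: "c \<in> A" and K: "compact K" "K \<subseteq> snd c ` fst c"
  shows "\<exists>m>0. \<exists>M>0. \<forall>z\<in>K. \<forall>w. m * norm w \<le> L c (z, w) \<and> L c (z, w) \<le> M * norm w"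
proof (cases "K = {}")
  case False
  let ?S = "K \<times> sphere (0 :: real ^ 'n) 1"
  have cS: "compact ?S" by (intro compact_Times K(1) compact_sphere)
  have neS: "?S \<noteq> {}" using False by simp
  have cont: "continuous_on ?S (L c)"
    by (rule continuous_on_subset[OF local_metric_continuous[OF c]]) (use K in auto)
  obtain q where q: "q \<in> ?S" "\<And>s. s \<in> ?S \<Longrightarrow> L c q \<le> L c s"
    using continuous_attains_inf[OF cS neS cont] by blast
  obtain q' where q': "q' \<in> ?S" "\<And>s. s \<in> ?S \<Longrightarrow> L c s \<le> L c q'"
    using continuous_attains_sup[OF cS neS cont] by blast
  have pos: "0 < L c s" if s: "s \<in> ?S" for s
  proof -
    obtain z w where zw: "s = (z, w)" "z \<in> K" "norm w = 1" using s by auto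
    then have "w \<noteq> 0" by auto
    then show ?thesis using local_metric_pos[OF c, of z w] zw K by auto
  qed
  have "L c q * norm w \<le> L c (z, w) \<and> L c (z, w) \<le> L c q' * norm w" if z: "z \<in> K" for z w
  proof (cases "w = 0")
    case True
    interpret minkowski_norm "\<lambda>w. L c (z, w)" using minkowski_local c z K by blast
    show ?thesis using zero True by simp
  next
    case False
    have zV: "z \<in> snd c ` fst c" using z K by blast
    have w: "(z, w /\<^sub>R norm w) \<in> ?S" using False z by simp
    have "L c (z, w) = norm w * L c (z, w /\<^sub>R norm w)"
      using local_metric_hom[OF c zV, of "norm w" "w /\<^sub>R norm w"] False by simp
    then show ?thesis
      using q(2)[OF w] q'(2)[OF w] by (simp add: mult.commute mult_left_mono)
  qed
  then show ?thesis using pos q(1) q'(1) by blast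
qed (auto intro: exI[of _ 1])

text \<open>Uniform continuity on the product of K with the unit sphere; homogeneity turns the error
  into a multiple of norm w.\<close>

lemma local_metric_uniform:
  assumes c: "c \<in> A" and K: "compact K" "K \<subseteq> snd c ` fst c" and e: "0 < e"
  shows "\<exists>\<delta>>0. \<forall>z\<in>K. \<forall>z'\<in>K. dist z z' < \<delta> \<longrightarrow> (\<forall>w. \<bar>L c (z, w) - L c (z', w)\<bar> \<le> e * norm w)"
proof -
  let ?S = "K \<times> sphere (0 :: real ^ 'n) 1"
  have "uniformly_continuous_on ?S (L c)"
    by (intro compact_uniformly_continuous compact_Times K(1) compact_sphere
        continuous_on_subset[OF local_metric_continuous[OF c]]) (use K in auto)
  then obtain \<delta> where \<delta>: "0 < \<delta>"
    "\<And>s s'. s \<in> ?S \<Longrightarrow> s' \<in> ?S \<Longrightarrow> dist s' s < \<delta> \<Longrightarrow> dist (L c s') (L c s) < e"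
    unfolding uniformly_continuous_on_def using e by metis
  have "\<bar>L c (z, w) - L c (z', w)\<bar> \<le> e * norm w" if z: "z \<in> K" "z' \<in> K" "dist z z' < \<delta>" for z z' w
  proof (cases "w = 0")
    case True
    interpret a: minkowski_norm "\<lambda>w. L c (z, w)" using minkowski_local c z(1) K by blast
    interpret b: minkowski_norm "\<lambda>w. L c (z', w)" using minkowski_local c z(2) K by blast
    show ?thesis using a.zero b.zero True by simp
  next
    case False
    have V: "z \<in> snd c ` fst c" "z' \<in> snd c ` fst c" using z K by auto
    let ?w = "w /\<^sub>R norm w"
    have S: "(z, ?w) \<in> ?S" "(z', ?w) \<in> ?S" using False z by auto
    have "dist (z, ?w) (z', ?w) < \<delta>" using z(3) by (simp add: dist_Pair_Pair)
    then have "\<bar>L c (z, ?w) - L c (z', ?w)\<bar> < e"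
      using \<delta>(2)[OF S(2,1)] by (simp add: dist_real_def)
    then have "norm w * \<bar>L c (z, ?w) - L c (z', ?w)\<bar> \<le> norm w * e" by (intro mult_left_mono) auto
    moreover have "norm w * \<bar>L c (z, ?w) - L c (z', ?w)\<bar> = \<bar>norm w * L c (z, ?w) - norm w * L c (z', ?w)\<bar>"
      by (simp add: abs_mult flip: right_diff_distrib)
    moreover have "norm w * L c (z, ?w) = L c (z, w)" "norm w * L c (z', ?w) = L c (z', w)"
      using local_metric_hom[OF c V(1), of "norm w" ?w] local_metric_hom[OF c V(2), of "norm w" ?w] False by auto
    ultimately show ?thesis by (simp add: mult.commute)
  qed
  then show ?thesis using \<delta>(1) by blast
qed

lemma segment_length_le:
  assumes c: "c \<in> A" and seg: "closed_segment z z' \<subseteq> snd c ` fst c"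
    and bd: "\<And>y. y \<in> closed_segment z z' \<Longrightarrow> L c (y, z' - z) \<le> B"
  shows "\<exists>\<gamma>. unit_curve \<gamma> \<and> \<gamma> 0 = chart_inv c z \<and> \<gamma> 1 = chart_inv c z' \<and> len \<gamma> \<le> B"
proof -
  let ?\<gamma> = "\<lambda>t. chart_inv c (z + t *\<^sub>R (z' - z))"
  have y: "z + t *\<^sub>R (z' - z) \<in> closed_segment z z'" if "t \<in> {0..1}" for t
  proof -
    have "z + t *\<^sub>R (z' - z) = (1 - t) *\<^sub>R z + t *\<^sub>R z'" by (simp add: algebra_simps)
    then show ?thesis using that unfolding closed_segment_def by auto
  qed
  have cont: "continuous_on {0..1} (\<lambda>t. L c (z + t *\<^sub>R (z' - z), z' - z))"
    by (rule continuous_on_compose2[OF local_metric_continuous[OF c]])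
      (use y seg in \<open>auto intro!: continuous_intros\<close>)
  have "len ?\<gamma> = integral {0..1} (\<lambda>t. L c (z + t *\<^sub>R (z' - z), z' - z))"
    by (rule chart_segment(2)[OF c seg])
  also have "\<dots> \<le> integral {0..1} (\<lambda>t::real. B)"
    using bd y by (intro integral_le integrable_continuous_real cont) auto
  finally have "len ?\<gamma> \<le> B" by simp
  then show ?thesis using chart_segment(1)[OF c seg] by (intro exI[of _ ?\<gamma>]) simp
qed

lemma nearby_curves:
  assumes c: "c \<in> A" and \<rho>: "cball z0 \<rho> \<subseteq> snd c ` fst c" and z: "z \<in> cball z0 \<rho>" "z' \<in> cball z0 \<rho>"
  shows "\<exists>\<gamma>. unit_curve \<gamma> \<and> \<gamma> 0 = chart_inv c z \<and> \<gamma> 1 = chart_inv c z'"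
proof -
  have "closed_segment z z' \<subseteq> cball z0 \<rho>" by (rule closed_segment_subset[OF z convex_cball])
  then show ?thesis
    using chart_segment(1)[OF c, of z z'] \<rho>
    by (intro exI[of _ "\<lambda>t. chart_inv c (z + t *\<^sub>R (z' - z))"]) auto
qed

text \<open>The set of points reachable from x is open and closed, since any two points of a
  coordinate ball are joined by a segment. It ensures that the infimum defining the distance is not
  taken over the empty set.\<close>

lemma ex_unit_curve: "\<exists>\<gamma>. unit_curve \<gamma> \<and> \<gamma> 0 = x \<and> \<gamma> 1 = y"
proof -
  define S where "S = {y. \<exists>\<gamma>. unit_curve \<gamma> \<and> \<gamma> 0 = x \<and> \<gamma> 1 = y}"
  have nbhd: "\<exists>W. open W \<and> y \<in> W \<and> (\<forall>y'\<in>W. y' \<in> S \<longleftrightarrow> y \<in> S)" for y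
  proof -
    obtain c where c: "c \<in> A" "y \<in> fst c" using ex_chart by blast
    obtain \<rho> where \<rho>: "0 < \<rho>" "cball (snd c y) \<rho> \<subseteq> snd c ` fst c" using chart_cball[OF c] by blast
    let ?W = "fst c \<inter> snd c -` ball (snd c y) \<rho>"
    have join: "p' \<in> S" if p: "p \<in> S" "p \<in> ?W" "p' \<in> ?W" for p p'
    proof -
      obtain \<gamma>1 where \<gamma>1: "unit_curve \<gamma>1" "\<gamma>1 0 = x" "\<gamma>1 1 = p" using p(1) unfolding S_def by blast
      have "\<exists>\<gamma>. unit_curve \<gamma> \<and> \<gamma> 0 = chart_inv c (snd c p) \<and> \<gamma> 1 = chart_inv c (snd c p')"
        using p by (intro nearby_curves[OF c(1) \<rho>(2)]) auto
      then obtain \<gamma>2 where \<gamma>2: "unit_curve \<gamma>2" "\<gamma>2 0 = p" "\<gamma>2 1 = p'" using p c by auto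
      obtain \<gamma> where "unit_curve \<gamma>" "\<gamma> 0 = x" "\<gamma> 1 = p'"
        using join_unit_curves[OF \<gamma>1(1) \<gamma>2(1)] \<gamma>1 \<gamma>2 by auto
      then show ?thesis unfolding S_def by blast
    qed
    have "y \<in> ?W" using c \<rho> by auto
    then show ?thesis
      using open_chart_preimage[OF c(1) open_ball[of "snd c y" \<rho>]] join by (intro exI[of _ ?W]) blast
  qed
  have "open S"
  proof (rule topological_space_class.openI)
    fix y assume y: "y \<in> S"
    obtain W where W: "open W" "y \<in> W" "\<forall>y'\<in>W. y' \<in> S \<longleftrightarrow> y \<in> S" using nbhd[of y] by blast
    have "W \<subseteq> S" using W(3) y by blast
    then show "\<exists>T. open T \<and> y \<in> T \<and> T \<subseteq> S" using W(1,2) by blast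
  qed
  moreover have "closed S"
    unfolding closed_def
  proof (rule topological_space_class.openI)
    fix y assume y: "y \<in> - S"
    obtain W where W: "open W" "y \<in> W" "\<forall>y'\<in>W. y' \<in> S \<longleftrightarrow> y \<in> S" using nbhd[of y] by blast
    have "W \<subseteq> - S" using W(3) y by blast
    then show "\<exists>T. open T \<and> y \<in> T \<and> T \<subseteq> - S" using W(1,2) by blast
  qed
  moreover have "x \<in> S"
  proof -
    obtain c where c: "c \<in> A" "x \<in> fst c" using ex_chart by blast
    obtain \<rho> where \<rho>: "0 < \<rho>" "cball (snd c x) \<rho> \<subseteq> snd c ` fst c" using chart_cball[OF c] by blast
    have "\<exists>\<gamma>. unit_curve \<gamma> \<and> \<gamma> 0 = chart_inv c (snd c x) \<and> \<gamma> 1 = chart_inv c (snd c x)"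
      using \<rho> by (intro nearby_curves[OF c(1) \<rho>(2)]) auto
    then show ?thesis using c unfolding S_def by simp
  qed
  ultimately have "S = UNIV" using conn unfolding connected_clopen by auto
  then show ?thesis unfolding S_def by blast
qed

section \<open>The distance function, its Lipschitz bound and the eikonal equation\<close>

lemma finsler_dist_len:
  "finsler_dist A F x y = Inf {len \<gamma> |\<gamma>. unit_curve \<gamma> \<and> \<gamma> 0 = x \<and> \<gamma> 1 = y}"
  unfolding finsler_dist_def len_def ..

lemma lens_bdd_below: "bdd_below {len \<gamma> |\<gamma>. unit_curve \<gamma> \<and> \<gamma> 0 = x \<and> \<gamma> 1 = y}"
  using len_nonneg by (auto intro!: bdd_belowI[of _ 0])

lemma finsler_dist_le_len: "unit_curve \<gamma> \<Longrightarrow> finsler_dist A F (\<gamma> 0) (\<gamma> 1) \<le> len \<gamma>"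
  unfolding finsler_dist_len by (rule cInf_lower[OF _ lens_bdd_below]) blast

lemma finsler_dist_nonneg: "0 \<le> finsler_dist A F x y"
  unfolding finsler_dist_len using ex_unit_curve[of x y] len_nonneg by (intro cInf_greatest) auto

lemma ex_curve_len_less:
  assumes "finsler_dist A F x y < e"
  shows "\<exists>\<gamma>. unit_curve \<gamma> \<and> \<gamma> 0 = x \<and> \<gamma> 1 = y \<and> len \<gamma> < e"
proof -
  have "{len \<gamma> |\<gamma>. unit_curve \<gamma> \<and> \<gamma> 0 = x \<and> \<gamma> 1 = y} \<noteq> {}" using ex_unit_curve[of x y] by blast
  from cInf_lessD[OF this assms[unfolded finsler_dist_len]] show ?thesis by blast
qed

text \<open>The triangle inequality, with the curve appended at the end: the distance is not
  symmetric, and it is its second argument that varies.\<close>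

lemma finsler_dist_le_add_len:
  assumes \<gamma>: "unit_curve \<gamma>"
  shows "finsler_dist A F x (\<gamma> 1) \<le> finsler_dist A F x (\<gamma> 0) + len \<gamma>"
proof (rule field_le_epsilon)
  fix e :: real assume "0 < e"
  then obtain \<gamma>1 where \<gamma>1: "unit_curve \<gamma>1" "\<gamma>1 0 = x" "\<gamma>1 1 = \<gamma> 0" "len \<gamma>1 < finsler_dist A F x (\<gamma> 0) + e"
    using ex_curve_len_less[of x "\<gamma> 0" "finsler_dist A F x (\<gamma> 0) + e"] by auto
  obtain \<delta> where "unit_curve \<delta>" "\<delta> 0 = x" "\<delta> 1 = \<gamma> 1" "len \<delta> = len \<gamma>1 + len \<gamma>"
    using join_unit_curves[OF \<gamma>1(1) \<gamma>] \<gamma>1 by auto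
  then show "finsler_dist A F x (\<gamma> 1) \<le> finsler_dist A F x (\<gamma> 0) + len \<gamma> + e"
    using finsler_dist_le_len[of \<delta>] \<gamma>1(4) by simp
qed

lemma finsler_dist_self: "finsler_dist A F x x = 0"
proof -
  obtain c where c: "c \<in> A" "x \<in> fst c" using ex_chart by blast
  interpret minkowski_norm "\<lambda>w. L c (snd c x, w)" using minkowski_local c by blast
  have "\<exists>\<gamma>. unit_curve \<gamma> \<and> \<gamma> 0 = chart_inv c (snd c x) \<and> \<gamma> 1 = chart_inv c (snd c x) \<and> len \<gamma> \<le> 0"
    using c zero by (intro segment_length_le) auto
  then obtain \<gamma> where \<gamma>: "unit_curve \<gamma>" "\<gamma> 0 = x" "\<gamma> 1 = x" "len \<gamma> \<le> 0" using c by auto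
  then show ?thesis using finsler_dist_le_len[OF \<gamma>(1)] finsler_dist_nonneg[of x x] by simp
qed

lemma finsler_dist_segment:
  assumes c: "c \<in> A" and seg: "closed_segment z z' \<subseteq> snd c ` fst c"
    and bd: "\<And>y. y \<in> closed_segment z z' \<Longrightarrow> L c (y, z' - z) \<le> B"
  shows "finsler_dist A F x (chart_inv c z') \<le> finsler_dist A F x (chart_inv c z) + B"
proof -
  obtain \<gamma> where \<gamma>: "unit_curve \<gamma>" "\<gamma> 0 = chart_inv c z" "\<gamma> 1 = chart_inv c z'" "len \<gamma> \<le> B"
    using segment_length_le[OF assms] by blast
  then show ?thesis using finsler_dist_le_add_len[OF \<gamma>(1), of x] by simp
qed

text \<open>The two increments of the distance are bounded by the lengths of the segment and of its
  reversal; the bound M norm w serves for both orientations.\<close>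

lemma finsler_dist_Lipschitz:
  assumes c: "c \<in> A" and \<rho>: "cball z0 \<rho> \<subseteq> snd c ` fst c"
  shows "\<exists>M. M-lipschitz_on (cball z0 \<rho>) (finsler_dist A F x \<circ> chart_inv c)"
proof -
  obtain m M where M: "0 < M"
    and bd: "\<forall>z\<in>cball z0 \<rho>. \<forall>w. m * norm w \<le> L c (z, w) \<and> L c (z, w) \<le> M * norm w"
    using local_metric_bounds[OF c compact_cball \<rho>] by blast
  have le: "finsler_dist A F x (chart_inv c z') \<le> finsler_dist A F x (chart_inv c z) + M * norm (z' - z)"
    if z: "z \<in> cball z0 \<rho>" "z' \<in> cball z0 \<rho>" for z z'
  proof -
    have "closed_segment z z' \<subseteq> cball z0 \<rho>" by (rule closed_segment_subset[OF z convex_cball])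
    then have "closed_segment z z' \<subseteq> snd c ` fst c" "\<And>y. y \<in> closed_segment z z' \<Longrightarrow> L c (y, z' - z) \<le> M * norm (z' - z)"
      using \<rho> bd by blast+
    then show ?thesis by (rule finsler_dist_segment[OF c])
  qed
  have "M-lipschitz_on (cball z0 \<rho>) (finsler_dist A F x \<circ> chart_inv c)"
  proof (rule lipschitz_onI)
    fix z z' assume z: "z \<in> cball z0 \<rho>" "z' \<in> cball z0 \<rho>"
    show "dist ((finsler_dist A F x \<circ> chart_inv c) z) ((finsler_dist A F x \<circ> chart_inv c) z') \<le> M * dist z z'"
      using le[OF z] le[OF z(2,1)] by (simp add: dist_norm abs_le_iff norm_minus_commute)
  qed (use M in simp)
  then show ?thesis by blast
qed

lemma continuous_finsler_dist: "continuous_on UNIV (finsler_dist A F x)"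
  unfolding continuous_on_eq_continuous_at[OF open_UNIV]
proof
  fix y
  obtain c where c: "c \<in> A" "y \<in> fst c" using ex_chart by blast
  obtain \<rho> where \<rho>: "0 < \<rho>" "cball (snd c y) \<rho> \<subseteq> snd c ` fst c" using chart_cball[OF c] by blast
  let ?W = "fst c \<inter> snd c -` ball (snd c y) \<rho>"
  have W: "open ?W" "y \<in> ?W" using open_chart_preimage[OF c(1)] c \<rho> by auto
  obtain M where "M-lipschitz_on (cball (snd c y) \<rho>) (finsler_dist A F x \<circ> chart_inv c)"
    using finsler_dist_Lipschitz[OF c(1) \<rho>(2)] by blast
  then have "continuous_on (cball (snd c y) \<rho>) (finsler_dist A F x \<circ> chart_inv c)"
    by (rule lipschitz_on_continuous_on)
  then have "continuous_on ?W (\<lambda>p. (finsler_dist A F x \<circ> chart_inv c) (snd c p))"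
    by (rule continuous_on_compose2) (auto intro: continuous_on_subset[OF continuous_on_chart[OF c(1)]])
  then have "continuous_on ?W (finsler_dist A F x)"
    by (rule continuous_on_eq) (use c in auto)
  then show "continuous (at y) (finsler_dist A F x)"
    using W continuous_on_eq_continuous_at by blast
qed

text \<open>Moving from z to z + t w raises the distance by at most the length of the segment, which
  is at most t L(z, w) up to the oscillation of L; division by t gives dr(w) \<le> F(w).\<close>

lemma eikonal_le:
  assumes c: "c \<in> A" "x \<in> fst c" and d: "diff_at (finsler_dist A F o') x"
  shows "grad_in c (finsler_dist A F o') (snd c x) \<bullet> w \<le> L c (snd c x, w)"
proof (rule field_le_epsilon)
  fix e :: real assume e: "0 < e"
  let ?r = "finsler_dist A F o'" and ?z = "snd c x"
  let ?f = "?r \<circ> chart_inv c" and ?a = "grad_in c (finsler_dist A F o') (snd c x)"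
  obtain \<rho> where \<rho>: "0 < \<rho>" "cball ?z \<rho> \<subseteq> snd c ` fst c" using chart_cball[OF c] by blast
  \<comment> \<open>Two errors of size s norm w arise, from the differentiability of the distance
    and from the oscillation of L. This s keeps their sum at most e, and the summand 1 covers w =
    0.\<close>
  define s where "s = e / (2 * (norm w + 1))"
  have s: "0 < s" "2 * (s * norm w) \<le> e"
  proof -
    have n: "0 < norm w + 1" by (simp add: add_nonneg_pos)
    then show s0: "0 < s" using e by (simp add: s_def)
    have "2 * (s * norm w) \<le> 2 * (s * (norm w + 1))" using s0 by simp
    also have "\<dots> = e"
    proof -
      have "2 * (e / (2 * N) * N) = e" if "0 < N" for N :: real using that by simp
      then show ?thesis unfolding s_def using n by blast
    qed
    finally show "2 * (s * norm w) \<le> e" .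
  qed
  have D: "(?f has_derivative (\<lambda>h. ?a \<bullet> h)) (at ?z)"
    using grad_in_has_derivative diff_at_iff[OF c] d by blast
  obtain \<delta>1 where \<delta>1: "0 < \<delta>1" "\<And>y. norm (y - ?z) < \<delta>1 \<Longrightarrow> \<bar>?f y - ?f ?z - ?a \<bullet> (y - ?z)\<bar> \<le> s * norm (y - ?z)"
    using D s(1) unfolding has_derivative_at_alt real_norm_def by blast
  obtain \<delta>2 where \<delta>2: "0 < \<delta>2" "\<And>y. y \<in> cball ?z \<rho> \<Longrightarrow> dist y ?z < \<delta>2 \<Longrightarrow> \<bar>L c (y, w) - L c (?z, w)\<bar> \<le> s * norm w"
    using local_metric_uniform[OF c(1) compact_cball \<rho>(2) s(1)] \<rho>(1) by (metis centre_in_cball less_imp_le)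
  define t where "t = Min {\<rho>, \<delta>1, \<delta>2} / (2 * (norm w + 1))"
  have t0: "0 < t" unfolding t_def using \<rho>(1) \<delta>1(1) \<delta>2(1) by (intro divide_pos_pos) (auto simp: add_nonneg_pos)
  have "t * norm w < Min {\<rho>, \<delta>1, \<delta>2}"
  proof -
    have "t * norm w \<le> t * (norm w + 1)" using t0 by (intro mult_left_mono) auto
    also have "\<dots> = Min {\<rho>, \<delta>1, \<delta>2} / 2" 
    proof -
      have "B / (2 * N) * N = B / 2" if "0 < N" for N B :: real using that by simp
      then show ?thesis unfolding t_def using add_nonneg_pos[OF norm_ge_zero[of w] zero_less_one] by blast
    qed
    also have "\<dots> < Min {\<rho>, \<delta>1, \<delta>2}" using \<rho>(1) \<delta>1(1) \<delta>2(1) by (auto simp: min_def)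
    finally show ?thesis .
  qed
  then have t: "t * norm w < \<rho>" "t * norm w < \<delta>1" "t * norm w < \<delta>2" by auto
  let ?y = "?z + t *\<^sub>R w"
  have ny: "norm (?y - ?z) = t * norm w" using t0 by simp
  have zc: "?z \<in> cball ?z \<rho>" "?y \<in> cball ?z \<rho>" using \<rho> t(1) t0 by (auto simp: dist_norm)
  have seg: "closed_segment ?z ?y \<subseteq> cball ?z \<rho>" by (rule closed_segment_subset[OF zc convex_cball])
  have "?f ?y \<le> ?f ?z + t * (L c (?z, w) + s * norm w)"
    unfolding comp_apply
  proof (rule finsler_dist_segment[OF c(1)])
    show "closed_segment ?z ?y \<subseteq> snd c ` fst c" using seg \<rho> by blast
    fix q assume q: "q \<in> closed_segment ?z ?y"
    then have "norm (q - ?z) \<le> norm (?y - ?z)"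
      using segment_bound(1)[of q ?z ?y] by simp
    then have "norm (q - ?z) \<le> t * norm w" by (simp only: ny)
    then have "dist q ?z < \<delta>2" using t(3) by (simp add: dist_norm)
    then have "L c (q, w) \<le> L c (?z, w) + s * norm w" using \<delta>2(2)[of q] seg q by fastforce
    then have "t * L c (q, w) \<le> t * (L c (?z, w) + s * norm w)" using t0 by (intro mult_left_mono) auto
    then show "L c (q, ?y - ?z) \<le> t * (L c (?z, w) + s * norm w)"
      using local_metric_hom[OF c(1), of q t w] seg q \<rho> t0 by auto
  qed
  moreover have "\<bar>?f ?y - ?f ?z - ?a \<bullet> (?y - ?z)\<bar> \<le> s * (t * norm w)"
    using \<delta>1(2)[of ?y] t(2) unfolding ny by blast
  moreover have "?a \<bullet> (?y - ?z) = t * (?a \<bullet> w)" by simp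
  ultimately have "t * (?a \<bullet> w) \<le> t * (L c (?z, w) + s * norm w) + s * (t * norm w)" by linarith
  also have "\<dots> = t * (L c (?z, w) + 2 * (s * norm w))" by (simp add: algebra_simps)
  finally have "?a \<bullet> w \<le> L c (?z, w) + 2 * (s * norm w)" using t0 by simp
  then show "?a \<bullet> w \<le> L c (?z, w) + e" using s(2) by linarith
qed

text \<open>The times at which the curve is outside the open coordinate ball form a compact set, and
  t is the last of them. By continuity the curve is in the closed ball at t, hence on the
  sphere.\<close>

lemma last_entrance:
  assumes c: "c \<in> A" "x \<in> fst c" and \<delta>: "0 < \<delta>" "cball (snd c x) \<delta> \<subseteq> snd c ` fst c"
    and \<gamma>: "unit_curve \<gamma>" "\<gamma> 1 = x" and p: "\<gamma> 0 \<notin> chart_inv c ` cball (snd c x) \<delta>"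
  obtains t where "0 \<le> t" "t < 1" "dist (snd c x) (snd c (\<gamma> t)) = \<delta>"
    "\<And>s. s \<in> {t..1} \<Longrightarrow> \<gamma> s \<in> fst c \<and> snd c (\<gamma> s) \<in> cball (snd c x) \<delta>"
proof -
  let ?z = "snd c x"
  let ?W = "fst c \<inter> snd c -` ball ?z \<delta>"
  \<comment> \<open>Compact in a Hausdorff space, hence closed in M. So the point reached at time t
    belongs to the chart, although \<open>fst c\<close> is only open.\<close>
  define C where "C = chart_inv c ` cball ?z \<delta>"
  have W: "open ?W" by (rule open_chart_preimage[OF c(1) open_ball])
  have WC: "?W \<subseteq> C"
  proof
    fix y assume "y \<in> ?W"
    then have "y = chart_inv c (snd c y)" "snd c y \<in> cball ?z \<delta>" using c by auto
    then show "y \<in> C" unfolding C_def by (rule image_eqI)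
  qed
  have "closed C"
    unfolding C_def
    by (intro compact_imp_closed compact_continuous_image compact_cball
        continuous_on_subset[OF continuous_on_chart_inv[OF c(1)] \<delta>(2)])
  have cont: "continuous_on {0..1} \<gamma>" by (rule unit_curve_continuous[OF \<gamma>(1)])
  define T where "T = {0..1} \<inter> \<gamma> -` (- ?W)"
  have "closed T"
    unfolding T_def by (intro continuous_closed_preimage[OF cont] closed_atLeastAtMost closed_Compl W)
  moreover have "bounded T" unfolding T_def by (rule bounded_subset[of "{0..1}"]) auto
  ultimately have "compact T" by (simp add: compact_eq_bounded_closed)
  moreover have "0 \<in> T" using p WC by (auto simp: T_def C_def)
  ultimately obtain t where t: "t \<in> T" "\<And>s. s \<in> T \<Longrightarrow> s \<le> t"
    using compact_attains_sup[of T] by blast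
  have t01: "0 \<le> t" "t \<le> 1" "\<gamma> t \<notin> ?W" using t(1) by (auto simp: T_def)
  have "x \<in> ?W" using c \<delta> by simp
  then have "t \<noteq> 1" using t01(3) \<gamma>(2) by blast
  then have t1: "t < 1" using t01 by simp
  have inW: "\<gamma> s \<in> ?W" if "s \<in> {t<..1}" for s
  proof (rule ccontr)
    assume "\<gamma> s \<notin> ?W"
    then have "s \<in> T" using that t01 by (auto simp: T_def)
    then show False using t(2) that by force
  qed
  have tC: "\<gamma> t \<in> C"
  proof -
    have "closed ({0..1} \<inter> \<gamma> -` C)" by (intro continuous_closed_preimage[OF cont] closed_atLeastAtMost \<open>closed C\<close>)
    moreover have "{t<..1} \<subseteq> {0..1} \<inter> \<gamma> -` C"
    proof
      fix s assume s: "s \<in> {t<..1}"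
      then have "\<gamma> s \<in> C" using inW WC by blast
      then show "s \<in> {0..1} \<inter> \<gamma> -` C" using s t01 by simp
    qed
    ultimately have "closure {t<..1} \<subseteq> {0..1} \<inter> \<gamma> -` C" by (rule closure_minimal[rotated])
    moreover have "t \<in> closure {t<..1}" using t1 by simp
    ultimately show ?thesis by blast
  qed
  then obtain z1 where z1: "\<gamma> t = chart_inv c z1" "z1 \<in> cball ?z \<delta>" unfolding C_def by blast
  then have "z1 \<in> snd c ` fst c" using \<delta> by blast
  then have z1': "\<gamma> t \<in> fst c" "snd c (\<gamma> t) = z1" using z1 c by auto
  have "dist ?z z1 = \<delta>"
    using z1 z1' t01(3) by (auto simp: less_le)
  moreover have "\<gamma> s \<in> fst c \<and> snd c (\<gamma> s) \<in> cball ?z \<delta>" if "s \<in> {t..1}" for s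
  proof (cases "s = t")
    case True then show ?thesis using z1 z1' by simp
  next
    case False
    then have "\<gamma> s \<in> ?W" using that by (intro inW) auto
    then show ?thesis by auto
  qed
  ultimately show ?thesis using that t01(1) t1 z1' by blast
qed

text \<open>If the dual norm of dr were below 1, the distance would grow at a rate of at most some k
  < 1, up to small errors, along the last piece of an almost minimal curve, whereas almost
  minimality demands nearly unit rate. The length of that piece is at least m \<delta>, which
  outweighs the errors.\<close>

lemma eikonal_ge:
  assumes c: "c \<in> A" "x \<in> fst c" and d: "diff_at (finsler_dist A F o') x" and x: "x \<noteq> o'"
  shows "1 \<le> dual_in c (snd c x) (grad_in c (finsler_dist A F o') (snd c x))"
proof (rule ccontr)
  let ?r = "finsler_dist A F o'" and ?z = "snd c x"
  let ?f = "?r \<circ> chart_inv c" and ?a = "grad_in c (finsler_dist A F o') (snd c x)"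
  interpret minkowski_norm "\<lambda>w. L c (?z, w)" using minkowski_local c by blast
  define D where "D = dual_in c ?z ?a"
  assume "\<not> 1 \<le> dual_in c ?z ?a"
  then have D1: "D < 1" by (simp add: D_def)
  have D0: "0 \<le> D" unfolding D_def dual_in_def by (rule dual_nonneg)
  have aD: "?a \<bullet> w \<le> D * L c (?z, w)" for w unfolding D_def dual_in_def by (rule inner_le_dual)
  \<comment> \<open>Strictly between D and 1: the gap k - D absorbs the oscillation of L near x, and
    the gap 1 - k produces the contradiction.\<close>
  define k where "k = (1 + D) / 2"
  have k: "D < k" "k < 1" using D1 by (simp_all add: k_def)
  obtain \<rho>0 where \<rho>0: "0 < \<rho>0" "cball ?z \<rho>0 \<subseteq> snd c ` fst c" using chart_cball[OF c] by blast
  \<comment> \<open>The coordinate ball must exclude the base point, so that a curve from there to x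
    has a last entrance into it.\<close>
  obtain \<rho> where \<rho>: "0 < \<rho>" "\<rho> \<le> \<rho>0" "o' \<notin> chart_inv c ` cball ?z \<rho>"
  proof (cases "o' \<in> fst c")
    case True
    have ne: "snd c o' \<noteq> ?z" using chart_inv_chart[OF c(1) True] chart_inv_chart[OF c] x by metis
    define \<rho> where "\<rho> = min \<rho>0 (dist (snd c o') ?z / 2)"
    have \<rho>: "0 < \<rho>" "\<rho> \<le> \<rho>0" "\<rho> < dist (snd c o') ?z" using ne \<rho>0(1) by (auto simp: \<rho>_def min_def)
    have "o' \<notin> chart_inv c ` cball ?z \<rho>"
    proof
      assume "o' \<in> chart_inv c ` cball ?z \<rho>"
      then obtain q where q: "o' = chart_inv c q" "q \<in> cball ?z \<rho>" by blast
      then have "q \<in> snd c ` fst c" using \<rho>0(2) \<rho>(2) by auto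
      then have "snd c o' = q" using q(1) c by simp
      then show False using q(2) \<rho>(3) by (simp add: dist_commute)
    qed
    then show thesis using that \<rho> by blast
  next
    case False
    have "o' \<notin> chart_inv c ` cball ?z \<rho>0"
    proof
      assume "o' \<in> chart_inv c ` cball ?z \<rho>0"
      then obtain q where q: "o' = chart_inv c q" "q \<in> cball ?z \<rho>0" by blast
      then show False using False chart_inv_in[OF c(1), of q] \<rho>0(2) by blast
    qed
    then show thesis using that[of \<rho>0] \<rho>0(1) by simp
  qed
  have \<rho>V: "cball ?z \<rho> \<subseteq> snd c ` fst c" using \<rho>0(2) \<rho>(2) by auto
  obtain m M where m: "0 < m" and bd: "\<forall>z\<in>cball ?z \<rho>. \<forall>w. m * norm w \<le> L c (z, w) \<and> L c (z, w) \<le> M * norm w"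
    using local_metric_bounds[OF c(1) compact_cball \<rho>V] by blast
  have zc: "?z \<in> cball ?z \<rho>" using \<rho>(1) by simp
  obtain \<delta>1 where \<delta>1: "0 < \<delta>1" and un: "\<forall>z\<in>cball ?z \<rho>. \<forall>z'\<in>cball ?z \<rho>. dist z z' < \<delta>1 \<longrightarrow>
      (\<forall>w. \<bar>L c (z, w) - L c (z', w)\<bar> \<le> (k - D) * m * norm w)"
    using local_metric_uniform[OF c(1) compact_cball \<rho>V, of "(k - D) * m"] k(1) m by auto
  \<comment> \<open>Replacing L(z, w) by L(y, w) costs at most (k - D) m norm w \<le> (k - D) L(y,
    w), and the factor D in front of this is below 1.\<close>
  have ak: "?a \<bullet> w \<le> k * L c (y, w)" if y: "y \<in> cball ?z \<rho>" "dist ?z y < \<delta>1" for y w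
  proof -
    have "L c (?z, w) \<le> L c (y, w) + (k - D) * m * norm w"
      using un zc y by (smt (verit, ccfv_threshold))
    then have "D * L c (?z, w) \<le> D * (L c (y, w) + (k - D) * m * norm w)" using D0 by (rule mult_left_mono)
    also have "\<dots> = D * L c (y, w) + D * ((k - D) * (m * norm w))" by (simp add: algebra_simps)
    also have "D * ((k - D) * (m * norm w)) \<le> 1 * ((k - D) * L c (y, w))"
      using D0 D1 k m bd y(1) by (intro mult_mono mult_left_mono mult_nonneg_nonneg) auto
    finally have "D * L c (?z, w) \<le> k * L c (y, w)" by (simp add: algebra_simps)
    then show ?thesis using aD[of w] by linarith
  qed
  \<comment> \<open>The errors s \<delta> and e introduced below are each a quarter of (1 - k) m
    \<delta>, so together they reach at most half of (1 - k) L1.\<close>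
  define s where "s = (1 - k) * m / 4"
  have s: "0 < s" using k m by (simp add: s_def)
  have Df: "(?f has_derivative (\<lambda>h. ?a \<bullet> h)) (at ?z)"
    using grad_in_has_derivative diff_at_iff[OF c] d by blast
  obtain \<delta>2 where \<delta>2: "0 < \<delta>2" "\<forall>y. norm (y - ?z) < \<delta>2 \<longrightarrow> \<bar>?f y - ?f ?z - ?a \<bullet> (y - ?z)\<bar> \<le> s * norm (y - ?z)"
    using Df s(1) unfolding has_derivative_at_alt real_norm_def by blast
  define \<delta> where "\<delta> = Min {\<rho>, \<delta>1 / 2, \<delta>2 / 2}"
  have \<delta>: "0 < \<delta>" "\<delta> \<le> \<rho>" "\<delta> < \<delta>1" "\<delta> < \<delta>2" using \<rho>(1) \<delta>1 \<delta>2(1) by (auto simp: \<delta>_def)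
  have \<delta>V: "cball ?z \<delta> \<subseteq> snd c ` fst c" using \<rho>V \<delta>(2) by auto
  define e where "e = (1 - k) * m * \<delta> / 4"
  have e: "0 < e" using k m \<delta> by (simp add: e_def)
  obtain \<gamma> where \<gamma>: "unit_curve \<gamma>" "\<gamma> 0 = o'" "\<gamma> 1 = x" "len \<gamma> < ?r x + e"
    using ex_curve_len_less[of o' x "?r x + e"] e by auto
  have "\<gamma> 0 \<notin> chart_inv c ` cball ?z \<delta>" using \<rho>(3) \<delta>(2) unfolding \<gamma>(2) by auto
  then obtain t where t: "0 \<le> t" "t < 1" "dist ?z (snd c (\<gamma> t)) = \<delta>"
    and in_ball: "\<And>s. s \<in> {t..1} \<Longrightarrow> \<gamma> s \<in> fst c \<and> snd c (\<gamma> s) \<in> cball ?z \<delta>"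
    using last_entrance[OF c \<delta>(1) \<delta>V \<gamma>(1,3)] by blast
  let ?z1 = "snd c (\<gamma> t)"
  have sub: "{t..1} \<subseteq> {0..1}" "{0..t} \<subseteq> {0..1}" using t by auto
  have si: "(\<lambda>\<tau>. speed \<gamma> \<tau>) integrable_on {u..v}" if "{u..v} \<subseteq> {0..1}" for u v
    by (intro integrable_continuous_real continuous_on_subset[OF continuous_on_speed[OF \<gamma>(1)] that])
  define L1 where "L1 = integral {t..1} (\<lambda>\<tau>. speed \<gamma> \<tau>)"
  have vel_int: "((\<lambda>\<tau>. vel \<gamma> \<tau> c) has_integral ?z - ?z1) {t..1}"
  proof -
    have "((\<lambda>\<tau>. vel \<gamma> \<tau> c) has_integral (snd c \<circ> \<gamma>) 1 - (snd c \<circ> \<gamma>) t) {t..1}"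
    proof (rule fundamental_theorem_of_calculus)
      fix \<tau> assume \<tau>: "\<tau> \<in> {t..1}"
      then have "\<tau> \<in> {0..1}" using sub by blast
      then show "(snd c \<circ> \<gamma> has_vector_derivative vel \<gamma> \<tau> c) (at \<tau> within {t..1})"
        using unit_curve_has_vector_derivative[OF \<gamma>(1) c(1)] in_ball[OF \<tau>] sub(1)
        by (blast intro: has_vector_derivative_within_subset)
    qed (use t in simp)
    then show ?thesis using \<gamma>(3) by simp
  qed
  have sp: "speed \<gamma> \<tau> = L c (snd c (\<gamma> \<tau>), vel \<gamma> \<tau> c)" if "\<tau> \<in> {t..1}" for \<tau>
    using speed_in_chart[OF \<gamma>(1) c(1)] in_ball[OF that] that sub by blast
  have near: "snd c (\<gamma> \<tau>) \<in> cball ?z \<rho>" "dist ?z (snd c (\<gamma> \<tau>)) < \<delta>1" if "\<tau> \<in> {t..1}" for \<tau>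
    using in_ball[OF that] \<delta>(2,3) by auto
  have 1: "?a \<bullet> (?z - ?z1) \<le> k * L1"
  proof -
    have "((\<lambda>\<tau>. ?a \<bullet> vel \<gamma> \<tau> c) has_integral ?a \<bullet> (?z - ?z1)) {t..1}"
      using has_integral_linear[OF vel_int bounded_linear_inner_right[of ?a]] by (simp add: o_def)
    moreover have "((\<lambda>\<tau>. k * speed \<gamma> \<tau>) has_integral k * L1) {t..1}"
      unfolding L1_def by (intro has_integral_mult_right integrable_integral si sub)
    ultimately show ?thesis
      by (rule has_integral_le) (use ak near sp in auto)
  qed
  have 2: "m * \<delta> \<le> L1"
  proof -
    have "norm (integral {t..1} (\<lambda>\<tau>. vel \<gamma> \<tau> c)) \<le> integral {t..1} (\<lambda>\<tau>. speed \<gamma> \<tau> / m)"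
    proof (rule integral_norm_bound_integral)
      show "(\<lambda>\<tau>. vel \<gamma> \<tau> c) integrable_on {t..1}" using vel_int by blast
      show "(\<lambda>\<tau>. speed \<gamma> \<tau> / m) integrable_on {t..1}" using integrable_on_mult_right[OF si[OF sub(1)], of "1 / m"] by simp
      fix \<tau> assume \<tau>: "\<tau> \<in> {t..1}"
      have "m * norm (vel \<gamma> \<tau> c) \<le> speed \<gamma> \<tau>" using bd near(1)[OF \<tau>] sp[OF \<tau>] by auto
      then show "norm (vel \<gamma> \<tau> c) \<le> speed \<gamma> \<tau> / m" using m by (simp add: field_simps)
    qed
    also have "integral {t..1} (\<lambda>\<tau>. speed \<gamma> \<tau> / m) = L1 / m" by (simp add: L1_def)
    also have "integral {t..1} (\<lambda>\<tau>. vel \<gamma> \<tau> c) = ?z - ?z1" using vel_int by (rule integral_unique)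
    finally show ?thesis using t(3) m by (simp add: dist_norm field_simps)
  qed
  \<comment> \<open>The part of the curve up to time t is at least as long as the distance to its
    end, so the length L1 of the rest exceeds the growth of the distance by less than e.\<close>
  have 3: "?r (\<gamma> t) + L1 < ?r x + e"
  proof -
    have "unit_curve (\<lambda>\<tau>. \<gamma> (t * \<tau>)) \<and> len (\<lambda>\<tau>. \<gamma> (t * \<tau>)) = integral {t * 0..t * 1} (\<lambda>\<tau>. speed \<gamma> \<tau>)"
    proof (intro conjI reparam_unit_curve[OF \<gamma>(1), where \<theta>' = "\<lambda>_. t"])
      show "(\<lambda>\<tau>. t * \<tau>) ` {0..1} \<subseteq> {0..1}" "(\<lambda>\<tau>. t * \<tau>) ` {0..1} \<subseteq> {0..1}" using t by (auto simp: mult_le_one)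
      show "((\<lambda>\<tau>. t * \<tau>) has_real_derivative t) (at \<tau> within {0..1})"
        "((\<lambda>\<tau>. t * \<tau>) has_real_derivative t) (at \<tau> within {0..1})" for \<tau>
        by (auto intro!: derivative_eq_intros)
    qed (use t in auto)
    then have "?r (\<gamma> t) \<le> integral {0..t} (\<lambda>\<tau>. speed \<gamma> \<tau>)"
      using finsler_dist_le_len[of "\<lambda>\<tau>. \<gamma> (t * \<tau>)"] \<gamma>(2) by simp
    moreover have "integral {0..t} (\<lambda>\<tau>. speed \<gamma> \<tau>) + L1 = len \<gamma>"
      unfolding L1_def len_def using t by (intro Henstock_Kurzweil_Integration.integral_combine si) auto
    ultimately show ?thesis using \<gamma>(4) by linarith
  qed
  have fz: "?f ?z1 = ?r (\<gamma> t)" "?f ?z = ?r x" using in_ball[of t] t c by auto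
  have nz: "norm (?z1 - ?z) = \<delta>" using t(3) by (simp add: dist_norm norm_minus_commute)
  have "\<bar>?f ?z1 - ?f ?z - ?a \<bullet> (?z1 - ?z)\<bar> \<le> s * \<delta>"
    using \<delta>2(2)[rule_format, of ?z1] \<delta>(4) unfolding nz by blast
  moreover have "?a \<bullet> (?z1 - ?z) = - (?a \<bullet> (?z - ?z1))" by (simp add: inner_diff_right)
  ultimately have "L1 < k * L1 + s * \<delta> + e" using 1 3 unfolding fz by linarith
  moreover have "(1 - k) * (m * \<delta>) \<le> (1 - k) * L1" using 2 k by (intro mult_left_mono) auto
  moreover have "s * \<delta> + e = (1 - k) * (m * \<delta>) / 2" by (simp add: s_def e_def field_simps)
  moreover have "0 < (1 - k) * (m * \<delta>)" using k m \<delta> by simp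
  ultimately show False by (simp add: algebra_simps)
qed

lemma eikonal:
  assumes d: "diff_at (finsler_dist A F o') x" and x: "x \<noteq> o'"
  shows "dual_metric A F x (differential A (finsler_dist A F o') x) = 1"
proof -
  obtain c where c: "c \<in> A" "x \<in> fst c" using ex_chart by blast
  interpret minkowski_norm "\<lambda>w. L c (snd c x, w)" using minkowski_local c by blast
  have "dual_in c (snd c x) (grad_in c (finsler_dist A F o') (snd c x)) \<le> 1"
    unfolding dual_in_def using eikonal_le[OF c d] by (intro dual_le) simp
  then show ?thesis using eikonal_ge[OF c d x] dual_metric_differential(1)[OF c d] by simp
qed

text \<open>A nonzero differential excludes extrema. For the distance this places r(x) strictly
  between 0 and R, where G is differentiable.\<close>

lemma eikonal_not_extremum:
  assumes d: "diff_at f x" and unit: "dual_metric A F x (differential A f x) = 1"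
  shows "\<exists>y. f y < f x" and "\<exists>y. f x < f y"
proof -
  obtain c where c: "c \<in> A" "x \<in> fst c" using ex_chart by blast
  interpret minkowski_norm "\<lambda>w. L c (snd c x, w)" using minkowski_local c by blast
  let ?a = "grad_in c f (snd c x)"
  have D: "((f \<circ> chart_inv c) has_derivative (\<lambda>h. ?a \<bullet> h)) (at (snd c x))"
    using grad_in_has_derivative diff_at_iff[OF c] d by blast
  have "?a \<noteq> 0" using unit dual_metric_differential(1)[OF c d] dual_zero by (auto simp: dual_in_def)
  then have ne: "(\<lambda>h. ?a \<bullet> h) \<noteq> (\<lambda>h. 0)" by (metis inner_eq_zero_iff)
  show "\<exists>y. f y < f x"
  proof (rule ccontr)
    assume "\<nexists>y. f y < f x"
    then have "(f \<circ> chart_inv c) (snd c x) \<le> (f \<circ> chart_inv c) y" for y using c by (simp add: not_less)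
    then show False using has_derivative_local_min[OF D] ne by auto
  qed
  show "\<exists>y. f x < f y"
  proof (rule ccontr)
    assume "\<nexists>y. f x < f y"
    then have "(f \<circ> chart_inv c) y \<le> (f \<circ> chart_inv c) (snd c x)" for y using c by (simp add: not_less)
    then show False using has_derivative_local_max[OF D] ne by auto
  qed
qed

end

section \<open>Measurability and null sets\<close>

context finsler_space
begin

section \<open>Coordinate balls and reduction to coordinates\<close>

lemma chart_preimage_borel:
  assumes c: "c \<in> A" and B: "B \<in> sets borel"
  shows "fst c \<inter> snd c -` B \<in> sets borel"
proof -
  have "snd c \<in> borel_measurable (restrict_space borel (fst c))"
    by (rule borel_measurable_continuous_on_restrict[OF continuous_on_chart[OF c]])
  then have "snd c -` B \<inter> space (restrict_space borel (fst c)) \<in> sets (restrict_space borel (fst c))"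
    using B by (rule measurable_sets)
  then have "snd c -` B \<inter> fst c \<in> sets borel"
    using open_chart[OF c] by (simp add: space_restrict_space sets_restrict_space_iff)
  then show ?thesis by (simp add: Int_commute)
qed

definition coord_ball :: "('a, 'n) chart \<Rightarrow> real ^ 'n \<Rightarrow> real \<Rightarrow> 'a set" where
  "coord_ball c z \<rho> = fst c \<inter> snd c -` ball z \<rho>"

text \<open>The closed ball has to lie in the image of the chart, so that compactness yields bounds
  up to the boundary of the open set \<open>coord_ball\<close>.\<close>

definition is_coord_ball :: "('a, 'n) chart \<Rightarrow> real ^ 'n \<Rightarrow> real \<Rightarrow> bool" where
  "is_coord_ball c z \<rho> \<longleftrightarrow> c \<in> A \<and> 0 < \<rho> \<and> cball z \<rho> \<subseteq> snd c ` fst c"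

lemma open_coord_ball: "is_coord_ball c z \<rho> \<Longrightarrow> open (coord_ball c z \<rho>)"
  unfolding coord_ball_def is_coord_ball_def by (intro open_chart_preimage) auto

lemma ex_coord_ball: "\<exists>c z \<rho>. is_coord_ball c z \<rho> \<and> x \<in> coord_ball c z \<rho>"
proof -
  obtain c where c: "c \<in> A" "x \<in> fst c" using ex_chart by blast
  obtain \<rho> where "0 < \<rho>" "cball (snd c x) \<rho> \<subseteq> snd c ` fst c" using chart_cball[OF c] by blast
  then have "is_coord_ball c (snd c x) \<rho> \<and> x \<in> coord_ball c (snd c x) \<rho>"
    using c by (simp add: is_coord_ball_def coord_ball_def)
  then show ?thesis by blast
qed

text \<open>Second countability, in the form of the Lindelof property. Borel and almost everywhere
  statements thereby reduce to single coordinate balls.\<close>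

lemma countable_coord_balls:
  "\<exists>\<C>. countable \<C> \<and> (\<forall>W\<in>\<C>. \<exists>c z \<rho>. is_coord_ball c z \<rho> \<and> W = coord_ball c z \<rho>) \<and> \<Union>\<C> = UNIV"
proof -
  define \<F> where "\<F> = {W. \<exists>c z \<rho>. is_coord_ball c z \<rho> \<and> W = coord_ball c z \<rho>}"
  have op: "open S" if "S \<in> \<F>" for S using that open_coord_ball unfolding \<F>_def by blast
  obtain \<F>' where \<F>': "\<F>' \<subseteq> \<F>" "countable \<F>'" "\<Union>\<F>' = \<Union>\<F>"
    by (rule Lindelof[OF op]) (assumption | rule that)+
  have "x \<in> \<Union>\<F>" for x
    using ex_coord_ball[of x] unfolding \<F>_def by blast
  then have "\<Union>\<F>' = UNIV" unfolding \<F>'(3) by blast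
  moreover have "\<forall>W\<in>\<F>'. \<exists>c z \<rho>. is_coord_ball c z \<rho> \<and> W = coord_ball c z \<rho>"
    using \<F>'(1) unfolding \<F>_def by blast
  ultimately show ?thesis using \<F>'(2) by blast
qed

lemma borel_if_locally_borel:
  assumes "\<And>c z \<rho>. is_coord_ball c z \<rho> \<Longrightarrow> coord_ball c z \<rho> \<inter> S \<in> sets borel"
  shows "S \<in> sets borel"
proof -
  obtain \<C> where \<C>: "countable \<C>" "\<forall>W\<in>\<C>. \<exists>c z \<rho>. is_coord_ball c z \<rho> \<and> W = coord_ball c z \<rho>" "\<Union>\<C> = UNIV"
    using countable_coord_balls by blast
  have "W \<inter> S \<in> sets borel" if "W \<in> \<C>" for W
    using bspec[OF \<C>(2) that] assms by blast
  then have "(\<Union>W\<in>\<C>. W \<inter> S) \<in> sets borel" by (intro sets.countable_UN'[OF \<C>(1)]) blast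
  also have "(\<Union>W\<in>\<C>. W \<inter> S) = \<Union>\<C> \<inter> S" by blast
  finally show ?thesis using \<C>(3) by simp
qed

text \<open>Composing with the projection onto the closed ball gives a globally defined function with the
  same derivative inside the ball.\<close>

definition in_coords :: "('a, 'n) chart \<Rightarrow> real ^ 'n \<Rightarrow> real \<Rightarrow> ('a \<Rightarrow> 'b) \<Rightarrow> real ^ 'n \<Rightarrow> 'b" where
  "in_coords c z \<rho> f = (\<lambda>y. f (chart_inv c (closest_point (cball z \<rho>) y)))"

lemma closest_point_in_ball:
  fixes z :: "real ^ 'n"
  assumes "0 < \<rho>"
  shows "closest_point (cball z \<rho>) y \<in> cball z \<rho>"
    "y \<in> cball z \<rho> \<Longrightarrow> closest_point (cball z \<rho>) y = y"
  using assms by (auto intro!: closest_point_self closest_point_in_set simp del: mem_cball)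

lemma in_coords_eq:
  assumes "is_coord_ball c z \<rho>" "y \<in> cball z \<rho>"
  shows "in_coords c z \<rho> f y = (f \<circ> chart_inv c) y"
  using assms closest_point_in_ball(2) by (simp add: is_coord_ball_def in_coords_def)

text \<open>Projection onto a convex set is 1-Lipschitz, so the local Lipschitz bound becomes a
  global one, as Rademacher's theorem requires.\<close>

lemma in_coords_Lipschitz:
  assumes B: "is_coord_ball c z \<rho>"
  shows "\<exists>M. M-lipschitz_on UNIV (in_coords c z \<rho> (finsler_dist A F o'))"
proof -
  have c: "c \<in> A" and \<rho>: "0 < \<rho>" "cball z \<rho> \<subseteq> snd c ` fst c" using B by (auto simp: is_coord_ball_def)
  obtain M where M: "M-lipschitz_on (cball z \<rho>) (finsler_dist A F o' \<circ> chart_inv c)"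
    using finsler_dist_Lipschitz[OF c \<rho>(2)] by blast
  have "1-lipschitz_on UNIV (closest_point (cball z \<rho>))"
    using \<rho>(1) closest_point_lipschitz[of "cball z \<rho>"] by (intro lipschitz_onI) auto
  moreover have "M-lipschitz_on (closest_point (cball z \<rho>) ` UNIV) (finsler_dist A F o' \<circ> chart_inv c)"
    by (rule lipschitz_on_subset[OF M]) (use closest_point_in_ball(1)[OF \<rho>(1)] in blast)
  ultimately have "(M * 1)-lipschitz_on UNIV ((finsler_dist A F o' \<circ> chart_inv c) \<circ> closest_point (cball z \<rho>))"
    by (rule lipschitz_on_compose)
  then show ?thesis by (auto simp: in_coords_def o_def)
qed

lemma in_coords_has_derivative:
  assumes B: "is_coord_ball c z \<rho>" and y: "y \<in> ball z \<rho>"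
  shows "(in_coords c z \<rho> f has_derivative D) (at y) \<longleftrightarrow> ((f \<circ> chart_inv c) has_derivative D) (at y)"
proof -
  have eq: "in_coords c z \<rho> f q = (f \<circ> chart_inv c) q" if "q \<in> ball z \<rho>" for q
    using that by (intro in_coords_eq[OF B]) auto
  show ?thesis
  proof
    assume "(in_coords c z \<rho> f has_derivative D) (at y)"
    then show "((f \<circ> chart_inv c) has_derivative D) (at y)"
      by (rule has_derivative_transform_within_open[OF _ open_ball y]) (rule eq)
  next
    assume "((f \<circ> chart_inv c) has_derivative D) (at y)"
    then show "(in_coords c z \<rho> f has_derivative D) (at y)"
      by (rule has_derivative_transform_within_open[OF _ open_ball y]) (rule eq[symmetric])
  qed
qed

lemma diff_at_in_coords:
  assumes B: "is_coord_ball c z \<rho>" and x: "x \<in> coord_ball c z \<rho>"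
  shows "diff_at f x \<longleftrightarrow> in_coords c z \<rho> f differentiable (at (snd c x))"
proof -
  have "snd c x \<in> ball z \<rho>" "c \<in> A" "x \<in> fst c" using B x by (auto simp: is_coord_ball_def coord_ball_def)
  then show ?thesis
    using diff_at_iff[of c x f] in_coords_has_derivative[OF B, of "snd c x" f] unfolding differentiable_def by blast
qed

lemma borel_diff_set:
  fixes f :: "real ^ 'n \<Rightarrow> real"
  assumes "continuous_on UNIV f"
  shows "{y. f differentiable (at y)} \<in> sets borel"
proof -
  have "{y. (\<lambda>h. f (y + h)) differentiable (at 0)} \<in> sets borel"
    by (rule borel_differentiability_set) (intro continuous_on_compose2[OF assms] continuous_intros, auto)
  then show ?thesis by (simp add: differentiable_shift)
qed

lemma borel_diff_at_finsler_dist: "{x. diff_at (finsler_dist A F o') x} \<in> sets borel"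
proof (rule borel_if_locally_borel)
  fix c z \<rho> assume B: "is_coord_ball c z \<rho>"
  let ?f = "in_coords c z \<rho> (finsler_dist A F o')"
  have c: "c \<in> A" using B by (simp add: is_coord_ball_def)
  have "continuous_on UNIV ?f" using in_coords_Lipschitz[OF B] lipschitz_on_continuous_on by blast
  then have "{y. ?f differentiable (at y)} \<inter> ball z \<rho> \<in> sets borel" using borel_diff_set by auto
  then have "fst c \<inter> snd c -` ({y. ?f differentiable (at y)} \<inter> ball z \<rho>) \<in> sets borel"
    by (rule chart_preimage_borel[OF c])
  moreover have "fst c \<inter> snd c -` ({y. ?f differentiable (at y)} \<inter> ball z \<rho>) =
      coord_ball c z \<rho> \<inter> {x. diff_at (finsler_dist A F o') x}"
    using diff_at_in_coords[OF B] by (auto simp: coord_ball_def)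
  ultimately show "coord_ball c z \<rho> \<inter> {x. diff_at (finsler_dist A F o') x} \<in> sets borel" by simp
qed

section \<open>Measurability of the dual norms of du and of du applied to the gradient of r\<close>

definition smooth_fun :: "('a \<Rightarrow> real) \<Rightarrow> bool" where
  "smooth_fun u \<longleftrightarrow> (\<forall>c\<in>A. smooth_on (snd c ` fst c) (u \<circ> chart_inv c))"

lemma smooth_fun_differentiable:
  assumes u: "smooth_fun u" and c: "c \<in> A" and z: "z \<in> snd c ` fst c"
  shows "(u \<circ> chart_inv c) differentiable (at z)"
proof -
  have "Ck_on (Suc 0) (u \<circ> chart_inv c) (snd c ` fst c)" using u c unfolding smooth_fun_def smooth_on_def by blast
  then have "\<forall>z\<in>snd c ` fst c. (u \<circ> chart_inv c) differentiable (at z)" unfolding Ck_on.simps by blast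
  then show ?thesis using z by blast
qed

lemma smooth_fun_diff_at: "smooth_fun u \<Longrightarrow> diff_at u x"
  using smooth_fun_differentiable ex_chart[of x] unfolding diff_at_def by blast

lemma smooth_fun_continuous_grad:
  assumes u: "smooth_fun u" and c: "c \<in> A"
  shows "continuous_on (snd c ` fst c) (grad_in c u)"
proof -
  have "Ck_on (Suc 0) (u \<circ> chart_inv c) (snd c ` fst c)" using u c unfolding smooth_fun_def smooth_on_def by blast
  then have "continuous_on (snd c ` fst c) (\<lambda>z. frechet_derivative (u \<circ> chart_inv c) (at z) b)" if "b \<in> Basis" for b
    using that by simp
  then show ?thesis unfolding grad_in_def by (intro continuous_intros)
qed

lemma smooth_fun_continuous:
  assumes u: "smooth_fun u"
  shows "continuous_on UNIV u"
  unfolding continuous_on_eq_continuous_at[OF open_UNIV]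
proof
  fix x
  obtain c where c: "c \<in> A" "x \<in> fst c" using ex_chart by blast
  have "continuous_on (snd c ` fst c) (u \<circ> chart_inv c)"
    using smooth_fun_differentiable[OF u c(1)] differentiable_imp_continuous_within
    by (intro continuous_at_imp_continuous_on) blast
  then have "continuous_on (fst c) (\<lambda>x. (u \<circ> chart_inv c) (snd c x))"
    by (rule continuous_on_compose2[OF _ continuous_on_chart[OF c(1)]]) auto
  then have "continuous_on (fst c) u" by (rule continuous_on_eq) (use c in auto)
  then show "continuous (at x) u" using open_chart[OF c(1)] c(2) continuous_on_eq_continuous_at by blast
qed

text \<open>For a fixed coordinate vector w the quotient is continuous in x, so the dual norm is a
  supremum of continuous functions and hence lower semicontinuous. The factor s is 1 for du and -1
  for -du.\<close>

lemma open_dual_superlevel: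
  assumes u: "smooth_fun u" and \<xi>: "\<And>x c. c \<in> A \<Longrightarrow> x \<in> fst c \<Longrightarrow>
      dual_metric A F x (\<xi> x) = dual_in c (snd c x) (s *\<^sub>R grad_in c u (snd c x))"
  shows "open {x. b < dual_metric A F x (\<xi> x)}"
proof -
  let ?q = "\<lambda>c w z. (s *\<^sub>R grad_in c u z) \<bullet> w / L c (z, w)"
  have iff: "b < dual_metric A F x (\<xi> x) \<longleftrightarrow> (\<exists>w. w \<noteq> 0 \<and> b < ?q c w (snd c x))" if c: "c \<in> A" "x \<in> fst c" for c x
  proof -
    interpret minkowski_norm "\<lambda>w. L c (snd c x, w)" using minkowski_local c by blast
    show ?thesis
      unfolding \<xi>[OF c] dual_in_def dual_def less_cSUP_iff[OF UNIV_minus_0 bdd_above_quotient] by blast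
  qed
  have "open (fst c \<inter> {x. b < ?q c w (snd c x)})" if c: "c \<in> A" and w: "w \<noteq> 0" for c w
  proof -
    have "continuous_on (snd c ` fst c) (\<lambda>z. L c (z, w))"
      by (rule continuous_on_compose2[OF local_metric_continuous[OF c]]) (auto intro!: continuous_intros)
    moreover have "L c (z, w) \<noteq> 0" if "z \<in> snd c ` fst c" for z using local_metric_pos[OF c that w] by simp
    ultimately have "continuous_on (snd c ` fst c) (?q c w)"
      by (intro continuous_intros smooth_fun_continuous_grad[OF u c]) auto
    then have "continuous_on (fst c) (\<lambda>x. ?q c w (snd c x))"
      by (rule continuous_on_compose2[OF _ continuous_on_chart[OF c]]) auto
    from continuous_open_preimage[OF this open_chart[OF c], of "{b<..}"]
    show ?thesis by (simp add: vimage_def)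
  qed
  then have "open (\<Union>c\<in>A. \<Union>w\<in>-{0}. fst c \<inter> {x. b < ?q c w (snd c x)})" by (intro open_UN ballI) auto
  also have "(\<Union>c\<in>A. \<Union>w\<in>-{0}. fst c \<inter> {x. b < ?q c w (snd c x)}) = {x. b < dual_metric A F x (\<xi> x)}"
  proof (intro equalityI subsetI)
    fix x assume "x \<in> {x. b < dual_metric A F x (\<xi> x)}"
    moreover obtain c where c: "c \<in> A" "x \<in> fst c" using ex_chart by blast
    ultimately obtain w where "w \<noteq> 0" "b < ?q c w (snd c x)" using iff[OF c] by blast
    then show "x \<in> (\<Union>c\<in>A. \<Union>w\<in>-{0}. fst c \<inter> {x. b < ?q c w (snd c x)})" using c by blast
  next
    fix x assume "x \<in> (\<Union>c\<in>A. \<Union>w\<in>-{0}. fst c \<inter> {x. b < ?q c w (snd c x)})"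
    then obtain c w where "c \<in> A" "x \<in> fst c" "w \<noteq> 0" "b < ?q c w (snd c x)" by blast
    then show "x \<in> {x. b < dual_metric A F x (\<xi> x)}" using iff[of c x] by blast
  qed
  finally show ?thesis .
qed

lemma borel_max_dual_powr:
  assumes u: "smooth_fun u"
  shows "max_dual_powr A F p u \<in> borel_measurable borel"
proof -
  have "(\<lambda>x. dual_metric A F x (differential A u x)) \<in> borel_measurable borel"
    unfolding borel_measurable_iff_greater
    using open_dual_superlevel[OF u, of "differential A u" 1] dual_metric_differential(1)[OF _ _ smooth_fun_diff_at[OF u]]
    by auto
  moreover have "(\<lambda>x. dual_metric A F x (\<lambda>v. - differential A u x v)) \<in> borel_measurable borel"
    unfolding borel_measurable_iff_greater
    using open_dual_superlevel[OF u, of "\<lambda>x v. - differential A u x v" "-1"]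
      dual_metric_differential(2)[OF _ _ smooth_fun_diff_at[OF u]]
    by auto
  ultimately have "(\<lambda>x. max_dual_powr A F p u x) \<in> borel_measurable borel"
    unfolding max_dual_powr_def by measurable
  then show ?thesis .
qed

text \<open>Where \<open>F\<^sup>*(dr) = 1\<close> the gradient is the only vector \<open>w\<close> with \<open>F(w) \<le> 1\<close> and \<open>dr(w) \<ge> 1\<close>, so a
  superlevel set of \<open>du(\<nabla>r)\<close> is a preimage of the projection of a closed set along a compact set
  of vectors.\<close>

lemma gradient_superlevel_iff:
  assumes c: "c \<in> A" "x \<in> fst c" and f: "diff_at f x" and u: "diff_at u x"
    and unit: "dual_metric A F x (differential A f x) = 1"
  shows "b \<le> differential A u x (finsler_gradient A F f x) \<longleftrightarrow>
    (\<exists>w. L c (snd c x, w) \<le> 1 \<and> 1 \<le> grad_in c f (snd c x) \<bullet> w \<and> b \<le> grad_in c u (snd c x) \<bullet> w)"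
proof -
  interpret minkowski_norm "\<lambda>w. L c (snd c x, w)" using minkowski_local c by blast
  let ?a = "grad_in c f (snd c x)" and ?v = "finsler_gradient A F f x"
  have d1: "dual ?a = 1" using unit dual_metric_differential(1)[OF c f] by (simp add: dual_in_def)
  note v = gradient_unit[OF c f unit]
  have uniq: "w = ?v c" if "L c (snd c x, w) \<le> 1" "1 \<le> ?a \<bullet> w" for w
  proof -
    have "L c (snd c x, w) = 1" "?a \<bullet> w = 1" using inner_le_dual[of ?a w] d1 that by auto
    then show ?thesis using legendre_ex1[of ?a] v d1 by auto
  qed
  have eq: "differential A u x ?v = grad_in c u (snd c x) \<bullet> ?v c" by (rule differential_eq[OF c v(1) u])
  show ?thesis
  proof
    assume "b \<le> differential A u x ?v"
    then show "\<exists>w. L c (snd c x, w) \<le> 1 \<and> 1 \<le> ?a \<bullet> w \<and> b \<le> grad_in c u (snd c x) \<bullet> w"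
      using v eq by (intro exI[of _ "?v c"]) simp
  next
    assume "\<exists>w. L c (snd c x, w) \<le> 1 \<and> 1 \<le> ?a \<bullet> w \<and> b \<le> grad_in c u (snd c x) \<bullet> w"
    then obtain w where w: "L c (snd c x, w) \<le> 1" "1 \<le> ?a \<bullet> w" "b \<le> grad_in c u (snd c x) \<bullet> w" by blast
    then show "b \<le> differential A u x ?v" using uniq[OF w(1,2)] eq by simp
  qed
qed

text \<open>Limits of difference quotients with steps 1/(k+1). They are Borel also where they fail
  to converge and \<open>lim\<close> has an unspecified value; only points of differentiability
  matter.\<close>

lemma borel_gradient_limit:
  fixes f :: "real ^ 'n \<Rightarrow> real"
  assumes cont: "continuous_on UNIV f"
  obtains g where "g \<in> borel_measurable borel" "\<And>y a. (f has_derivative (\<lambda>w. a \<bullet> w)) (at y) \<Longrightarrow> g y = a"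
proof -
  define q where "q = (\<lambda>b k y. (f (y + (1 / real (Suc k)) *\<^sub>R b) - f y) * real (Suc k))"
  define g where "g = (\<lambda>y. \<Sum>b\<in>Basis. lim (\<lambda>k. q b k y) *\<^sub>R b)"
  have "continuous_on UNIV (q b k)" for b k
    unfolding q_def by (intro continuous_intros continuous_on_compose2[OF cont]) auto
  then have "q b k \<in> borel_measurable borel" for b k by (rule borel_measurable_continuous_onI)
  then have "g \<in> borel_measurable borel" unfolding g_def by measurable
  moreover have "g y = a" if D: "(f has_derivative (\<lambda>w. a \<bullet> w)) (at y)" for y a
  proof -
    have "lim (\<lambda>k. q b k y) = a \<bullet> b" for b
    proof -
      have "((\<lambda>t. y + t *\<^sub>R b) has_derivative (\<lambda>t. t *\<^sub>R b)) (at 0)" by (auto intro!: derivative_eq_intros)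
      from diff_chain_at[OF this, of f "\<lambda>w. a \<bullet> w"] D
      have "((\<lambda>t. f (y + t *\<^sub>R b)) has_derivative (\<lambda>t. t * (a \<bullet> b))) (at 0)" by (simp add: o_def)
      then have "((\<lambda>t. f (y + t *\<^sub>R b)) has_field_derivative (a \<bullet> b)) (at 0)"
        unfolding has_field_derivative_def by (rule has_derivative_eq_rhs) (simp add: fun_eq_iff)
      then have "((\<lambda>t. (f (y + t *\<^sub>R b) - f y) / t) \<longlongrightarrow> a \<bullet> b) (at 0)"
        by (simp add: DERIV_def)
      moreover have "filterlim (\<lambda>k. 1 / real (Suc k)) (at 0) sequentially"
        unfolding filterlim_at using LIMSEQ_inverse_real_of_nat by (auto simp: inverse_eq_divide)
      ultimately have "((\<lambda>k. (f (y + (1 / real (Suc k)) *\<^sub>R b) - f y) / (1 / real (Suc k))) \<longlonglongrightarrow> a \<bullet> b)"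
        by (rule filterlim_compose)
      then show ?thesis unfolding q_def by (intro limI) simp
    qed
    then show ?thesis by (simp add: g_def euclidean_representation)
  qed
  ultimately show ?thesis using that by blast
qed

lemma borel_gradient_superlevel:
  assumes u: "smooth_fun u" and unit: "\<And>x. x \<in> E \<Longrightarrow> dual_metric A F x (differential A (finsler_dist A F o') x) = 1"
    and E: "E \<in> sets borel" "\<And>x. x \<in> E \<Longrightarrow> diff_at (finsler_dist A F o') x"
  shows "{x\<in>E. b \<le> differential A u x (finsler_gradient A F (finsler_dist A F o') x)} \<in> sets borel"
proof (rule borel_if_locally_borel)
  fix c z \<rho> assume B: "is_coord_ball c z \<rho>"
  then have c: "c \<in> A" and \<rho>: "0 < \<rho>" "cball z \<rho> \<subseteq> snd c ` fst c" by (auto simp: is_coord_ball_def)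
  let ?r = "finsler_dist A F o'"
  let ?f = "in_coords c z \<rho> ?r" and ?P = "closest_point (cball z \<rho>)"
  have "continuous_on UNIV ?f" using in_coords_Lipschitz[OF B] lipschitz_on_continuous_on by blast
  then obtain g where g: "g \<in> borel_measurable borel" "\<And>y a. (?f has_derivative (\<lambda>w. a \<bullet> w)) (at y) \<Longrightarrow> g y = a"
    using borel_gradient_limit by blast
  obtain m M where m: "0 < m" and bd: "\<forall>y\<in>cball z \<rho>. \<forall>w. m * norm w \<le> L c (y, w) \<and> L c (y, w) \<le> M * norm w"
    using local_metric_bounds[OF c compact_cball \<rho>(2)] by blast
  have contP: "continuous_on S ?P" for S using \<rho>(1) by (intro continuous_on_closest_point) auto
  have P: "?P y \<in> cball z \<rho>" for y using closest_point_in_ball(1)[OF \<rho>(1)] .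
  \<comment> \<open>The components of q are the vector w, the base point, and the coordinate
    differentials of r and of u.\<close>
  define T where "T = {q :: (real^'n) \<times> (real^'n) \<times> (real^'n) \<times> (real^'n).
    L c (?P (fst (snd q)), fst q) \<le> 1 \<and> 1 \<le> fst (snd (snd q)) \<bullet> fst q \<and> b \<le> snd (snd (snd q)) \<bullet> fst q}"
  have "continuous_on UNIV (\<lambda>q :: (real^'n) \<times> (real^'n) \<times> (real^'n) \<times> (real^'n). L c (?P (fst (snd q)), fst q))"
    by (rule continuous_on_compose2[OF local_metric_continuous[OF c]])
      (use P \<rho>(2) in \<open>auto intro!: continuous_intros continuous_on_compose2[OF contP]\<close>)
  then have "closed T"
    unfolding T_def by (intro closed_Collect_conj closed_Collect_le continuous_intros)
  \<comment> \<open>The radius 1 / m loses no solution, since m norm w \<le> L \<le> 1; compactness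
    of the ball keeps the projection closed.\<close>
  then have "closed {p. \<exists>w. w \<in> cball 0 (1 / m) \<and> (w, p) \<in> T}" (is "closed ?Q")
    by (rule closed_compact_projection[OF compact_cball])
  then have Q: "?Q \<in> sets borel" by (rule borel_closed)
  have "continuous_on UNIV (\<lambda>y. grad_in c u (?P y))"
    by (rule continuous_on_compose2[OF smooth_fun_continuous_grad[OF u c] contP]) (use P \<rho>(2) in blast)
  then have "(\<lambda>y. grad_in c u (?P y)) \<in> borel_measurable borel" by (rule borel_measurable_continuous_onI)
  then have "(\<lambda>y. (y, g y, grad_in c u (?P y))) \<in> borel \<rightarrow>\<^sub>M borel"
    using g(1) by (intro borel_measurable_Pair) auto
  then have "(\<lambda>y. (y, g y, grad_in c u (?P y))) -` ?Q \<in> sets borel"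
    using measurable_sets_borel[OF _ Q] by blast
  then have "(\<lambda>y. (y, g y, grad_in c u (?P y))) -` ?Q \<inter> ball z \<rho> \<in> sets borel" by auto
  then have "fst c \<inter> snd c -` ((\<lambda>y. (y, g y, grad_in c u (?P y))) -` ?Q \<inter> ball z \<rho>) \<in> sets borel"
    by (rule chart_preimage_borel[OF c])
  then have "(fst c \<inter> snd c -` ((\<lambda>y. (y, g y, grad_in c u (?P y))) -` ?Q \<inter> ball z \<rho>)) \<inter> E \<in> sets borel"
    using E(1) by blast
  also have "(fst c \<inter> snd c -` ((\<lambda>y. (y, g y, grad_in c u (?P y))) -` ?Q \<inter> ball z \<rho>)) \<inter> E =
      coord_ball c z \<rho> \<inter> {x\<in>E. b \<le> differential A u x (finsler_gradient A F ?r x)}"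
  proof -
    have "(snd c x, g (snd c x), grad_in c u (?P (snd c x))) \<in> ?Q \<longleftrightarrow>
        b \<le> differential A u x (finsler_gradient A F ?r x)" if x: "x \<in> E" "x \<in> coord_ball c z \<rho>" for x
    proof -
      have xc: "x \<in> fst c" "snd c x \<in> ball z \<rho>" using x by (auto simp: coord_ball_def)
      then have Px: "?P (snd c x) = snd c x" using closest_point_in_ball(2)[OF \<rho>(1)] by auto
      have "(?f has_derivative (\<lambda>w. grad_in c ?r (snd c x) \<bullet> w)) (at (snd c x))"
        using in_coords_has_derivative[OF B xc(2)] grad_in_has_derivative diff_at_iff[OF c xc(1)] E(2)[OF x(1)] by blast
      then have gx: "g (snd c x) = grad_in c ?r (snd c x)" by (rule g(2))
      have small: "w \<in> cball 0 (1 / m)" if "L c (snd c x, w) \<le> 1" for w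
      proof -
        have "m * norm w \<le> 1" using bd xc(2) that by (meson ball_subset_cball order_trans subsetD)
        then show ?thesis using m by (simp add: field_simps)
      qed
      have "(snd c x, g (snd c x), grad_in c u (?P (snd c x))) \<in> ?Q \<longleftrightarrow>
          (\<exists>w. L c (snd c x, w) \<le> 1 \<and> 1 \<le> grad_in c ?r (snd c x) \<bullet> w \<and> b \<le> grad_in c u (snd c x) \<bullet> w)"
      proof -
        have "(snd c x, g (snd c x), grad_in c u (?P (snd c x))) \<in> ?Q \<longleftrightarrow> (\<exists>w. w \<in> cball 0 (1 / m) \<and>
            L c (snd c x, w) \<le> 1 \<and> 1 \<le> grad_in c ?r (snd c x) \<bullet> w \<and> b \<le> grad_in c u (snd c x) \<bullet> w)"
          by (simp add: T_def gx Px)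
        then show ?thesis using small by blast
      qed
      then show ?thesis
        using gradient_superlevel_iff[OF c xc(1) E(2)[OF x(1)] smooth_fun_diff_at[OF u] unit[OF x(1)]] by simp
    qed
    then show ?thesis unfolding coord_ball_def by blast
  qed
  finally show "coord_ball c z \<rho> \<inter> {x\<in>E. b \<le> differential A u x (finsler_gradient A F ?r x)} \<in> sets borel" .
qed

end

section \<open>Integration of the pointwise inequality\<close>

text \<open>Young's inequality for |I| / D and |\<mu>|^(1/(p-1)), multiplied by D. Its equality case
  dictates the maximizer \<mu> = sgn I (|I| / D)^(p-1).\<close>

lemma quotient_maximum:
  fixes I D p :: real
  assumes p: "1 < p" and D: "0 < D"
  shows "p * (\<mu> * I) - (p - 1) * (\<bar>\<mu>\<bar> powr (p / (p - 1)) * D) \<le> \<bar>I\<bar> powr p / D powr (p - 1)"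
    and "\<exists>\<mu>. p * (\<mu> * I) - (p - 1) * (\<bar>\<mu>\<bar> powr (p / (p - 1)) * D) = \<bar>I\<bar> powr p / D powr (p - 1)"
proof -
  let ?a = "\<bar>I\<bar> / D"
  have a0: "0 \<le> ?a" using D by simp
  have r: "\<bar>I\<bar> powr p / D powr (p - 1) = D * ?a powr p"
    using D by (simp add: powr_divide powr_diff)
  let ?c = "\<bar>\<mu>\<bar> powr (1 / (p - 1))"
  have c: "?c powr (p - 1) = \<bar>\<mu>\<bar>" "?c powr p = \<bar>\<mu>\<bar> powr (p / (p - 1))"
    using p by (simp_all add: powr_powr)
  have "p * (?a * \<bar>\<mu>\<bar>) \<le> ?a powr p + (p - 1) * \<bar>\<mu>\<bar> powr (p / (p - 1))"
    using Young_powr_le[OF p a0, of ?c] unfolding c by simp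
  then have "D * (p * (?a * \<bar>\<mu>\<bar>)) \<le> D * (?a powr p + (p - 1) * \<bar>\<mu>\<bar> powr (p / (p - 1)))"
    using D by (intro mult_left_mono) auto
  also have "\<dots> = D * ?a powr p + (p - 1) * (\<bar>\<mu>\<bar> powr (p / (p - 1)) * D)"
    by (simp only: distrib_left mult_ac)
  finally have "D * (p * (?a * \<bar>\<mu>\<bar>)) \<le> D * ?a powr p + (p - 1) * (\<bar>\<mu>\<bar> powr (p / (p - 1)) * D)" .
  moreover have "D * (p * (?a * \<bar>\<mu>\<bar>)) = p * \<bar>\<mu> * I\<bar>" using D by (simp add: abs_mult)
  moreover have "p * (\<mu> * I) \<le> p * \<bar>\<mu> * I\<bar>" using p by (intro mult_left_mono) auto
  ultimately show "p * (\<mu> * I) - (p - 1) * (\<bar>\<mu>\<bar> powr (p / (p - 1)) * D) \<le> \<bar>I\<bar> powr p / D powr (p - 1)"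
    unfolding r by linarith
  show "\<exists>\<mu>. p * (\<mu> * I) - (p - 1) * (\<bar>\<mu>\<bar> powr (p / (p - 1)) * D) = \<bar>I\<bar> powr p / D powr (p - 1)"
  proof (intro exI)
    let ?m = "sgn I * ?a powr (p - 1)"
    show "p * (?m * I) - (p - 1) * (\<bar>?m\<bar> powr (p / (p - 1)) * D) = \<bar>I\<bar> powr p / D powr (p - 1)"
    proof (cases "I = 0")
      case True
      then show ?thesis using p by simp
    next
      case False
      have a: "0 < ?a" using False D by simp
      have m: "\<bar>?m\<bar> = ?a powr (p - 1)" using False by (simp add: abs_mult)
      have "\<bar>?m\<bar> powr (p / (p - 1)) = ?a powr p"
        unfolding m using p by (simp add: powr_powr)
      moreover have "?m * I = ?a powr p * D"
      proof -
        have "?m * I = ?a powr (p - 1) * \<bar>I\<bar>" by (simp add: abs_sgn mult_ac)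
        also have "\<dots> = ?a powr (p - 1) * (?a * D)" using D by (intro arg_cong[of _ _ "\<lambda>y. ?a powr (p - 1) * y"]) simp
        also have "\<dots> = (?a powr (p - 1) * ?a) * D" by (simp only: mult.assoc)
        also have "?a powr (p - 1) * ?a = ?a powr p" using a D by (simp add: powr_diff)
        finally show ?thesis .
      qed
      ultimately have "p * (?m * I) - (p - 1) * (\<bar>?m\<bar> powr (p / (p - 1)) * D) = p * (?a powr p * D) - (p - 1) * (?a powr p * D)"
        by (simp only:)
      also have "\<dots> = D * ?a powr p" 
      proof -
        have "p * (X * D) - (p - 1) * (X * D) = D * X" for X by (simp add: algebra_simps)
        then show ?thesis .
      qed
      finally show ?thesis unfolding r .
    qed
  qed
qed

text \<open>Integration detached from geometry: w stands for du(\<nabla>r), N for the larger of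
  F*(du)^p and F*(-du)^p, and \<open>E x k\<close> for the equality case at x with k in place of K.
  The conditions hold for all k outside one null set, so they serve K and all its multiples \<mu>
  K.\<close>

locale integrated_Young =
  fixes M :: "'x measure" and N w :: "'x \<Rightarrow> real" and E :: "'x \<Rightarrow> real \<Rightarrow> bool" and p :: real
  assumes p: "1 < p" and N_int: "integrable M N" and N_nonneg: "\<And>x. 0 \<le> N x"
    and le: "AE x in M. \<forall>k. p * (- k * w x) \<le> N x + (p - 1) * \<bar>k\<bar> powr (p / (p - 1))"
    and eq: "AE x in M. \<forall>k. p * (- k * w x) = N x + (p - 1) * \<bar>k\<bar> powr (p / (p - 1)) \<longleftrightarrow> E x k"
    and norm: "AE x in M. \<forall>k. E x k \<longrightarrow> N x = \<bar>k\<bar> powr (p / (p - 1))"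
    and abs: "AE x in M. \<forall>k. \<bar>k * w x\<bar> \<le> N x + (p - 1) * \<bar>k\<bar> powr (p / (p - 1))"
begin

context
  fixes K J :: "'x \<Rightarrow> real"
  assumes K: "K \<in> borel_measurable M" and J: "J \<in> borel_measurable M"
    and JK: "AE x in M. J x = - K x * w x"
begin

abbreviation "Kp \<equiv> \<lambda>x. \<bar>K x\<bar> powr (p / (p - 1))"

lemma J_integrable:
  assumes "integrable M Kp"
  shows "integrable M J"
proof (rule Bochner_Integration.integrable_bound)
  show "integrable M (\<lambda>x. N x + (p - 1) * Kp x)" using assms N_int by simp
  show "AE x in M. norm (J x) \<le> norm (N x + (p - 1) * Kp x)"
    using JK abs
  proof eventually_elim
    case (elim x)
    have "0 \<le> N x + (p - 1) * Kp x" using N_nonneg[of x] p by simp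
    then show ?case using elim(1) spec[OF elim(2), of "K x"] by simp
  qed
qed (rule J)

text \<open>The gap in the pointwise inequality is nonnegative and integrable, so its integral
  vanishes exactly when the gap vanishes almost everywhere.\<close>

lemma scaled:
  assumes Kp: "integrable M Kp"
  shows "p * (\<mu> * (\<integral>x. J x \<partial>M)) \<le> (\<integral>x. N x \<partial>M) + (p - 1) * (\<bar>\<mu>\<bar> powr (p / (p - 1)) * (\<integral>x. Kp x \<partial>M))"
    and "p * (\<mu> * (\<integral>x. J x \<partial>M)) = (\<integral>x. N x \<partial>M) + (p - 1) * (\<bar>\<mu>\<bar> powr (p / (p - 1)) * (\<integral>x. Kp x \<partial>M))
      \<longleftrightarrow> (AE x in M. E x (\<mu> * K x))"
proof -
  note Ji = J_integrable[OF Kp]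
  let ?c = "\<bar>\<mu>\<bar> powr (p / (p - 1))"
  let ?g = "\<lambda>x. N x + (p - 1) * (?c * Kp x) - p * (\<mu> * J x)"
  have pw: "\<bar>\<mu> * K x\<bar> powr (p / (p - 1)) = ?c * Kp x" for x by (simp add: abs_mult powr_mult)
  have gi: "integrable M ?g" using Kp Ji N_int by simp
  have g0: "AE x in M. 0 \<le> ?g x"
    using JK le
  proof eventually_elim
    case (elim x)
    then show ?case using spec[OF elim(2), of "\<mu> * K x"] pw[of x] by (simp add: mult_ac)
  qed
  have int: "(\<integral>x. ?g x \<partial>M) = (\<integral>x. N x \<partial>M) + (p - 1) * (?c * (\<integral>x. Kp x \<partial>M)) - p * (\<mu> * (\<integral>x. J x \<partial>M))"
    using Kp Ji N_int by simp
  have "0 \<le> (\<integral>x. ?g x \<partial>M)" by (rule integral_nonneg_AE[OF g0])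
  then show "p * (\<mu> * (\<integral>x. J x \<partial>M)) \<le> (\<integral>x. N x \<partial>M) + (p - 1) * (?c * (\<integral>x. Kp x \<partial>M))"
    unfolding int by simp
  have "(\<integral>x. ?g x \<partial>M) = 0 \<longleftrightarrow> (AE x in M. ?g x = 0)"
    by (rule integral_nonneg_eq_0_iff_AE[OF gi g0])
  also have "\<dots> \<longleftrightarrow> (AE x in M. E x (\<mu> * K x))"
  proof (rule eventually_cong)
    show "AE x in M. (?g x = 0) = E x (\<mu> * K x)"
      using JK eq
    proof eventually_elim
      case (elim x)
      have "?g x = 0 \<longleftrightarrow> p * (- (\<mu> * K x) * w x) = N x + (p - 1) * \<bar>\<mu> * K x\<bar> powr (p / (p - 1))"
        unfolding pw elim(1) by (auto simp: mult_ac)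
      then show ?case using spec[OF elim(2), of "\<mu> * K x"] by simp
    qed
  qed simp
  finally show "p * (\<mu> * (\<integral>x. J x \<partial>M)) = (\<integral>x. N x \<partial>M) + (p - 1) * (?c * (\<integral>x. Kp x \<partial>M))
      \<longleftrightarrow> (AE x in M. E x (\<mu> * K x))"
    unfolding int by auto
qed

lemma Kp_measurable: "Kp \<in> borel_measurable M"
  using K by measurable

lemma E_imp_norm:
  assumes "AE x in M. E x (\<mu> * K x)"
  shows "AE x in M. N x = \<bar>\<mu>\<bar> powr (p / (p - 1)) * Kp x"
  using assms norm
proof eventually_elim
  case (elim x)
  show ?case using spec[OF elim(2), of "\<mu> * K x"] elim(1) by (simp add: abs_mult powr_mult)
qed

text \<open>In the equality case |\<mu> K|^p' agrees almost everywhere with the integrable N. This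
  rules out equality when |K|^p' has a divergent integral.\<close>

lemma E_imp_integrable:
  assumes "AE x in M. E x (\<mu> * K x)" "\<mu> \<noteq> 0"
  shows "integrable M Kp"
proof -
  let ?c = "\<bar>\<mu>\<bar> powr (p / (p - 1))"
  have "AE x in M. Kp x = N x / ?c"
    using E_imp_norm[OF assms(1)] by eventually_elim (use assms(2) in simp)
  moreover have "integrable M (\<lambda>x. N x / ?c)" using N_int by simp
  ultimately show ?thesis
    using integrable_cong_AE[of Kp M "\<lambda>x. N x / ?c"] Kp_measurable N_int by simp
qed

text \<open>For k = 0 the pointwise equality reads N = 0. This settles the multiple 0 in the
  equality case of the quotient.\<close>

lemma E_zero_iff: "(AE x in M. E x 0) \<longleftrightarrow> (\<integral>x. N x \<partial>M) = 0"
proof -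
  have "(\<integral>x. N x \<partial>M) = 0 \<longleftrightarrow> (AE x in M. N x = 0)"
    using N_nonneg by (intro integral_nonneg_eq_0_iff_AE N_int) auto
  also have "\<dots> \<longleftrightarrow> (AE x in M. E x 0)"
  proof (rule eventually_cong)
    show "AE x in M. (N x = 0) = E x 0"
      using eq
    proof eventually_elim
      case (elim x)
      then show ?case using spec[OF elim, of 0] p by auto
    qed
  qed simp
  finally show ?thesis by simp
qed

text \<open>For integrable |K|^p' this is \<open>scaled\<close> with \<mu> = 1. Otherwise the
  right-hand side is minus infinity, and both sides of the equivalence are false.\<close>

theorem additive_inequality:
  defines "rhs \<equiv> ereal (p * (\<integral>x. J x \<partial>M)) - ereal (p - 1) * enn2ereal (\<integral>\<^sup>+x. ennreal (Kp x) \<partial>M)"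
  shows "rhs \<le> ereal (\<integral>x. N x \<partial>M)" and "ereal (\<integral>x. N x \<partial>M) = rhs \<longleftrightarrow> (AE x in M. E x (K x))"
proof -
  have "rhs \<le> ereal (\<integral>x. N x \<partial>M) \<and> (ereal (\<integral>x. N x \<partial>M) = rhs \<longleftrightarrow> (AE x in M. E x (K x)))"
  proof (cases "integrable M Kp")
    case True
    then have "(\<integral>\<^sup>+x. ennreal (Kp x) \<partial>M) = ennreal (\<integral>x. Kp x \<partial>M)"
      by (intro nn_integral_eq_integral) auto
    then have "rhs = ereal (p * (\<integral>x. J x \<partial>M) - (p - 1) * (\<integral>x. Kp x \<partial>M))"
      by (simp add: rhs_def enn2ereal_ennreal)
    then show ?thesis using scaled[OF True, of 1] by auto
  next
    case False
    then have "(\<integral>\<^sup>+x. ennreal (Kp x) \<partial>M) = \<infinity>"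
      using integrableI_nonneg[OF Kp_measurable] by (auto simp: less_top[symmetric])
    then have "rhs = -\<infinity>" using p by (simp add: rhs_def)
    moreover have "\<not> (AE x in M. E x (K x))" using E_imp_integrable[of 1] False by auto
    ultimately show ?thesis by simp
  qed
  then show "rhs \<le> ereal (\<integral>x. N x \<partial>M)" and "ereal (\<integral>x. N x \<partial>M) = rhs \<longleftrightarrow> (AE x in M. E x (K x))" by auto
qed

text \<open>The quotient is the maximum over \<open>\<mu>\<close> of the right-hand side of the additive inequality for
  \<open>\<mu>K\<close>.\<close>

theorem multiplicative_inequality:
  defines "rhs \<equiv> \<bar>\<integral>x. J x \<partial>M\<bar> powr p / (\<integral>x. Kp x \<partial>M) powr (p - 1)"
  shows "rhs \<le> (\<integral>x. N x \<partial>M)" and "(\<integral>x. N x \<partial>M) = rhs \<longleftrightarrow> (\<exists>\<mu>. AE x in M. E x (\<mu> * K x))"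
proof -
  let ?I = "\<integral>x. J x \<partial>M" and ?D = "\<integral>x. Kp x \<partial>M" and ?N = "\<integral>x. N x \<partial>M"
  have D0: "0 \<le> ?D" by simp
  have N0: "0 \<le> ?N" using N_nonneg by simp
  have "rhs \<le> ?N \<and> (?N = rhs \<longleftrightarrow> (\<exists>\<mu>. AE x in M. E x (\<mu> * K x)))"
  proof (cases "?D = 0")
    case True
    \<comment> \<open>?D = 0 arises from K = 0 almost everywhere as well as from a divergent
      integral. In both cases the quotient is 0, and N integrates to 0 as soon as some multiple is
      in the equality case; conversely \<mu> = 0 is the witness.\<close>
    have r0: "rhs = 0" using True by (simp add: rhs_def)
    have "?N = 0" if E: "AE x in M. E x (\<mu> * K x)" for \<mu>
    proof -
      have "?N = (\<integral>x. \<bar>\<mu>\<bar> powr (p / (p - 1)) * Kp x \<partial>M)"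
        using N_int Kp_measurable by (intro integral_cong_AE E_imp_norm[OF E]) auto
      then show ?thesis using True by simp
    qed
    moreover have "AE x in M. E x (0 * K x)" if "?N = 0" using E_zero_iff that by simp
    ultimately show ?thesis using r0 N0 by blast
  next
    case False
    then have Kp: "integrable M Kp" using not_integrable_integral_eq by blast
    have D: "0 < ?D" using order.not_eq_order_implies_strict[OF False[symmetric] D0] .
    note upper = quotient_maximum(1)[OF p D, of _ ?I, folded rhs_def]
    obtain \<mu>' where attained: "p * (\<mu>' * ?I) - (p - 1) * (\<bar>\<mu>'\<bar> powr (p / (p - 1)) * ?D) = rhs"
      using quotient_maximum(2)[OF p D, of ?I] unfolding rhs_def by blast
    have "rhs \<le> ?N" using scaled(1)[OF Kp, of \<mu>'] attained by linarith
    moreover have "AE x in M. E x (\<mu>' * K x)" if "?N = rhs"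
      using scaled(2)[OF Kp, of \<mu>'] attained that by linarith
    moreover have "?N = rhs" if "AE x in M. E x (\<mu> * K x)" for \<mu>
    proof -
      have "p * (\<mu> * ?I) = ?N + (p - 1) * (\<bar>\<mu>\<bar> powr (p / (p - 1)) * ?D)"
        using scaled(2)[OF Kp, of \<mu>] that by blast
      then show ?thesis using upper[of \<mu>] \<open>rhs \<le> ?N\<close> by linarith
    qed
    ultimately show ?thesis by blast
  qed
  then show "rhs \<le> ?N" and "?N = rhs \<longleftrightarrow> (\<exists>\<mu>. AE x in M. E x (\<mu> * K x))" by auto
qed

end

end

section \<open>Null sets of the smooth measure and integrability of the energy density\<close>

locale finsler_measure = finsler_space A F
  for A :: "('a::{second_countable_topology,t2_space}, 'n::finite) chart set" and F +
  fixes \<mm> :: "'a measure"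
  assumes meas: "smooth_measure A \<mm>"
begin

lemma sets_m [measurable_cong]: "sets \<mm> = sets borel"
  using meas by (simp add: smooth_measure_def)

lemma space_m [simp]: "space \<mm> = UNIV"
  using sets_eq_imp_space_eq[OF sets_m] by simp

lemma borel_measurable_m: "f \<in> borel_measurable borel \<Longrightarrow> f \<in> borel_measurable \<mm>"
  using measurable_cong_sets[OF sets_m refl] by blast

lemma density:
  assumes "c \<in> A"
  shows "\<exists>\<sigma>. continuous_on (snd c ` fst c) \<sigma> \<and>
    (\<forall>B\<in>sets borel. B \<subseteq> fst c \<longrightarrow> emeasure \<mm> B = (\<integral>\<^sup>+z\<in>snd c ` B. ennreal (\<sigma> z) \<partial>lborel))"
proof -
  obtain \<sigma> :: "real ^ 'n \<Rightarrow> real" where \<sigma>: "smooth_on (snd c ` fst c) \<sigma>"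
    "\<forall>B\<in>sets borel. B \<subseteq> fst c \<longrightarrow> emeasure \<mm> B = (\<integral>\<^sup>+z\<in>snd c ` B. ennreal (\<sigma> z) \<partial>lborel)"
    using meas assms unfolding smooth_measure_def by blast
  have "Ck_on 0 \<sigma> (snd c ` fst c)" using \<sigma>(1) unfolding smooth_on_def by blast
  then show ?thesis using \<sigma>(2) by auto
qed

text \<open>A negligible image is contained in a Borel null set, off which the integrand of the
  density formula is 0; measurability of the image itself does not enter.\<close>

lemma emeasure_eq_0_if_negligible_image:
  assumes c: "c \<in> A" and B: "B \<in> sets borel" "B \<subseteq> fst c" and N: "negligible (snd c ` B)"
  shows "emeasure \<mm> B = 0"
proof -
  obtain \<sigma> where \<sigma>: "emeasure \<mm> B = (\<integral>\<^sup>+z\<in>snd c ` B. ennreal (\<sigma> z) \<partial>lborel)"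
    using density[OF c] B by blast
  have "snd c ` B \<in> null_sets (completion lborel)" using N by (simp add: negligible_iff_null_sets)
  then have "\<exists>N'\<in>null_sets lborel. snd c ` B \<subseteq> N'" unfolding null_sets_completion_iff2 .
  then obtain N' where N': "N' \<in> null_sets lborel" "snd c ` B \<subseteq> N'" by (rule bexE)
  have "AE z in lborel. z \<notin> N'" by (rule AE_not_in[OF N'(1)])
  then have "AE z in lborel. ennreal (\<sigma> z) * indicator (snd c ` B) z = 0"
  proof eventually_elim
    case (elim z)
    then have "z \<notin> snd c ` B" using N'(2) by blast
    then show ?case by simp
  qed
  then have "(\<integral>\<^sup>+z\<in>snd c ` B. ennreal (\<sigma> z) \<partial>lborel) = (\<integral>\<^sup>+z. 0 \<partial>(lborel :: (real ^ 'n) measure))"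
    by (rule nn_integral_cong_AE)
  then show ?thesis using \<sigma> by simp
qed

lemma AE_locally:
  assumes "\<And>c z \<rho>. is_coord_ball c z \<rho> \<Longrightarrow> AE x in \<mm>. x \<in> coord_ball c z \<rho> \<longrightarrow> P x"
  shows "AE x in \<mm>. P x"
proof -
  obtain \<C> where \<C>: "countable \<C>" "\<forall>W\<in>\<C>. \<exists>c z \<rho>. is_coord_ball c z \<rho> \<and> W = coord_ball c z \<rho>" "\<Union>\<C> = UNIV"
    using countable_coord_balls by blast
  have "AE x in \<mm>. x \<in> W \<longrightarrow> P x" if "W \<in> \<C>" for W
    using bspec[OF \<C>(2) that] assms by blast
  then have "AE x in \<mm>. \<forall>W\<in>\<C>. x \<in> W \<longrightarrow> P x" unfolding AE_ball_countable[OF \<C>(1)] by blast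
  then show ?thesis
  proof eventually_elim
    case (elim x)
    have "x \<in> \<Union>\<C>" using \<C>(3) by simp
    then show ?case using elim by blast
  qed
qed

text \<open>Rademacher's theorem for the globally Lipschitz extension in each coordinate ball; the
  exceptional set is Borel, so the density formula carries its negligibility over to the
  manifold.\<close>

lemma AE_diff_at_finsler_dist: "AE x in \<mm>. diff_at (finsler_dist A F o') x"
proof (rule AE_locally)
  fix c z \<rho> assume B: "is_coord_ball c z \<rho>"
  then have c: "c \<in> A" by (simp add: is_coord_ball_def)
  let ?N = "coord_ball c z \<rho> \<inter> - {x. diff_at (finsler_dist A F o') x}"
  let ?f = "in_coords c z \<rho> (finsler_dist A F o')"
  have Nb: "?N \<in> sets borel"
    by (intro sets.Int borel_open[OF open_coord_ball[OF B]] borel_comp borel_diff_at_finsler_dist)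
  obtain M where "M-lipschitz_on UNIV ?f" using in_coords_Lipschitz[OF B] by blast
  then have "negligible {y. \<not> ?f differentiable (at y)}" by (rule Rademacher)
  moreover have "snd c ` ?N \<subseteq> {y. \<not> ?f differentiable (at y)}"
    using diff_at_in_coords[OF B] by blast
  ultimately have "negligible (snd c ` ?N)" by (rule negligible_subset)
  then have "emeasure \<mm> ?N = 0"
    by (intro emeasure_eq_0_if_negligible_image[OF c Nb]) (auto simp: coord_ball_def)
  then have "?N \<in> null_sets \<mm>" using Nb sets_m by (intro null_setsI) auto
  then show "AE x in \<mm>. x \<in> coord_ball c z \<rho> \<longrightarrow> diff_at (finsler_dist A F o') x"
    by (rule AE_I') auto
qed

lemma AE_neq: "AE x in \<mm>. x \<noteq> o'"
proof -
  obtain c where c: "c \<in> A" "o' \<in> fst c" using ex_chart by blast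
  have "emeasure \<mm> {o'} = 0"
    using c by (intro emeasure_eq_0_if_negligible_image[OF c(1)]) auto
  then have "{o'} \<in> null_sets \<mm>" using sets_m by (intro null_setsI) auto
  then show ?thesis by (rule AE_I') auto
qed

text \<open>The density is continuous on the chart image, hence bounded on the compact closed
  ball.\<close>

lemma coord_ball_finite:
  assumes B: "is_coord_ball c z \<rho>"
  shows "emeasure \<mm> (coord_ball c z \<rho>) < \<infinity>"
proof -
  have c: "c \<in> A" and \<rho>: "0 < \<rho>" "cball z \<rho> \<subseteq> snd c ` fst c" using B by (auto simp: is_coord_ball_def)
  obtain \<sigma> where \<sigma>: "continuous_on (snd c ` fst c) \<sigma>" "emeasure \<mm> (coord_ball c z \<rho>) =
      (\<integral>\<^sup>+z\<in>snd c ` coord_ball c z \<rho>. ennreal (\<sigma> z) \<partial>lborel)"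
    using density[OF c] borel_open[OF open_coord_ball[OF B]] by (metis Int_lower1 coord_ball_def)
  have "compact (\<sigma> ` cball z \<rho>)"
    by (intro compact_continuous_image compact_cball continuous_on_subset[OF \<sigma>(1) \<rho>(2)])
  then obtain b where b: "\<And>y. y \<in> cball z \<rho> \<Longrightarrow> \<sigma> y \<le> b"
    using compact_imp_bounded bounded_real by (metis abs_le_D1 imageI)
  have "emeasure \<mm> (coord_ball c z \<rho>) \<le> (\<integral>\<^sup>+y. ennreal b * indicator (cball z \<rho>) y \<partial>lborel)"
    unfolding \<sigma>(2)
  proof (rule nn_integral_mono)
    fix y
    show "ennreal (\<sigma> y) * indicator (snd c ` coord_ball c z \<rho>) y \<le> ennreal b * indicator (cball z \<rho>) y"
      using b[of y] by (auto simp: indicator_def coord_ball_def ennreal_leI)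
  qed
  also have "\<dots> = ennreal b * emeasure lborel (cball z \<rho>)" by (rule nn_integral_cmult_indicator) simp
  also have "\<dots> < \<infinity>" using emeasure_lborel_cball_finite[of z \<rho>] by (simp add: ennreal_mult_less_top)
  finally show ?thesis .
qed

text \<open>If G bounds the coordinate differential of u and m norm w bounds L from below on the
  closed ball, then both dual norms are at most G / m.\<close>

lemma coord_ball_max_dual_bounded:
  assumes B: "is_coord_ball c z \<rho>" and u: "smooth_fun u" and p: "0 \<le> p"
  shows "\<exists>b. \<forall>x\<in>coord_ball c z \<rho>. max_dual_powr A F p u x \<le> b"
proof -
  have c: "c \<in> A" and \<rho>: "0 < \<rho>" "cball z \<rho> \<subseteq> snd c ` fst c" using B by (auto simp: is_coord_ball_def)
  obtain m M where m: "0 < m" and bd: "\<forall>y\<in>cball z \<rho>. \<forall>w. m * norm w \<le> L c (y, w) \<and> L c (y, w) \<le> M * norm w"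
    using local_metric_bounds[OF c compact_cball \<rho>(2)] by blast
  have "compact (grad_in c u ` cball z \<rho>)"
    by (intro compact_continuous_image compact_cball continuous_on_subset[OF smooth_fun_continuous_grad[OF u c] \<rho>(2)])
  then have "bounded (grad_in c u ` cball z \<rho>)" by (rule compact_imp_bounded)
  then obtain G where "\<forall>v\<in>grad_in c u ` cball z \<rho>. norm v \<le> G" unfolding bounded_iff by (rule exE)
  then have G: "norm (grad_in c u y) \<le> G" if "y \<in> cball z \<rho>" for y using that by blast
  have d: "dual_in c y a \<le> G / m" if y: "y \<in> cball z \<rho>" "norm a \<le> G" for y a
  proof -
    interpret minkowski_norm "\<lambda>w. L c (y, w)" using minkowski_local c y \<rho>(2) by blast
    show ?thesis
      unfolding dual_in_def
    proof (rule dual_le)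
      fix w
      have "a \<bullet> w \<le> norm a * norm w" by (rule norm_cauchy_schwarz)
      also have "\<dots> \<le> G * (L c (y, w) / m)"
        using y bd m order_trans[OF norm_ge_zero y(2)] by (intro mult_mono) (auto simp: field_simps)
      finally show "a \<bullet> w \<le> G / m * L c (y, w)" by simp
    qed
  qed
  have "max_dual_powr A F p u x \<le> (G / m) powr p" if x: "x \<in> coord_ball c z \<rho>" for x
  proof -
    have xc: "x \<in> fst c" "snd c x \<in> cball z \<rho>" using x by (auto simp: coord_ball_def)
    interpret minkowski_norm "\<lambda>w. L c (snd c x, w)" using minkowski_local c xc(1) by blast
    have "0 \<le> dual_in c (snd c x) a" for a unfolding dual_in_def by (rule dual_nonneg)
    then show ?thesis
      unfolding max_dual_powr_def dual_metric_differential[OF c xc(1) smooth_fun_diff_at[OF u]]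
      using d[OF xc(2)] G[OF xc(2)] p by (auto intro!: powr_mono2)
  qed
  then show ?thesis by blast
qed

lemma max_dual_powr_zero:
  assumes u: "smooth_fun u" and p: "p \<noteq> 0" and x: "x \<notin> closure {x. u x \<noteq> 0}"
  shows "max_dual_powr A F p u x = 0"
proof -
  obtain c where c: "c \<in> A" "x \<in> fst c" using ex_chart by blast
  interpret minkowski_norm "\<lambda>w. L c (snd c x, w)" using minkowski_local c by blast
  let ?W = "snd c ` fst c \<inter> chart_inv c -` (- closure {x. u x \<noteq> 0})"
  have "open ?W" by (rule open_chart_inv_preimage[OF c(1)]) auto
  moreover have "snd c x \<in> ?W" using c x by simp
  moreover have "0 = (u \<circ> chart_inv c) y" if "y \<in> ?W" for y
    using that closure_subset[of "{x. u x \<noteq> 0}"] by auto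
  ultimately have "((u \<circ> chart_inv c) has_derivative (\<lambda>w. 0)) (at (snd c x))"
    by (rule has_derivative_transform_within_open[OF has_derivative_const])
  then have "grad_in c u (snd c x) = 0" by (intro grad_in_unique) simp
  then show ?thesis
    unfolding max_dual_powr_def dual_metric_differential[OF c smooth_fun_diff_at[OF u]]
    using p dual_zero by (simp add: dual_in_def)
qed

lemma max_dual_powr_nonneg: "0 \<le> max_dual_powr A F p u x"
  by (simp add: max_dual_powr_def max_def)

text \<open>Finitely many coordinate balls cover the support; on each of them the measure is finite
  and the integrand bounded, and outside their union the integrand is 0.\<close>

lemma max_dual_powr_integrable:
  assumes u: "smooth_fun u" and cpt: "compact (closure {x. u x \<noteq> 0})" and p: "0 < p"
  shows "integrable \<mm> (max_dual_powr A F p u)"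
proof -
  let ?K = "closure {x. u x \<noteq> 0}"
  define \<F> where "\<F> = {W. \<exists>c z \<rho>. is_coord_ball c z \<rho> \<and> W = coord_ball c z \<rho>}"
  have op: "open W" if "W \<in> \<F>" for W using that open_coord_ball unfolding \<F>_def by blast
  have sub: "?K \<subseteq> \<Union>\<F>"
  proof
    fix x
    show "x \<in> \<Union>\<F>" using ex_coord_ball[of x] unfolding \<F>_def by blast
  qed
  obtain \<D> where \<D>: "\<D> \<subseteq> \<F>" "finite \<D>" "?K \<subseteq> \<Union>\<D>"
    using compactE[OF cpt sub op] by metis
  have ball: "open W \<and> emeasure \<mm> W < \<infinity> \<and> (\<exists>b. \<forall>x\<in>W. max_dual_powr A F p u x \<le> b)" if W: "W \<in> \<D>" for W
  proof -
    obtain c z \<rho> where B: "is_coord_ball c z \<rho>" "W = coord_ball c z \<rho>" using W \<D>(1) unfolding \<F>_def by blast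
    then show ?thesis
      using open_coord_ball[OF B(1)] coord_ball_finite[OF B(1)] coord_ball_max_dual_bounded[OF B(1) u] p by auto
  qed
  then have "\<forall>W\<in>\<D>. \<exists>b. \<forall>x\<in>W. max_dual_powr A F p u x \<le> b" by blast
  then obtain b where b: "\<forall>W\<in>\<D>. \<forall>x\<in>W. max_dual_powr A F p u x \<le> b W" by (rule bchoice[THEN exE])
  have fin: "emeasure \<mm> (\<Union>\<D>) < \<infinity>"
  proof -
    have "emeasure \<mm> (\<Union>W\<in>\<D>. W) \<le> (\<Sum>W\<in>\<D>. emeasure \<mm> W)"
      using ball \<D>(2) sets_m by (intro emeasure_subadditive_finite) auto
    also have "\<dots> < \<infinity>" using ball \<D>(2) by (simp add: ennreal_sum_less_top)
    finally show ?thesis by simp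
  qed
  have D_sets: "\<Union>\<D> \<in> sets \<mm>" using ball sets_m by (simp add: open_Union borel_open)
  show ?thesis
  proof (rule integrableI_bounded_set[OF D_sets _ fin, of _ "\<Sum>W\<in>\<D>. \<bar>b W\<bar>"])
    show "max_dual_powr A F p u \<in> borel_measurable \<mm>" by (rule borel_measurable_m[OF borel_max_dual_powr[OF u]])
    show "AE x in \<mm>. x \<in> \<Union>\<D> \<longrightarrow> norm (max_dual_powr A F p u x) \<le> (\<Sum>W\<in>\<D>. \<bar>b W\<bar>)"
    proof (intro AE_I2 impI)
      fix x assume "x \<in> \<Union>\<D>"
      then obtain W where W: "W \<in> \<D>" "x \<in> W" by blast
      then have "max_dual_powr A F p u x \<le> \<bar>b W\<bar>" using b by fastforce
      also have "\<dots> \<le> (\<Sum>W\<in>\<D>. \<bar>b W\<bar>)" using W \<D>(2) by (intro member_le_sum) auto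
      finally show "norm (max_dual_powr A F p u x) \<le> (\<Sum>W\<in>\<D>. \<bar>b W\<bar>)" using max_dual_powr_nonneg by simp
    qed
    show "AE x in \<mm>. x \<notin> \<Union>\<D> \<longrightarrow> max_dual_powr A F p u x = 0"
    proof (intro AE_I2 impI)
      fix x assume "x \<notin> \<Union>\<D>"
      then have "x \<notin> ?K" using \<D>(3) by blast
      then show "max_dual_powr A F p u x = 0" by (intro max_dual_powr_zero[OF u]) (use p in auto)
    qed
  qed
qed

end

context finsler_measure
begin

section \<open>Young's inequality on the manifold and the weak integrand\<close>

definition equality_at :: "real \<Rightarrow> ('a \<Rightarrow> real) \<Rightarrow> ('a \<Rightarrow> real) \<Rightarrow> 'a \<Rightarrow> real \<Rightarrow> bool" where
  "equality_at p r u x k \<longleftrightarrow>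
     (\<forall>v\<in>tangent_space A x.
        differential A u x v = - sgn k * \<bar>k\<bar> powr (1 / (p - 1)) * differential A r x v) \<and>
     ((\<exists>v\<in>tangent_space A x. differential A u x v \<noteq> 0) \<longrightarrow>
        max (dual_metric A F x (differential A r x))
            (dual_metric A F x (\<lambda>v. - differential A r x v))
          = dual_metric A F x (differential A r x))"

text \<open>\<open>Finsler_Young\<close> in a chart, where a, b and v are the coordinates of du, dr
  and \<nabla>r. The condition on all tangent vectors becomes an equation between coordinate
  covectors, because every coordinate vector comes from a tangent vector.\<close>

lemma pointwise_Young:
  assumes u: "diff_at u x" and r: "diff_at r x" and unit: "dual_metric A F x (differential A r x) = 1"
    and p: "1 < p"
  defines "N \<equiv> max_dual_powr A F p u x" and "w \<equiv> differential A u x (finsler_gradient A F r x)"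
  shows "p * (- k * w) \<le> N + (p - 1) * \<bar>k\<bar> powr (p / (p - 1))"
    and "p * (- k * w) = N + (p - 1) * \<bar>k\<bar> powr (p / (p - 1)) \<longleftrightarrow> equality_at p r u x k"
    and "equality_at p r u x k \<Longrightarrow> N = \<bar>k\<bar> powr (p / (p - 1))"
    and "\<bar>k * w\<bar> \<le> N + (p - 1) * \<bar>k\<bar> powr (p / (p - 1))"
proof -
  obtain c where c: "c \<in> A" "x \<in> fst c" using ex_chart by blast
  interpret minkowski_norm "\<lambda>w. L c (snd c x, w)" using minkowski_local c by blast
  let ?a = "grad_in c u (snd c x)" and ?b = "grad_in c r (snd c x)" and ?v = "finsler_gradient A F r x c"
  note v = gradient_unit[OF c r unit]
  have w: "w = ?a \<bullet> ?v" unfolding w_def by (rule differential_eq[OF c v(1) u])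
  have N: "N = max (dual ?a powr p) (dual (- ?a) powr p)"
    unfolding N_def max_dual_powr_def dual_metric_differential[OF c u] dual_in_def ..
  have b: "dual ?b = 1" using unit dual_metric_differential(1)[OF c r] by (simp add: dual_in_def)
  have all_iff: "(\<forall>v\<in>tangent_space A x. differential A u x v = \<kappa> * differential A r x v) \<longleftrightarrow> ?a = \<kappa> *\<^sub>R ?b" for \<kappa>
  proof
    assume *: "\<forall>v\<in>tangent_space A x. differential A u x v = \<kappa> * differential A r x v"
    have "?a \<bullet> y = (\<kappa> *\<^sub>R ?b) \<bullet> y" for y
    proof -
      have t: "coord_tvec A c x y \<in> tangent_space A x" by (rule coord_tvec_in_tangent_space[OF c])
      show ?thesis
        using bspec[OF * t] differential_eq[OF c t u] differential_eq[OF c t r] c by simp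
    qed
    then show "?a = \<kappa> *\<^sub>R ?b" using vector_eq_rdot[of ?a "\<kappa> *\<^sub>R ?b"] by blast
  next
    assume "?a = \<kappa> *\<^sub>R ?b"
    then show "\<forall>v\<in>tangent_space A x. differential A u x v = \<kappa> * differential A r x v"
      using differential_eq[OF c _ u] differential_eq[OF c _ r] by simp
  qed
  have ex_iff: "(\<exists>v\<in>tangent_space A x. differential A u x v \<noteq> 0) \<longleftrightarrow> ?a \<noteq> 0"
    using all_iff[of 0] by auto
  have E: "equality_at p r u x k \<longleftrightarrow> ?a = (- sgn k * \<bar>k\<bar> powr (1 / (p - 1))) *\<^sub>R ?b \<and>
      (?a \<noteq> 0 \<longrightarrow> max (dual ?b) (dual (- ?b)) = dual ?b)"
    unfolding equality_at_def all_iff ex_iff dual_metric_differential[OF c r] dual_in_def ..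
  show "p * (- k * w) \<le> N + (p - 1) * \<bar>k\<bar> powr (p / (p - 1))"
    and "p * (- k * w) = N + (p - 1) * \<bar>k\<bar> powr (p / (p - 1)) \<longleftrightarrow> equality_at p r u x k"
    and "equality_at p r u x k \<Longrightarrow> N = \<bar>k\<bar> powr (p / (p - 1))"
    and "\<bar>k * w\<bar> \<le> N + (p - 1) * \<bar>k\<bar> powr (p / (p - 1))"
    unfolding E w N
    using Finsler_Young_le[OF p b v(2,3), of k ?a] Finsler_Young_eq[OF p b v(2,3), of k ?a]
      Finsler_Young_norm[OF p b v(2,3), of ?a k] Finsler_Young_abs[OF p b v(2,3), of k ?a]
    by blast+
qed

text \<open>Product and chain rule together with dr(\<nabla>r) = 1, which cancels G'(r) H(u) inside
  the integrand, before any question of its integrability arises.\<close>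

lemma weak_integrand:
  assumes u: "diff_at u x" and r: "diff_at r x" and unit: "dual_metric A F x (differential A r x) = 1"
    and G: "G differentiable (at (r x))" and H: "H differentiable (at (u x))"
  shows "deriv G (r x) * H (u x) - differential A (\<lambda>x. G (r x) * H (u x)) x (finsler_gradient A F r x) =
    - (G (r x) * deriv H (u x)) * differential A u x (finsler_gradient A F r x)"
proof -
  obtain c where c: "c \<in> A" "x \<in> fst c" using ex_chart by blast
  let ?a = "grad_in c u (snd c x)" and ?b = "grad_in c r (snd c x)" and ?v = "finsler_gradient A F r x"
  note v = gradient_unit[OF c r unit]
  have DG: "(G has_derivative (\<lambda>t. deriv G (r x) * t)) (at ((r \<circ> chart_inv c) (snd c x)))"
    using G c unfolding DERIV_deriv_iff_real_differentiable[symmetric] has_field_derivative_def by simp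
  have DH: "(H has_derivative (\<lambda>t. deriv H (u x) * t)) (at ((u \<circ> chart_inv c) (snd c x)))"
    using H c unfolding DERIV_deriv_iff_real_differentiable[symmetric] has_field_derivative_def by simp
  have Dr: "((r \<circ> chart_inv c) has_derivative (\<lambda>y. ?b \<bullet> y)) (at (snd c x))"
    using r diff_at_iff[OF c] by (intro grad_in_has_derivative) simp
  have Du: "((u \<circ> chart_inv c) has_derivative (\<lambda>y. ?a \<bullet> y)) (at (snd c x))"
    using u diff_at_iff[OF c] by (intro grad_in_has_derivative) simp
  have "((\<lambda>y. (G \<circ> (r \<circ> chart_inv c)) y * (H \<circ> (u \<circ> chart_inv c)) y) has_derivative
      (\<lambda>y. (G \<circ> (r \<circ> chart_inv c)) (snd c x) * ((\<lambda>t. deriv H (u x) * t) \<circ> (\<lambda>y. ?a \<bullet> y)) y +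
        ((\<lambda>t. deriv G (r x) * t) \<circ> (\<lambda>y. ?b \<bullet> y)) y * (H \<circ> (u \<circ> chart_inv c)) (snd c x))) (at (snd c x))"
    by (intro has_derivative_mult diff_chain_at Dr Du DG DH)
  moreover have "(\<lambda>y. (G \<circ> (r \<circ> chart_inv c)) (snd c x) * ((\<lambda>t. deriv H (u x) * t) \<circ> (\<lambda>y. ?a \<bullet> y)) y +
        ((\<lambda>t. deriv G (r x) * t) \<circ> (\<lambda>y. ?b \<bullet> y)) y * (H \<circ> (u \<circ> chart_inv c)) (snd c x)) =
      (\<lambda>y. ((G (r x) * deriv H (u x)) *\<^sub>R ?a + (deriv G (r x) * H (u x)) *\<^sub>R ?b) \<bullet> y)"
    using c by (simp add: fun_eq_iff inner_add_left)
  moreover have "(\<lambda>y. (G \<circ> (r \<circ> chart_inv c)) y * (H \<circ> (u \<circ> chart_inv c)) y) = (\<lambda>x. G (r x) * H (u x)) \<circ> chart_inv c"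
    by (simp add: fun_eq_iff)
  ultimately have D: "((\<lambda>x. G (r x) * H (u x)) \<circ> chart_inv c has_derivative
      (\<lambda>y. ((G (r x) * deriv H (u x)) *\<^sub>R ?a + (deriv G (r x) * H (u x)) *\<^sub>R ?b) \<bullet> y)) (at (snd c x))"
    by simp
  then have "diff_at (\<lambda>x. G (r x) * H (u x)) x" unfolding diff_at_iff[OF c] differentiable_def by blast
  then have "differential A (\<lambda>x. G (r x) * H (u x)) x ?v = grad_in c (\<lambda>x. G (r x) * H (u x)) (snd c x) \<bullet> ?v c"
    by (rule differential_eq[OF c v(1)])
  also have "grad_in c (\<lambda>x. G (r x) * H (u x)) (snd c x) =
      (G (r x) * deriv H (u x)) *\<^sub>R ?a + (deriv G (r x) * H (u x)) *\<^sub>R ?b"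
    by (rule grad_in_unique[OF D])
  finally show ?thesis using v(3) differential_eq[OF c v(1) u] by (simp add: inner_add_left)
qed

text \<open>Continuity of g is available only between 0 and R. The other possible values of r are 0
  and, if it is attained, R; on these level sets the composition is constant, whatever g is
  there.\<close>

lemma borel_level_function:
  fixes r g :: "_ \<Rightarrow> real"
  assumes r: "continuous_on UNIV r" and bounds: "\<And>x. 0 \<le> r x" "\<And>x. ereal (r x) \<le> R"
    and g: "continuous_on {t. 0 < t \<and> ereal t < R} g"
  shows "(\<lambda>x :: 'a. g (r x)) \<in> borel_measurable borel"
proof -
  let ?B = "{x. 0 < r x \<and> ereal (r x) < R}"
  have B: "open ?B"
    using r by (intro open_Collect_conj open_Collect_less continuous_intros continuous_on_ereal) auto
  have rm: "r \<in> borel_measurable borel" by (rule borel_measurable_continuous_onI[OF r])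
  have "continuous_on ?B (\<lambda>x. g (r x))"
    by (rule continuous_on_compose2[OF g continuous_on_subset[OF r]]) auto
  then have 1: "(\<lambda>x. indicator ?B x *\<^sub>R g (r x)) \<in> borel_measurable borel"
    by (rule borel_measurable_continuous_on_indicator[OF borel_open[OF B]])
  have 2: "(\<lambda>x. if r x = 0 then g 0 else g (real_of_ereal R)) \<in> borel_measurable borel"
    using rm by measurable
  have 3: "{x \<in> space borel. x \<in> ?B} \<in> sets borel" using borel_open[OF B] by simp
  have "(\<lambda>x. if x \<in> ?B then indicator ?B x *\<^sub>R g (r x) else if r x = 0 then g 0 else g (real_of_ereal R))
      \<in> borel_measurable borel" by (rule measurable_If[OF 1 2 3])
  also have "(\<lambda>x. if x \<in> ?B then indicator ?B x *\<^sub>R g (r x) else if r x = 0 then g 0 else g (real_of_ereal R)) =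
      (\<lambda>x. g (r x))"
  proof
    fix x
    have "r x = real_of_ereal R" if "x \<notin> ?B" "r x \<noteq> 0"
    proof -
      have "ereal (r x) = R" using that bounds[of x] by (simp add: less_le)
      then show ?thesis by (metis real_of_ereal.simps(1))
    qed
    then show "(if x \<in> ?B then indicator ?B x *\<^sub>R g (r x) else if r x = 0 then g 0 else g (real_of_ereal R)) = g (r x)"
      by (cases "x \<in> ?B"; cases "r x = 0") simp_all
  qed
  finally show ?thesis .
qed

text \<open>E consists of the points other than the pole at which r is differentiable. It is Borel
  and of full measure, the eikonal equation holds on it, and the pointwise statements are proved
  there.\<close>

lemma distance_Young:
  fixes pole :: 'a and u :: "'a \<Rightarrow> real" and G H :: "real \<Rightarrow> real" and p :: real and R :: ereal
  defines "r \<equiv> finsler_dist A F pole"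
  defines "w \<equiv> \<lambda>x. differential A u x (finsler_gradient A F r x)"
  defines "K \<equiv> \<lambda>x. G (r x) * deriv H (u x)"
  defines "J \<equiv> \<lambda>x. deriv G (r x) * H (u x) -
    differential A (\<lambda>x. G (r x) * H (u x)) x (finsler_gradient A F r x)"
  assumes R: "R = (SUP x\<in>UNIV - {pole}. ereal (r x))" and p: "1 < p"
    and G: "C1_fun_on {t. 0 < t \<and> ereal t < R} G" and H: "C1_fun_on UNIV H"
    and u: "compactly_supported_smooth A u"
  shows "integrated_Young \<mm> (max_dual_powr A F p u) w (equality_at p r u) p"
    and "K \<in> borel_measurable \<mm>" "J \<in> borel_measurable \<mm>" "AE x in \<mm>. J x = - K x * w x"
proof -
  have u': "smooth_fun u" and cpt: "compact (closure {x. u x \<noteq> 0})"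
    using u by (auto simp: compactly_supported_smooth_def smooth_fun_def)
  define E where "E = {x. diff_at r x} - {pole}"
  have E: "diff_at r x" "x \<noteq> pole" if "x \<in> E" for x using that by (auto simp: E_def)
  have E_borel: "E \<in> sets borel"
    unfolding E_def r_def using borel_diff_at_finsler_dist by (intro sets.Diff) auto
  have AE_E: "AE x in \<mm>. x \<in> E"
    using AE_diff_at_finsler_dist[of pole] AE_neq[of pole] unfolding E_def r_def by eventually_elim simp
  have unit: "dual_metric A F x (differential A r x) = 1" if "x \<in> E" for x
    unfolding r_def by (rule eikonal) (use E[OF that] in \<open>auto simp: r_def\<close>)
  have r_cont: "continuous_on UNIV r" unfolding r_def by (rule continuous_finsler_dist)
  have r0: "0 \<le> r x" for x unfolding r_def by (rule finsler_dist_nonneg)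
  have rR: "ereal (r x) \<le> R" if "x \<noteq> pole" for x
    unfolding R using that by (intro SUP_upper) auto
  \<comment> \<open>A point of E is no extremum of r, so there are points at smaller and at larger
    distance; the latter is not the pole and hence counts in the supremum R.\<close>
  have in_range: "0 < r x \<and> ereal (r x) < R" if x: "x \<in> E" for x
  proof -
    obtain y y' where y: "r y < r x" "r x < r y'"
      using eikonal_not_extremum[OF E(1)[OF x] unit[OF x]] by blast
    have "y' \<noteq> pole" using y(2) r0[of x] finsler_dist_self by (auto simp: r_def)
    then have "ereal (r x) < R" using less_le_trans[OF _ rR] y(2) by simp
    then show ?thesis using y(1) r0[of y] by simp
  qed
  show Y: "integrated_Young \<mm> (max_dual_powr A F p u) w (equality_at p r u) p"
  proof (rule integrated_Young.intro)
    show "integrable \<mm> (max_dual_powr A F p u)" using p by (intro max_dual_powr_integrable[OF u' cpt]) simp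
  next
    show "AE x in \<mm>. \<forall>k. p * (- k * w x) \<le> max_dual_powr A F p u x + (p - 1) * \<bar>k\<bar> powr (p / (p - 1))"
      using AE_E unfolding w_def
      by eventually_elim (intro allI pointwise_Young(1)[OF smooth_fun_diff_at[OF u'] E(1) unit p])
    show "AE x in \<mm>. \<forall>k. p * (- k * w x) = max_dual_powr A F p u x + (p - 1) * \<bar>k\<bar> powr (p / (p - 1)) \<longleftrightarrow>
        equality_at p r u x k"
      using AE_E unfolding w_def
      by eventually_elim (intro allI pointwise_Young(2)[OF smooth_fun_diff_at[OF u'] E(1) unit p])
    show "AE x in \<mm>. \<forall>k. equality_at p r u x k \<longrightarrow> max_dual_powr A F p u x = \<bar>k\<bar> powr (p / (p - 1))"
      using AE_E
      by eventually_elim (intro allI impI pointwise_Young(3)[OF smooth_fun_diff_at[OF u'] E(1) unit p])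
    show "AE x in \<mm>. \<forall>k. \<bar>k * w x\<bar> \<le> max_dual_powr A F p u x + (p - 1) * \<bar>k\<bar> powr (p / (p - 1))"
      using AE_E unfolding w_def
      by eventually_elim (intro allI pointwise_Young(4)[OF smooth_fun_diff_at[OF u'] E(1) unit p])
  qed (use p max_dual_powr_nonneg in auto)
  have JE: "J x = - K x * w x" if x: "x \<in> E" for x
  proof -
    have "G differentiable (at (r x))" "H differentiable (at (u x))"
      using G H in_range[OF x] by (auto simp: C1_fun_on_def)
    then show ?thesis
      unfolding J_def K_def w_def by (rule weak_integrand[OF smooth_fun_diff_at[OF u'] E(1)[OF x] unit[OF x]])
  qed
  show "AE x in \<mm>. J x = - K x * w x" using AE_E by eventually_elim (rule JE)
  \<comment> \<open>Serves to include the pole in r \<le> R. A second point is found by a coordinate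
    step away from the pole, so the supremum is not over the empty set, where it would be minus
    infinity.\<close>
  have R0: "0 \<le> R"
  proof -
    obtain c where c: "c \<in> A" "pole \<in> fst c" using ex_chart by blast
    obtain \<rho> where \<rho>: "0 < \<rho>" "cball (snd c pole) \<rho> \<subseteq> snd c ` fst c" using chart_cball[OF c] by blast
    obtain b :: "real ^ 'n" where b: "b \<in> Basis" using nonempty_Basis by blast
    let ?z = "snd c pole + \<rho> *\<^sub>R b"
    have z: "?z \<in> snd c ` fst c" using \<rho> b by (intro subsetD[OF \<rho>(2)]) (simp add: dist_norm)
    have "?z \<noteq> snd c pole" using \<rho>(1) b nonzero_Basis by auto
    then have "chart_inv c ?z \<noteq> pole" using chart_chart_inv[OF c(1) z] by metis
    then have "ereal (r (chart_inv c ?z)) \<le> R" by (rule rR)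
    moreover have "0 \<le> ereal (r (chart_inv c ?z))" using r0 by simp
    ultimately show ?thesis by (rule order_trans[rotated])
  qed
  have rR': "ereal (r x) \<le> R" for x
    using rR[of x] R0 finsler_dist_self by (cases "x = pole") (auto simp: r_def zero_ereal_def)
  have Gr: "(\<lambda>x. G (r x)) \<in> borel_measurable borel"
    using G differentiable_imp_continuous_within
    by (intro borel_level_function[OF r_cont r0 rR'] continuous_at_imp_continuous_on) (auto simp: C1_fun_on_def)
  have dGr: "(\<lambda>x. deriv G (r x)) \<in> borel_measurable borel"
    using G by (intro borel_level_function[OF r_cont r0 rR']) (auto simp: C1_fun_on_def)
  have Hc: "continuous_on UNIV H" "continuous_on UNIV (deriv H)"
    using H differentiable_imp_continuous_within[of H]
    by (auto simp: C1_fun_on_def intro!: continuous_at_imp_continuous_on)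
  have uc: "continuous_on UNIV u" by (rule smooth_fun_continuous[OF u'])
  have Hu: "(\<lambda>x. H (u x)) \<in> borel_measurable borel" "(\<lambda>x. deriv H (u x)) \<in> borel_measurable borel"
    by (auto intro!: borel_measurable_continuous_onI continuous_on_compose2[OF Hc(1) uc] continuous_on_compose2[OF Hc(2) uc])
  have Kb: "K \<in> borel_measurable borel" unfolding K_def using Gr Hu by measurable
  then show "K \<in> borel_measurable \<mm>" by (rule borel_measurable_m)
  let ?w = "\<lambda>x. if x \<in> E then w x else 0"
  have wb: "?w \<in> borel_measurable borel"
    unfolding borel_measurable_iff_ge
  proof
    fix b
    have "{x\<in>E. b \<le> w x} \<in> sets borel"
      unfolding w_def r_def
      by (rule borel_gradient_superlevel[OF u']) (use unit E E_borel in \<open>auto simp: r_def\<close>)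
    moreover have "{x\<in>space borel. b \<le> ?w x} = {x\<in>E. b \<le> w x} \<union> (if b \<le> 0 then - E else {})" by auto
    ultimately show "{x\<in>space borel. b \<le> ?w x} \<in> sets borel" using E_borel by (auto intro!: sets.Un borel_comp)
  qed
  \<comment> \<open>Outside E the default values decide: where r is not differentiable the gradient
    is 0 and only G'(r) H(u) remains, and the pole contributes a single value.\<close>
  have J_eq: "J = (\<lambda>x. if x \<in> E then - K x * ?w x else if x = pole then J pole else deriv G (r x) * H (u x))"
  proof
    fix x
    have "J x = deriv G (r x) * H (u x)" if "x \<notin> E" "x \<noteq> pole"
    proof -
      have "\<not> diff_at r x" using that by (simp add: E_def)
      then show ?thesis unfolding J_def gradient_not_diff[OF \<open>\<not> diff_at r x\<close>] differential_zero_vector by simp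
    qed
    then show "J x = (if x \<in> E then - K x * ?w x else if x = pole then J pole else deriv G (r x) * H (u x))"
      using JE by auto
  qed
  have "J \<in> borel_measurable borel"
  proof (subst J_eq, intro measurable_If)
    show "{x \<in> space borel. x \<in> E} \<in> sets borel" using E_borel by simp
    show "(\<lambda>x. - K x * ?w x) \<in> borel_measurable borel" using Kb wb by measurable
    show "(\<lambda>x. deriv G (r x) * H (u x)) \<in> borel_measurable borel" using dGr Hu by measurable
    show "{x \<in> space borel. x = pole} \<in> sets borel" by simp
  qed simp
  then show "J \<in> borel_measurable \<mm>" by (rule borel_measurable_m)
qed

end

theorem theorem4p1:
  fixes A :: "('a::{second_countable_topology,t2_space}, 'n::finite) chart set"
    and F :: "'a \<Rightarrow> ('a, 'n) tvec \<Rightarrow> real"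
    and \<mm> :: "'a measure"
    and pole :: 'a
    and r :: "'a \<Rightarrow> real"
    and \<Omega> :: "'a set"
    and R :: ereal
    and p p' :: real
    and G H :: "real \<Rightarrow> real"
  assumes "finsler_measure_space A F \<mm>"
    and "forward_complete A F"
    and r_def: "r = finsler_dist A F pole"
    and \<Omega>_def: "\<Omega> = UNIV - {pole}"
    and R_def: "R = (SUP x\<in>\<Omega>. ereal (r x))"
    and "1 < p" and "p < real CARD('n)"
    and p'_def: "p' = p / (p - 1)"
    and "C1_fun_on {t. 0 < t \<and> ereal t < R} G"
    and "C1_fun_on UNIV H"
    and "Lq_loc \<mm> p' \<Omega> (\<lambda>x. G (r x))"
    and "Lq_loc \<mm> 1 \<Omega> (\<lambda>x. deriv G (r x))"
    and "H 0 = 0" and "deriv H 0 = 0"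
  shows "\<forall>u. compactly_supported_smooth A u \<longrightarrow>
    (let lhs = (\<integral>x. max_dual_powr A F p u x \<partial>\<mm>);
         I = weak_laplacian_integral A F \<mm>
               (\<lambda>x. deriv G (r x) * H (u x)) (\<lambda>x. G (r x) * H (u x)) r;
         rhs_a = ereal (p * I) - ereal (p - 1) *
               enn2ereal (\<integral>\<^sup>+x. ennreal (\<bar>G (r x) * deriv H (u x)\<bar> powr p') \<partial>\<mm>);
         rhs_b = \<bar>I\<bar> powr p / (\<integral>x. \<bar>G (r x) * deriv H (u x)\<bar> powr p' \<partial>\<mm>) powr (p - 1)
     in
       (ereal lhs \<ge> rhs_a \<and>
        (ereal lhs = rhs_a \<longleftrightarrow>
           equality_case A F \<mm> p r u (\<lambda>x. G (r x) * deriv H (u x)))) \<and>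
       ((\<exists>N. open N \<and> 0 \<in> N \<and> (\<forall>s\<in>N - {0}. deriv H s \<noteq> 0)) \<and>
        (\<forall>t. 0 < t \<and> ereal t < R \<longrightarrow> G t \<noteq> 0) \<longrightarrow>
          lhs \<ge> rhs_b \<and>
          (lhs = rhs_b \<longleftrightarrow>
             (\<exists>\<mu>::real. equality_case A F \<mm> p r u (\<lambda>x. \<mu> * (G (r x) * deriv H (u x)))))))"
proof (intro allI impI)
  fix u assume u: "compactly_supported_smooth A u"
  interpret finsler_measure A F \<mm>
    using assms(1) unfolding finsler_measure_space_def by unfold_locales auto
  have R: "R = (SUP x\<in>UNIV - {pole}. ereal (finsler_dist A F pole x))"
    using R_def unfolding \<Omega>_def r_def .
  note Y = distance_Young[OF R assms(6,9,10) u, folded r_def]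
  interpret integrated_Young \<mm> "max_dual_powr A F p u"
    "\<lambda>x. differential A u x (finsler_gradient A F r x)" "equality_at p r u" p
    by (rule Y(1))
  have eq_case: "equality_case A F \<mm> p r u K \<longleftrightarrow> (AE x in \<mm>. equality_at p r u x (K x))" for K
    unfolding equality_case_def equality_at_def ..
  \<comment> \<open>The weak integrand is J of \<open>distance_Young\<close>, so the two parts are
    the additive and the multiplicative inequality for K = G(r) H'(u).\<close>
  show "let lhs = (\<integral>x. max_dual_powr A F p u x \<partial>\<mm>);
         I = weak_laplacian_integral A F \<mm>
               (\<lambda>x. deriv G (r x) * H (u x)) (\<lambda>x. G (r x) * H (u x)) r;
         rhs_a = ereal (p * I) - ereal (p - 1) *
               enn2ereal (\<integral>\<^sup>+x. ennreal (\<bar>G (r x) * deriv H (u x)\<bar> powr p') \<partial>\<mm>);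
         rhs_b = \<bar>I\<bar> powr p / (\<integral>x. \<bar>G (r x) * deriv H (u x)\<bar> powr p' \<partial>\<mm>) powr (p - 1)
     in
       (ereal lhs \<ge> rhs_a \<and>
        (ereal lhs = rhs_a \<longleftrightarrow>
           equality_case A F \<mm> p r u (\<lambda>x. G (r x) * deriv H (u x)))) \<and>
       ((\<exists>N. open N \<and> 0 \<in> N \<and> (\<forall>s\<in>N - {0}. deriv H s \<noteq> 0)) \<and>
        (\<forall>t. 0 < t \<and> ereal t < R \<longrightarrow> G t \<noteq> 0) \<longrightarrow>
          lhs \<ge> rhs_b \<and>
          (lhs = rhs_b \<longleftrightarrow>
             (\<exists>\<mu>::real. equality_case A F \<mm> p r u (\<lambda>x. \<mu> * (G (r x) * deriv H (u x))))))"
    unfolding Let_def weak_laplacian_integral_def eq_case p'_def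
    using additive_inequality[OF Y(2-4)] multiplicative_inequality[OF Y(2-4)] by blast
qed

end
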